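(* Let $$X_{\Gamma,\Omega}=\Big\{(x,y,z,t_2,t_4)\in\mathbb{C}^3\times\mathbb{C}^2\ \Big|\ z^4+t_2z^2+t_4+\tfrac18t_2^2=xy\Big\},$$ let $\alpha^\Omega:X_{\Gamma,\Omega}\to(\mathfrak{h}/W)^\Omega=\mathbb{C}^2$, $(x,y,z,t_2,t_4)\mapsto(t_2,t_4)$, be the semiuniversal deformation of the simple singularity of type $B_2=(A_3,\mathbb{Z}/2\mathbb{Z})$, and let $\Omega=\mathbb{Z}/2\mathbb{Z}=\langle\sigma\rangle$ act on $X_{\Gamma,\Omega}$ by $\sigma.(x,y,z,t_2,t_4)=(y,x,-z,t_2,t_4)$. Then every fibre of the quotient morphism $\overline{\alpha^\Omega}:X_{\Gamma,\Omega}/\Omega\to(\mathfrak{h}/W)^\Omega$, which is a deformation of a simple singularity of type $D_4$, is singular.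
   Context: The base field is $\mathbb{C}$. Here $\Gamma=\mathcal{C}_4$ is the cyclic group of order 4 and $\Gamma'=\mathcal{D}_2$ the binary dihedral group of order 8 in $\mathrm{SU}_2$, $\Omega=\Gamma'/\Gamma$; $\mathfrak{h}$ is a Cartan subalgebra of type $A_3$ and $W$ its Weyl group, with $(\mathfrak{h}/W)^\Omega$ identified with $\mathbb{C}^2$ through the coordinates $(t_2,t_4)$. Since $\alpha^\Omega$ is $\Omega$-invariant, $\Omega$ acts on each fibre; $\overline{\alpha^\Omega}$ is the map induced on the quotient variety, and its fibre over $(t_2,t_4)$ is the quotient of $(\alpha^\Omega)^{-1}(t_2,t_4)$ by $\Omega$. A fibre is singular if it has at least one singular point. *)

theory Defs
  imports
    Complex_Main
    "HOL-Library.FuncSet"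
    "HOL-Library.Function_Algebras"
    "HOL-Library.Poly_Mapping"
    "HOL-Library.Extended_Nat"
    "HOL-Algebra.Ideal"
    "HOL-Algebra.Module"
begin

section \<open>Complex affine varieties as spaces with functions\<close>

text \<open>
  An affine variety over the complex numbers is represented by its set of closed points together
  with its algebra of regular functions. Regular functions are extensional, i.e. undefined outside
  the set of points, so that equality in the coordinate ring is equality of HOL functions.
\<close>

record 'a variety =
  points :: "'a set"
  regfuns :: "('a \<Rightarrow> complex) set"

inductive_set polyfuns :: "('a \<Rightarrow> complex) set \<Rightarrow> ('a \<Rightarrow> complex) set"
  for coords :: "('a \<Rightarrow> complex) set" where
  coord: "f \<in> coords \<Longrightarrow> f \<in> polyfuns coords"
| const: "(\<lambda>_. c) \<in> polyfuns coords"
| add: "f \<in> polyfuns coords \<Longrightarrow> g \<in> polyfuns coords \<Longrightarrow> (\<lambda>p. f p + g p) \<in> polyfuns coords"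
| mult: "f \<in> polyfuns coords \<Longrightarrow> g \<in> polyfuns coords \<Longrightarrow> (\<lambda>p. f p * g p) \<in> polyfuns coords"

definition affine_variety :: "('a \<Rightarrow> complex) set \<Rightarrow> 'a set \<Rightarrow> 'a variety" where
  "affine_variety coords S =
     \<lparr>points = S, regfuns = (\<lambda>f. restrict f S) ` polyfuns coords\<rparr>"

definition coord_ring :: "'a variety \<Rightarrow> ('a \<Rightarrow> complex) ring" where
  "coord_ring V =
     \<lparr>carrier = regfuns V,
      monoid.mult = (\<lambda>f g. \<lambda>p\<in>points V. f p * g p),
      one = (\<lambda>p\<in>points V. 1),
      zero = (\<lambda>p\<in>points V. 0),
      add = (\<lambda>f g. \<lambda>p\<in>points V. f p + g p)\<rparr>"

definition pullback :: "'a variety \<Rightarrow> ('a \<Rightarrow> 'b) \<Rightarrow> ('b \<Rightarrow> complex) \<Rightarrow> 'a \<Rightarrow> complex" where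
  "pullback V \<phi> f = (\<lambda>p\<in>points V. f (\<phi> p))"

definition variety_morphism :: "'a variety \<Rightarrow> 'b variety \<Rightarrow> ('a \<Rightarrow> 'b) \<Rightarrow> bool" where
  "variety_morphism V W \<phi> \<longleftrightarrow>
     \<phi> ` points V \<subseteq> points W \<and> (\<forall>f\<in>regfuns W. pullback V \<phi> f \<in> regfuns V)"

definition variety_iso :: "'a variety \<Rightarrow> 'b variety \<Rightarrow> bool" where
  "variety_iso V W \<longleftrightarrow>
     (\<exists>\<phi> \<psi>. variety_morphism V W \<phi> \<and> variety_morphism W V \<psi> \<and>
        (\<forall>p\<in>points V. \<psi> (\<phi> p) = p) \<and> (\<forall>q\<in>points W. \<phi> (\<psi> q) = q))"

definition fibre :: "'a variety \<Rightarrow> ('a \<Rightarrow> 'b) \<Rightarrow> 'b \<Rightarrow> 'a variety" where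
  "fibre V \<phi> t =
     (let F = {p \<in> points V. \<phi> p = t}
      in \<lparr>points = F, regfuns = (\<lambda>f. restrict f F) ` regfuns V\<rparr>)"

text \<open>
  The fibre above carries the reduced structure. The following predicate says that this is the
  scheme-theoretic fibre: the ideal of the fibre is generated by the pulled-back maximal ideal
  of \<open>t\<close>.
\<close>

definition reduced_fibre :: "'a variety \<Rightarrow> 'b variety \<Rightarrow> ('a \<Rightarrow> 'b) \<Rightarrow> 'b \<Rightarrow> bool" where
  "reduced_fibre V W \<phi> t \<longleftrightarrow>
     {f \<in> regfuns V. \<forall>p\<in>points V. \<phi> p = t \<longrightarrow> f p = 0} =
     genideal (coord_ring V) (pullback V \<phi> ` {g \<in> regfuns W. g t = 0})"


section \<open>Quotients by finite groups\<close>

text \<open>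
  The monoid generated by a set of transformations; it is a group if, as below, the generators
  are bijections of finite order.
\<close>

inductive_set generated_group :: "('a \<Rightarrow> 'a) set \<Rightarrow> ('a \<Rightarrow> 'a) set"
  for S :: "('a \<Rightarrow> 'a) set" where
  id: "id \<in> generated_group S"
| comp: "s \<in> S \<Longrightarrow> g \<in> generated_group S \<Longrightarrow> s \<circ> g \<in> generated_group S"

definition group_orbit :: "('a \<Rightarrow> 'a) set \<Rightarrow> 'a \<Rightarrow> 'a set" where
  "group_orbit G p = (\<lambda>g. g p) ` G"

text \<open>
  For a finite group \<open>G\<close> the closed points of the spectrum of the invariant ring are the orbits,
  and its elements are the functions on orbits whose pullback is regular.
\<close>

definition quotient_variety :: "'a variety \<Rightarrow> ('a \<Rightarrow> 'a) set \<Rightarrow> 'a set variety" where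
  "quotient_variety V G =
     (let Q = group_orbit G ` points V
      in \<lparr>points = Q,
          regfuns = {f \<in> extensional Q. pullback V (group_orbit G) f \<in> regfuns V}\<rparr>)"

definition induced_map :: "('a \<Rightarrow> 'b) \<Rightarrow> 'a set \<Rightarrow> 'b" where
  "induced_map \<phi> = (\<lambda>A. the_elem (\<phi> ` A))"


section \<open>Singular points\<close>

text \<open>
  The Zariski tangent space at \<open>p\<close>: derivations of the coordinate ring with values in the residue
  field at \<open>p\<close>, extended by zero to a total function.
\<close>

definition tangent_space :: "'a variety \<Rightarrow> 'a \<Rightarrow> (('a \<Rightarrow> complex) \<Rightarrow> complex) set" where
  "tangent_space V p =
     {D. (\<forall>f. f \<notin> regfuns V \<longrightarrow> D f = 0) \<and>
         (\<forall>f\<in>regfuns V. \<forall>g\<in>regfuns V. D (f \<oplus>\<^bsub>coord_ring V\<^esub> g) = D f + D g) \<and>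
         (\<forall>c. \<forall>f\<in>regfuns V. D (\<lambda>q\<in>points V. c * f q) = c * D f) \<and>
         (\<forall>f\<in>regfuns V. \<forall>g\<in>regfuns V.
            D (f \<otimes>\<^bsub>coord_ring V\<^esub> g) = f p * D g + g p * D f)}"

definition tangent_dim :: "'a variety \<Rightarrow> 'a \<Rightarrow> nat" where
  "tangent_dim V p = vector_space.dim (\<lambda>(c::complex) D f. c * D f) (tangent_space V p)"

lemma vector_space_functionals:
  "vector_space (\<lambda>(c::complex) (D :: 'b \<Rightarrow> complex) f. c * D f)"
  by unfold_locales (auto simp: fun_eq_iff algebra_simps)

text \<open>
  The dimension of \<open>V\<close> at \<open>p\<close> is the Krull dimension of the local ring at \<open>p\<close>, whose primes
  correspond to the primes of the coordinate ring contained in the maximal ideal of \<open>p\<close>.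
\<close>

definition maximal_ideal_at :: "'a variety \<Rightarrow> 'a \<Rightarrow> ('a \<Rightarrow> complex) set" where
  "maximal_ideal_at V p = {f \<in> regfuns V. f p = 0}"

definition local_dim :: "'a variety \<Rightarrow> 'a \<Rightarrow> enat" where
  "local_dim V p =
     Sup {enat n | n. \<exists>P :: nat \<Rightarrow> ('a \<Rightarrow> complex) set.
            (\<forall>i\<le>n. primeideal (P i) (coord_ring V) \<and> P i \<subseteq> maximal_ideal_at V p) \<and>
            (\<forall>i<n. P i \<subset> P (Suc i))}"

definition singular_point :: "'a variety \<Rightarrow> 'a \<Rightarrow> bool" where
  "singular_point V p \<longleftrightarrow> p \<in> points V \<and> enat (tangent_dim V p) \<noteq> local_dim V p"

definition singular :: "'a variety \<Rightarrow> bool" where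
  "singular V \<longleftrightarrow> (\<exists>p. singular_point V p)"


section \<open>Flatness and deformations\<close>

text \<open>
  For an ideal \<open>I\<close> of \<open>R\<close> the tensor product of \<open>I\<close> and \<open>M\<close> is the free abelian group on
  \<open>I \<times> M\<close> modulo the following subgroup.
\<close>

inductive_set tensor_relations ::
    "('r, 'c) ring_scheme \<Rightarrow> 'r set \<Rightarrow> ('r, 'm, 'd) module_scheme \<Rightarrow> ('r \<times> 'm \<Rightarrow>\<^sub>0 int) set"
  for R (structure) and I and M where
  zero: "0 \<in> tensor_relations R I M"
| diff: "v \<in> tensor_relations R I M \<Longrightarrow> w \<in> tensor_relations R I M \<Longrightarrow>
    v - w \<in> tensor_relations R I M"
| add_left: "r \<in> I \<Longrightarrow> s \<in> I \<Longrightarrow> m \<in> carrier M \<Longrightarrow>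
    Poly_Mapping.single (r \<oplus> s, m) 1 - Poly_Mapping.single (r, m) 1 -
      Poly_Mapping.single (s, m) 1 \<in> tensor_relations R I M"
| add_right: "r \<in> I \<Longrightarrow> m \<in> carrier M \<Longrightarrow> n \<in> carrier M \<Longrightarrow>
    Poly_Mapping.single (r, m \<oplus>\<^bsub>M\<^esub> n) 1 - Poly_Mapping.single (r, m) 1 -
      Poly_Mapping.single (r, n) 1 \<in> tensor_relations R I M"
| scalar: "a \<in> carrier R \<Longrightarrow> r \<in> I \<Longrightarrow> m \<in> carrier M \<Longrightarrow>
    Poly_Mapping.single (a \<otimes> r, m) 1 - Poly_Mapping.single (r, a \<odot>\<^bsub>M\<^esub> m) 1
      \<in> tensor_relations R I M"

text \<open>
  \<open>M\<close> is flat iff for each ideal \<open>I\<close> the multiplication map from the tensor product of \<open>I\<close> and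
  \<open>M\<close> to \<open>M\<close> is injective.
\<close>

definition flat_module :: "('r, 'c) ring_scheme \<Rightarrow> ('r, 'm, 'd) module_scheme \<Rightarrow> bool" where
  "flat_module R M \<longleftrightarrow> Module.module R M \<and>
     (\<forall>I. ideal I R \<longrightarrow>
       (\<forall>w :: 'r \<times> 'm \<Rightarrow>\<^sub>0 int.
          Poly_Mapping.keys w \<subseteq> I \<times> carrier M \<longrightarrow>
          (\<Oplus>\<^bsub>M\<^esub>k\<in>Poly_Mapping.keys w. add_pow M (Poly_Mapping.lookup w k) (fst k \<odot>\<^bsub>M\<^esub> snd k))
            = \<zero>\<^bsub>M\<^esub> \<longrightarrow>
          w \<in> tensor_relations R I M))"

definition pullback_module ::
    "'a variety \<Rightarrow> ('a \<Rightarrow> 'b) \<Rightarrow> ('b \<Rightarrow> complex, 'a \<Rightarrow> complex) module" where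
  "pullback_module V \<phi> =
     ring.extend (coord_ring V) \<lparr>smult = (\<lambda>r m. pullback V \<phi> r \<otimes>\<^bsub>coord_ring V\<^esub> m)\<rparr>"

definition flat_morphism :: "'a variety \<Rightarrow> 'b variety \<Rightarrow> ('a \<Rightarrow> 'b) \<Rightarrow> bool" where
  "flat_morphism V W \<phi> \<longleftrightarrow>
     variety_morphism V W \<phi> \<and> flat_module (coord_ring W) (pullback_module V \<phi>)"

definition deformation ::
    "'a variety \<Rightarrow> 'b variety \<Rightarrow> ('a \<Rightarrow> 'b) \<Rightarrow> 'b \<Rightarrow> 'c variety \<Rightarrow> bool" where
  "deformation V W \<phi> t\<^sub>0 X\<^sub>0 \<longleftrightarrow>
     flat_morphism V W \<phi> \<and> t\<^sub>0 \<in> points W \<and>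
     reduced_fibre V W \<phi> t\<^sub>0 \<and> variety_iso (fibre V \<phi> t\<^sub>0) X\<^sub>0"


section \<open>The deformation of type $B_2$ and its quotient\<close>

type_synonym C2 = "complex \<times> complex"
type_synonym C5 = "complex \<times> complex \<times> complex \<times> complex \<times> complex"

definition coords2 :: "(C2 \<Rightarrow> complex) set" where
  "coords2 = {\<lambda>(u, v). u, \<lambda>(u, v). v}"

definition coords5 :: "(C5 \<Rightarrow> complex) set" where
  "coords5 = {\<lambda>(x, y, z, t2, t4). x, \<lambda>(x, y, z, t2, t4). y, \<lambda>(x, y, z, t2, t4). z,
     \<lambda>(x, y, z, t2, t4). t2, \<lambda>(x, y, z, t2, t4). t4}"

definition affine_plane :: "C2 variety" where
  "affine_plane = affine_variety coords2 UNIV"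

definition X_B2 :: "C5 variety" where
  "X_B2 = affine_variety coords5
     {(x, y, z, t2, t4). z ^ 4 + t2 * z ^ 2 + t4 + 1 / 8 * t2 ^ 2 = x * y}"

definition alpha_B2 :: "C5 \<Rightarrow> C2" where
  "alpha_B2 = (\<lambda>(x, y, z, t2, t4). (t2, t4))"

definition sigma :: "C5 \<Rightarrow> C5" where
  "sigma = (\<lambda>(x, y, z, t2, t4). (y, x, - z, t2, t4))"

definition Omega :: "(C5 \<Rightarrow> C5) set" where
  "Omega = generated_group {sigma}"

definition X_B2_mod_Omega :: "C5 set variety" where
  "X_B2_mod_Omega = quotient_variety X_B2 Omega"

definition alpha_B2_bar :: "C5 set \<Rightarrow> C2" where
  "alpha_B2_bar = induced_map alpha_B2"

text \<open>
  The binary dihedral group of order 8 in $\mathrm{SU}_2$, acting on the plane, is generated by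
  $\mathrm{diag}(i, -i)$ (of order 4) and the matrix with rows $(0, 1)$ and $(-1, 0)$. The simple
  singularity of type $D_4$ is the corresponding quotient of the plane.
\<close>

definition binary_dihedral_8 :: "(C2 \<Rightarrow> C2) set" where
  "binary_dihedral_8 =
     generated_group {\<lambda>(u, v). (\<i> * u, - \<i> * v), \<lambda>(u, v). (v, - u)}"

definition singularity_D4 :: "C2 set variety" where
  "singularity_D4 = quotient_variety affine_plane binary_dihedral_8"

end

theory Submission
  imports Defs "HOL-Computational_Algebra.Polynomial" "HOL-Analysis.Derivative"
begin

text \<open>
  The involution negates \<open>b = x - y\<close> and \<open>z\<close>, so its invariants are generated by \<open>a = x + y\<close>,
  \<open>w = z\<^sup>2\<close>, \<open>v = b z\<close> and the parameters, and the quotient is the family of surfaces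
  \<open>v\<^sup>2 = w (a\<^sup>2 - 4 (w\<^sup>2 + t\<^sub>2 w + t\<^sub>4 + t\<^sub>2\<^sup>2 / 8))\<close> (lemmas \<open>X_B2_mod_Omega_eq\<close> and
  \<open>fibre_set_bij\<close>). Each fibre of this family
  contains the point \<open>w = v = 0\<close>, \<open>a\<^sup>2 = 4 (t\<^sub>4 + t\<^sub>2\<^sup>2 / 8)\<close>, the image of a fixed point of the
  involution, where the equation has no linear term. The tangent space has dimension 3 there (lemma
  \<open>tangent_dim_3\<close>), while a surface has Krull dimension 2, so the fibre is singular.

  The monomials \<open>a\<^sup>i w\<^sup>j\<close> and \<open>a\<^sup>i w\<^sup>j v\<close> form a basis of the coordinate ring over the polynomials in
  the parameters, and they stay independent on each fibre (lemmas \<open>quot_normal_form\<close> and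
  \<open>quot_basis_independent\<close>). Freeness gives flatness (lemma \<open>flat_module_of_basis\<close>), and independence
  on the fibre shows that the scheme-theoretic fibre is reduced. The fibre over the origin is
  \<open>v\<^sup>2 = w (a\<^sup>2 - 4 w\<^sup>2)\<close>. On the other side, the plane modulo the cyclic group of order 4 is
  \<open>x y = z\<^sup>4\<close> with \<open>x = u\<^sup>4\<close>, \<open>y = v\<^sup>4\<close>, \<open>z = u v\<close>, on which the binary dihedral group acts through the same
  involution; hence its quotient is the same surface (lemma \<open>zero_fibre_iso\<close>).

  The upper bound for the Krull dimension (lemma \<open>local_dim_le_2\<close>) comes from counting. The functions
  of degree at most \<open>n\<close> on a fibre form a space of dimension quadratic in \<open>n\<close>, hence any three
  functions satisfy a polynomial relation, and along a chain of four primes such a relation would put a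
  nonzero constant into the last one.
\<close>

section \<open>Regular functions on affine varieties\<close>

text \<open>
  Agreement with a polynomial is demanded on \<open>S\<close> only, so that total functions can be added and
  multiplied without restricting them after each step.
\<close>

definition regular_on :: "('a \<Rightarrow> complex) set \<Rightarrow> 'a set \<Rightarrow> ('a \<Rightarrow> complex) set" where
  "regular_on C S = {f. \<exists>g\<in>polyfuns C. \<forall>p\<in>S. f p = g p}"

lemma regular_on_polyfun: "f \<in> polyfuns C \<Longrightarrow> f \<in> regular_on C S"
  by (auto simp: regular_on_def)

lemma regular_on_coord: "f \<in> C \<Longrightarrow> f \<in> regular_on C S"
  by (intro regular_on_polyfun polyfuns.coord)

lemma regular_on_const: "(\<lambda>p. c) \<in> regular_on C S"
  by (intro regular_on_polyfun polyfuns.const)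

lemma regular_on_add:
  assumes "f \<in> regular_on C S" "g \<in> regular_on C S"
  shows "(\<lambda>p. f p + g p) \<in> regular_on C S"
proof -
  from assms obtain f' g' where "f' \<in> polyfuns C" "\<forall>p\<in>S. f p = f' p"
    "g' \<in> polyfuns C" "\<forall>p\<in>S. g p = g' p" by (auto simp: regular_on_def)
  thus ?thesis unfolding regular_on_def
    by (intro CollectI bexI[of _ "\<lambda>p. f' p + g' p"]) (auto intro: polyfuns.add)
qed

lemma regular_on_mult:
  assumes "f \<in> regular_on C S" "g \<in> regular_on C S"
  shows "(\<lambda>p. f p * g p) \<in> regular_on C S"
proof -
  from assms obtain f' g' where "f' \<in> polyfuns C" "\<forall>p\<in>S. f p = f' p"
    "g' \<in> polyfuns C" "\<forall>p\<in>S. g p = g' p" by (auto simp: regular_on_def)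
  thus ?thesis unfolding regular_on_def
    by (intro CollectI bexI[of _ "\<lambda>p. f' p * g' p"]) (auto intro: polyfuns.mult)
qed

lemma regular_on_uminus: "f \<in> regular_on C S \<Longrightarrow> (\<lambda>p. - f p) \<in> regular_on C S"
  using regular_on_mult[OF regular_on_const[of "-1"], of f] by simp

lemma regular_on_diff:
  "f \<in> regular_on C S \<Longrightarrow> g \<in> regular_on C S \<Longrightarrow> (\<lambda>p. f p - g p) \<in> regular_on C S"
  using regular_on_add[OF _ regular_on_uminus, of f C S g] by simp

lemma regular_on_power: "f \<in> regular_on C S \<Longrightarrow> (\<lambda>p. f p ^ n) \<in> regular_on C S"
  by (induction n) (auto intro: regular_on_mult regular_on_const)

lemma regular_on_sum:
  "(\<And>i. i \<in> I \<Longrightarrow> f i \<in> regular_on C S) \<Longrightarrow> (\<lambda>p. \<Sum>i\<in>I. f i p) \<in> regular_on C S"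
  by (induction I rule: infinite_finite_induct) (auto intro: regular_on_add regular_on_const)

lemmas regular_on_intros = regular_on_const regular_on_add regular_on_mult regular_on_uminus
  regular_on_diff regular_on_power regular_on_sum

lemma regular_on_cong:
  "f \<in> regular_on C S \<Longrightarrow> (\<And>p. p \<in> S \<Longrightarrow> g p = f p) \<Longrightarrow> g \<in> regular_on C S"
  by (auto simp: regular_on_def)

lemma regular_on_restrict [simp]: "restrict f S \<in> regular_on C S \<longleftrightarrow> f \<in> regular_on C S"
  by (auto simp: regular_on_def)

lemma regular_on_UNIV: "regular_on C UNIV = polyfuns C"
  by (auto simp: regular_on_def fun_eq_iff[symmetric])

lemma regular_on_comp:
  assumes "f \<in> regular_on C' S'" "\<And>p. p \<in> S \<Longrightarrow> \<phi> p \<in> S'"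
    and C: "\<And>g. g \<in> C' \<Longrightarrow> (\<lambda>p. g (\<phi> p)) \<in> regular_on C S"
  shows "(\<lambda>p. f (\<phi> p)) \<in> regular_on C S"
proof -
  from assms(1) obtain f' where f': "f' \<in> polyfuns C'" "\<forall>p\<in>S'. f p = f' p"
    by (auto simp: regular_on_def)
  from f'(1) have "(\<lambda>p. f' (\<phi> p)) \<in> regular_on C S"
    by induction (auto intro: C regular_on_intros)
  thus ?thesis
    by (rule regular_on_cong) (use f' assms(2) in auto)
qed

lemma regular_on_change_coords:
  assumes "f \<in> regular_on C' S" "\<And>g. g \<in> C' \<Longrightarrow> g \<in> regular_on C S"
  shows "f \<in> regular_on C S"
  using regular_on_comp[of f C' S S "\<lambda>p. p" C] assms by auto

lemma points_affine_variety [simp]: "points (affine_variety C S) = S"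
  by (simp add: affine_variety_def)

lemma regfuns_affine_variety:
  "regfuns (affine_variety C S) = extensional S \<inter> regular_on C S"
proof -
  have "f \<in> (\<lambda>f. restrict f S) ` polyfuns C \<longleftrightarrow> f \<in> extensional S \<and> f \<in> regular_on C S" for f
    by (auto simp: regular_on_def image_iff extensional_def fun_eq_iff)
  thus ?thesis by (auto simp: affine_variety_def)
qed

lemma restrict_in_regfuns [simp]:
  "restrict f S \<in> regfuns (affine_variety C S) \<longleftrightarrow> f \<in> regular_on C S"
  by (auto simp: regfuns_affine_variety regular_on_def)

lemma affine_variety_eqI:
  assumes "\<And>g. g \<in> C \<Longrightarrow> g \<in> regular_on C' S" "\<And>g. g \<in> C' \<Longrightarrow> g \<in> regular_on C S"
  shows "affine_variety C S = affine_variety C' S"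
proof -
  have "regfuns (affine_variety C S) = regfuns (affine_variety C' S)"
    unfolding regfuns_affine_variety using assms by (auto intro: regular_on_change_coords)
  thus ?thesis by (simp add: affine_variety_def)
qed

lemma fibre_affine_variety:
  "fibre (affine_variety C S) \<phi> t = affine_variety C {p \<in> S. \<phi> p = t}"
  unfolding fibre_def Let_def affine_variety_def
  by (auto simp: image_image intro!: arg_cong2[where f=variety.make] image_cong)

lemma variety_morphism_affine:
  assumes "\<And>p. p \<in> S \<Longrightarrow> \<phi> p \<in> S'"
    and "\<And>g. g \<in> C' \<Longrightarrow> (\<lambda>p. g (\<phi> p)) \<in> regular_on C S"
  shows "variety_morphism (affine_variety C S) (affine_variety C' S') \<phi>"
  unfolding variety_morphism_def
proof safe
  fix f assume "f \<in> regfuns (affine_variety C' S')"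
  hence "f \<in> regular_on C' S'" by (simp add: regfuns_affine_variety)
  hence "(\<lambda>p. f (\<phi> p)) \<in> regular_on C S"
    by (rule regular_on_comp) (use assms in auto)
  thus "pullback (affine_variety C S) \<phi> f \<in> regfuns (affine_variety C S)"
    by (simp add: pullback_def)
qed (use assms in auto)


section \<open>Coordinate rings and their ideals\<close>

lemma coord_ring_simps [simp]:
  "carrier (coord_ring V) = regfuns V"
  "zero (coord_ring V) = (\<lambda>p\<in>points V. 0)"
  "one (coord_ring V) = (\<lambda>p\<in>points V. 1)"
  "f \<oplus>\<^bsub>coord_ring V\<^esub> g = (\<lambda>p\<in>points V. f p + g p)"
  "f \<otimes>\<^bsub>coord_ring V\<^esub> g = (\<lambda>p\<in>points V. f p * g p)"
  by (simp_all add: coord_ring_def)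

lemma regfuns_extensional: "f \<in> regfuns (affine_variety C S) \<Longrightarrow> (\<lambda>p\<in>S. f p) = f"
  by (auto simp: regfuns_affine_variety extensional_restrict)

lemma cring_coord_ring: "cring (coord_ring (affine_variety C S))"
proof (rule cringI)
  show "abelian_group (coord_ring (affine_variety C S))"
  proof (rule abelian_groupI)
    fix f assume f: "f \<in> carrier (coord_ring (affine_variety C S))"
    hence "(\<lambda>p\<in>S. - f p) \<in> carrier (coord_ring (affine_variety C S))"
      by (auto simp: regfuns_affine_variety intro: regular_on_intros)
    moreover have "(\<lambda>p\<in>S. - f p) \<oplus>\<^bsub>coord_ring (affine_variety C S)\<^esub> f
        = \<zero>\<^bsub>coord_ring (affine_variety C S)\<^esub>" by (auto simp: fun_eq_iff)
    ultimately show "\<exists>g\<in>carrier (coord_ring (affine_variety C S)).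
        g \<oplus>\<^bsub>coord_ring (affine_variety C S)\<^esub> f = \<zero>\<^bsub>coord_ring (affine_variety C S)\<^esub>" by blast
  qed (auto simp: regfuns_affine_variety fun_eq_iff extensional_def intro: regular_on_intros)
  show "Group.comm_monoid (coord_ring (affine_variety C S))"
    by (rule comm_monoidI)
       (auto simp: regfuns_affine_variety fun_eq_iff extensional_def intro: regular_on_intros)
qed (auto simp: fun_eq_iff algebra_simps)

lemma ideal_coord_ring_add:
  assumes "ideal J (coord_ring (affine_variety C S))" "restrict f S \<in> J" "restrict g S \<in> J"
  shows "(\<lambda>p\<in>S. f p + g p) \<in> J"
proof -
  have "restrict f S \<oplus>\<^bsub>coord_ring (affine_variety C S)\<^esub> restrict g S \<in> J"
    using assms by (intro additive_subgroup.a_closed[OF ideal.axioms(1)])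
  also have "restrict f S \<oplus>\<^bsub>coord_ring (affine_variety C S)\<^esub> restrict g S
      = (\<lambda>p\<in>S. f p + g p)" by auto
  finally show ?thesis .
qed

lemma ideal_coord_ring_mult:
  assumes "ideal J (coord_ring (affine_variety C S))" "restrict f S \<in> J" "g \<in> regular_on C S"
  shows "(\<lambda>p\<in>S. f p * g p) \<in> J"
proof -
  have "restrict f S \<otimes>\<^bsub>coord_ring (affine_variety C S)\<^esub> restrict g S \<in> J"
    using assms by (intro ideal.I_r_closed) auto
  also have "restrict f S \<otimes>\<^bsub>coord_ring (affine_variety C S)\<^esub> restrict g S
      = (\<lambda>p\<in>S. f p * g p)" by auto
  finally show ?thesis .
qed

lemma ideal_coord_ring_zero:
  assumes "ideal J (coord_ring (affine_variety C S))"
  shows "(\<lambda>p\<in>S. 0) \<in> J"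
  using additive_subgroup.zero_closed[OF ideal.axioms(1)[OF assms]] by simp

lemma ideal_coord_ring_sum:
  assumes "ideal J (coord_ring (affine_variety C S))" "\<And>i. i \<in> I \<Longrightarrow> restrict (f i) S \<in> J"
  shows "(\<lambda>p\<in>S. \<Sum>i\<in>I. f i p) \<in> J"
  using assms(2)
  by (induction I rule: infinite_finite_induct)
     (auto simp: ideal_coord_ring_zero[OF assms(1)] intro: ideal_coord_ring_add[OF assms(1)])

lemma ideal_vanishing:
  assumes "T \<subseteq> S"
  shows "ideal {f \<in> regfuns (affine_variety C S). \<forall>p\<in>T. f p = 0} (coord_ring (affine_variety C S))"
    (is "ideal ?I ?R")
proof -
  interpret cring ?R by (rule cring_coord_ring)
  show ?thesis
  proof (rule idealI)
    show "subgroup ?I (add_monoid ?R)"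
    proof (rule add.subgroupI)
      fix f assume f: "f \<in> ?I"
      have r: "(\<lambda>p\<in>S. - f p) \<in> carrier ?R"
        using f by (auto simp: regfuns_affine_variety intro: regular_on_intros)
      have "(\<lambda>p\<in>S. - f p) \<oplus>\<^bsub>?R\<^esub> f = \<zero>\<^bsub>?R\<^esub>" by (auto simp: fun_eq_iff)
      hence "\<ominus>\<^bsub>?R\<^esub> f = (\<lambda>p\<in>S. - f p)" using f r by (intro minus_equality) auto
      thus "\<ominus>\<^bsub>?R\<^esub> f \<in> ?I" using f r assms by auto
    next
      show "?I \<noteq> {}" using assms
        by (auto intro!: exI[of _ "\<lambda>p\<in>S. 0"] simp: regular_on_const)
    qed (use assms in \<open>auto simp: regfuns_affine_variety intro: regular_on_intros\<close>)
  qed (use assms in \<open>auto simp: ring_axioms regfuns_affine_variety intro: regular_on_intros\<close>)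
qed

lemma finsum_coord_ring:
  assumes "finite I" "\<And>i. i \<in> I \<Longrightarrow> f i \<in> regfuns (affine_variety C S)" "p \<in> S"
  shows "finsum (coord_ring (affine_variety C S)) f I p = (\<Sum>i\<in>I. f i p)"
proof -
  interpret cring "coord_ring (affine_variety C S)" by (rule cring_coord_ring)
  show ?thesis using assms(1,2)
    by (induction I) (use assms(3) in \<open>auto simp: Pi_def\<close>)
qed

lemma add_pow_coord_ring:
  assumes "f \<in> regfuns (affine_variety C S)" "p \<in> S"
  shows "add_pow (coord_ring (affine_variety C S)) (n :: int) f p = of_int n * f p"
proof -
  interpret cring "coord_ring (affine_variety C S)" by (rule cring_coord_ring)
  let ?R = "coord_ring (affine_variety C S)"
  have nat: "add_pow ?R k f p = of_nat k * f p" for k :: nat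
    using assms by (induction k) (auto simp: algebra_simps)
  show ?thesis
  proof (cases n)
    case (nonneg k)
    thus ?thesis using nat[of k] by (simp add: add_pow_def int_pow_int)
  next
    case (neg k)
    define g where "g = add_pow ?R (Suc k) f"
    have g: "g \<in> carrier ?R" using assms unfolding g_def by (intro add.nat_pow_closed) auto
    have "add_pow ?R n f = \<ominus>\<^bsub>?R\<^esub> g"
      using neg assms unfolding g_def by (metis add.int_pow_neg_int coord_ring_simps(1))
    moreover have "\<ominus>\<^bsub>?R\<^esub> g \<oplus>\<^bsub>?R\<^esub> g = \<zero>\<^bsub>?R\<^esub>" using g by (rule l_neg)
    hence "(\<ominus>\<^bsub>?R\<^esub> g) p + g p = 0"
      using assms(2) by (auto dest!: fun_cong[of _ _ p])
    moreover have "g p = of_nat (Suc k) * f p" unfolding g_def by (rule nat)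
    ultimately have "add_pow ?R n f p = - (of_nat (Suc k) * f p)"
      by (simp only: add_eq_0_iff2)
    also have "\<dots> = of_int n * f p" unfolding neg by (simp add: algebra_simps)
    finally show ?thesis .
  qed
qed


section \<open>Free modules are flat\<close>

lemma pullback_module_simps [simp]:
  "carrier (pullback_module V \<phi>) = regfuns V"
  "zero (pullback_module V \<phi>) = (\<lambda>p\<in>points V. 0)"
  "f \<oplus>\<^bsub>pullback_module V \<phi>\<^esub> g = (\<lambda>p\<in>points V. f p + g p)"
  "r \<odot>\<^bsub>pullback_module V \<phi>\<^esub> m = (\<lambda>p\<in>points V. pullback V \<phi> r p * m p)"
  "finsum (pullback_module V \<phi>) h I = finsum (coord_ring V) h I"
  by (simp_all add: pullback_module_def ring.defs coord_ring_def finsum_def finprod_def)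

lemma add_pow_pullback_module [simp]:
  "add_pow (pullback_module V \<phi>) (n :: int) f = add_pow (coord_ring V) n f"
  by (cases "n < 0")
     (simp_all add: pullback_module_def ring.defs coord_ring_def add_pow_def
       int_pow_def nat_pow_def m_inv_def)

lemma module_pullback_module:
  assumes "variety_morphism (affine_variety C S) (affine_variety C' S') \<phi>"
  shows "Module.module (coord_ring (affine_variety C' S')) (pullback_module (affine_variety C S) \<phi>)"
proof -
  let ?V = "affine_variety C S"
  interpret V: cring "coord_ring ?V" by (rule cring_coord_ring)
  have pb: "pullback ?V \<phi> f \<in> regular_on C S" if "f \<in> regular_on C' S'" for f
  proof -
    have "pullback ?V \<phi> (restrict f S') \<in> regfuns ?V"
      using assms that by (simp add: variety_morphism_def)
    moreover have "pullback ?V \<phi> (restrict f S') = pullback ?V \<phi> f"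
      using assms by (auto simp: variety_morphism_def pullback_def fun_eq_iff)
    ultimately show ?thesis by (simp add: regfuns_affine_variety)
  qed
  show ?thesis
  proof (rule moduleI)
    show "abelian_group (pullback_module ?V \<phi>)"
    proof (rule abelian_groupI)
      fix f assume "f \<in> carrier (pullback_module ?V \<phi>)"
      thus "\<exists>g\<in>carrier (pullback_module ?V \<phi>).
          g \<oplus>\<^bsub>pullback_module ?V \<phi>\<^esub> f = \<zero>\<^bsub>pullback_module ?V \<phi>\<^esub>"
        using V.l_neg[of f] V.a_inv_closed[of f] by auto
    qed (auto simp: regfuns_affine_variety fun_eq_iff extensional_def intro: regular_on_intros)
  next
    fix r m assume "r \<in> carrier (coord_ring (affine_variety C' S'))"
      "m \<in> carrier (pullback_module ?V \<phi>)"
    hence "(\<lambda>p. pullback ?V \<phi> r p * m p) \<in> regular_on C S"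
      by (intro regular_on_mult pb) (auto simp: regfuns_affine_variety)
    thus "r \<odot>\<^bsub>pullback_module ?V \<phi>\<^esub> m \<in> carrier (pullback_module ?V \<phi>)" by simp
  qed (use assms in \<open>auto simp: regfuns_affine_variety fun_eq_iff algebra_simps extensional_def
         pullback_def variety_morphism_def cring_coord_ring\<close>)
qed

lemma tensor_relations_uminus: "x \<in> tensor_relations R I M \<Longrightarrow> - x \<in> tensor_relations R I M"
  using tensor_relations.diff[OF tensor_relations.zero, of x R I M] by simp

lemma tensor_relations_add:
  "x \<in> tensor_relations R I M \<Longrightarrow> y \<in> tensor_relations R I M \<Longrightarrow> x + y \<in> tensor_relations R I M"
  using tensor_relations.diff[OF _ tensor_relations_uminus, of x R I M y] by simp

lemma tensor_relations_sum:
  "(\<And>i. i \<in> A \<Longrightarrow> f i \<in> tensor_relations R I M) \<Longrightarrow> (\<Sum>i\<in>A. f i) \<in> tensor_relations R I M"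
  by (induction A rule: infinite_finite_induct)
     (auto intro: tensor_relations_add tensor_relations.zero)

lemma tensor_relations_cmul:
  assumes "x \<in> tensor_relations R I M"
  shows "frag_cmul n x \<in> tensor_relations R I M"
proof -
  have nat: "frag_cmul (int k) x \<in> tensor_relations R I M" for k
    by (induction k)
       (use assms in \<open>auto simp: frag_cmul_distrib intro: tensor_relations_add tensor_relations.zero\<close>)
  show ?thesis
  proof (cases n)
    case (nonneg k)
    thus ?thesis using nat by simp
  next
    case (neg k)
    hence "frag_cmul n x = - frag_cmul (int (Suc k)) x" by simp
    thus ?thesis using nat[of "Suc k"] by (metis tensor_relations_uminus)
  qed
qed

lemma tensor_relations_trans_add:
  "x - (u + v) \<in> tensor_relations R I M \<Longrightarrow> v - s \<in> tensor_relations R I M \<Longrightarrow>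
     x - (u + s) \<in> tensor_relations R I M"
  using tensor_relations_add[of "x - (u + v)" R I M "v - s"] by (simp add: algebra_simps)

lemma tensor_relations_cancel:
  assumes "z - (a + b) \<in> tensor_relations R I M" "z \<in> tensor_relations R I M"
    "b - c \<in> tensor_relations R I M"
  shows "a + c \<in> tensor_relations R I M"
  using tensor_relations.diff[OF tensor_relations.diff[OF assms(2,1)] assms(3)]
  by (simp add: algebra_simps)

lemma frag_cmul_diff_right: "frag_cmul n (x - y) = frag_cmul n x - frag_cmul n y"
  by (rule poly_mapping_eqI) (simp add: lookup_minus algebra_simps)

lemma tensor_relations_trans0:
  "x - y \<in> tensor_relations R I M \<Longrightarrow> y \<in> tensor_relations R I M \<Longrightarrow> x \<in> tensor_relations R I M"
  using tensor_relations_add[of "x - y" R I M "y"] by simp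

text \<open>
  Modulo the relations, a second tensor factor expands in the basis and its coefficients move to the
  first factor. An element of the tensor product thus becomes a sum of terms \<open>(r\<^sub>b, b)\<close>, one for
  each basis element, and independence of the basis makes all \<open>r\<^sub>b\<close> vanish once the product is zero.
\<close>

lemma flat_module_of_basis:
  fixes B :: "'i \<Rightarrow> 'a \<Rightarrow> complex" and \<phi> :: "'a \<Rightarrow> 'b"
  assumes \<phi>: "variety_morphism (affine_variety C S) (affine_variety C' S') \<phi>"
    and B: "\<And>i. B i \<in> regular_on C S"
    and span: "\<And>f. f \<in> regular_on C S \<Longrightarrow> \<exists>F c. finite F \<and> (\<forall>i. c i \<in> regular_on C' S') \<and>
          (\<forall>p\<in>S. f p = (\<Sum>i\<in>F. c i (\<phi> p) * B i p))"
    and indep: "\<And>F c. finite F \<Longrightarrow> (\<And>i. c i \<in> regular_on C' S') \<Longrightarrow>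
          (\<And>p. p \<in> S \<Longrightarrow> (\<Sum>i\<in>F. c i (\<phi> p) * B i p) = 0) \<Longrightarrow> \<forall>i\<in>F. \<forall>t\<in>S'. c i t = 0"
  shows "flat_module (coord_ring (affine_variety C' S')) (pullback_module (affine_variety C S) \<phi>)"
    (is "flat_module ?R ?M")
  unfolding flat_module_def
proof (intro conjI allI impI)
  show "Module.module ?R ?M" by (rule module_pullback_module[OF \<phi>])
next
  fix I and w :: "('b \<Rightarrow> complex) \<times> ('a \<Rightarrow> complex) \<Rightarrow>\<^sub>0 int"
  assume I: "ideal I ?R" and keys: "Poly_Mapping.keys w \<subseteq> I \<times> carrier ?M"
    and rel: "(\<Oplus>\<^bsub>?M\<^esub>k\<in>Poly_Mapping.keys w.
       add_pow ?M (Poly_Mapping.lookup w k) (fst k \<odot>\<^bsub>?M\<^esub> snd k)) = \<zero>\<^bsub>?M\<^esub>"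
  let ?T = "tensor_relations ?R I ?M"
  have \<phi>S: "\<phi> p \<in> S'" if "p \<in> S" for p
    using \<phi> that by (auto simp: variety_morphism_def)
  have I_reg: "r \<in> regular_on C' S'" if "r \<in> I" for r
    using ideal.Icarr[OF I that] by (simp add: regfuns_affine_variety)
  have I_ext: "restrict r S' = r" if "r \<in> I" for r
    using ideal.Icarr[OF I that] regfuns_extensional by auto
  have I_mult: "(\<lambda>t\<in>S'. g t * r t) \<in> I" if "r \<in> I" "g \<in> regular_on C' S'" for r g
    using ideal_coord_ring_mult[OF I, of r g] that I_ext by (simp add: mult.commute)
  have left0: "frag_of (\<lambda>t\<in>S'. 0, m) \<in> ?T" if m: "m \<in> carrier ?M" for m
  proof -
    have "frag_of ((\<lambda>t\<in>S'. 0) \<oplus>\<^bsub>?R\<^esub> (\<lambda>t\<in>S'. 0), m) - frag_of (\<lambda>t\<in>S'. 0, m) -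
        frag_of (\<lambda>t\<in>S'. 0, m) \<in> ?T"
      using m ideal_coord_ring_zero[OF I] by (intro tensor_relations.add_left)
    moreover have "(\<lambda>t\<in>S'. 0) \<oplus>\<^bsub>?R\<^esub> (\<lambda>t\<in>S'. 0) = (\<lambda>t\<in>S'. 0)" by auto
    ultimately show ?thesis by (auto dest: tensor_relations_uminus)
  qed
  have right0: "frag_of (r, \<lambda>p\<in>S. 0) \<in> ?T" if r: "r \<in> I" for r
  proof -
    have z: "(\<lambda>p\<in>S. 0) \<in> carrier ?M" by (simp add: regular_on_const)
    have "frag_of (r, (\<lambda>p\<in>S. 0) \<oplus>\<^bsub>?M\<^esub> (\<lambda>p\<in>S. 0)) - frag_of (r, \<lambda>p\<in>S. 0) -
        frag_of (r, \<lambda>p\<in>S. 0) \<in> ?T"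
      using r z by (intro tensor_relations.add_right)
    moreover have "(\<lambda>p\<in>S. 0) \<oplus>\<^bsub>?M\<^esub> (\<lambda>p\<in>S. 0) = (\<lambda>p\<in>S. 0)" by auto
    ultimately show ?thesis by (auto dest: tensor_relations_uminus)
  qed
  have left_add: "frag_of (\<lambda>t\<in>S'. r t + s t, m) - (frag_of (r, m) + frag_of (s, m)) \<in> ?T"
    if "r \<in> I" "s \<in> I" "m \<in> carrier ?M" for r s m
    using tensor_relations.add_left[OF that, of ?R] by (simp add: algebra_simps)
  have left_sum: "frag_of (\<lambda>t\<in>S'. \<Sum>a\<in>A. r a t, m) - (\<Sum>a\<in>A. frag_of (r a, m)) \<in> ?T"
    if "finite A" "\<And>a. a \<in> A \<Longrightarrow> r a \<in> I" "m \<in> carrier ?M" for A m and r :: "('b \<Rightarrow> complex) \<times> ('a \<Rightarrow> complex) \<Rightarrow> 'b \<Rightarrow> complex"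
    using that
  proof (induction A)
    case empty
    thus ?case using left0[of m] by (simp only: sum.empty diff_zero)
  next
    case (insert a A)
    let ?s = "\<lambda>t\<in>S'. \<Sum>a\<in>A. r a t"
    have s: "?s \<in> I"
      by (rule ideal_coord_ring_sum[OF I]) (use insert I_ext in auto)
    have "frag_of (\<lambda>t\<in>S'. r a t + ?s t, m) - (frag_of (r a, m) + frag_of (?s, m)) \<in> ?T"
      by (rule left_add[OF insert.prems(1) s insert.prems(2)]) simp
    moreover have "(\<lambda>t\<in>S'. r a t + ?s t) = (\<lambda>t\<in>S'. \<Sum>a\<in>insert a A. r a t)"
      using insert by auto
    moreover have "frag_of (?s, m) - (\<Sum>a\<in>A. frag_of (r a, m)) \<in> ?T"
      by (rule insert.IH) (use insert.prems in blast)+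
    moreover have "(\<Sum>a\<in>insert a A. frag_of (r a, m)) = frag_of (r a, m) + (\<Sum>a\<in>A. frag_of (r a, m))"
      using insert.hyps by (rule sum.insert)
    ultimately show ?case by (simp only: tensor_relations_trans_add)
  qed
  have right_sum: "frag_of (r, \<lambda>p\<in>S. \<Sum>a\<in>A. m a p) - (\<Sum>a\<in>A. frag_of (r, m a)) \<in> ?T"
    if "finite A" "\<And>a. a \<in> A \<Longrightarrow> m a \<in> carrier ?M" "r \<in> I" for A r and m :: "'i \<Rightarrow> 'a \<Rightarrow> complex"
    using that
  proof (induction A)
    case empty
    thus ?case using right0[of r] by (simp only: sum.empty diff_zero)
  next
    case (insert a A)
    let ?s = "\<lambda>p\<in>S. \<Sum>a\<in>A. m a p"
    have s: "?s \<in> carrier ?M"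
      using insert by (auto simp: regfuns_affine_variety intro!: regular_on_intros)
    have "frag_of (r, m a \<oplus>\<^bsub>?M\<^esub> ?s) - (frag_of (r, m a) + frag_of (r, ?s)) \<in> ?T"
      unfolding diff_diff_eq[symmetric]
      by (rule tensor_relations.add_right[OF insert.prems(2) insert.prems(1) s]) simp
    moreover have "m a \<oplus>\<^bsub>?M\<^esub> ?s = (\<lambda>p\<in>S. \<Sum>a\<in>insert a A. m a p)"
      using insert by auto
    moreover have "frag_of (r, ?s) - (\<Sum>a\<in>A. frag_of (r, m a)) \<in> ?T"
      by (rule insert.IH) (use insert.prems in blast)+
    moreover have "(\<Sum>a\<in>insert a A. frag_of (r, m a)) = frag_of (r, m a) + (\<Sum>a\<in>A. frag_of (r, m a))"
      using insert.hyps by (rule sum.insert)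
    ultimately show ?case by (simp only: tensor_relations_trans_add)
  qed
  have left_nat: "frag_of (\<lambda>t\<in>S'. of_nat n * r t, m) - frag_cmul (int n) (frag_of (r, m)) \<in> ?T"
    if r: "r \<in> I" and m: "m \<in> carrier ?M" for n r m
  proof (induction n)
    case 0
    thus ?case using left0[OF m]
      by (simp only: of_nat_0 mult_zero_left frag_cmul_zero diff_zero)
  next
    case (Suc n)
    let ?s = "\<lambda>t\<in>S'. of_nat n * r t"
    have s: "?s \<in> I" by (rule I_mult[OF r regular_on_const])
    have eq: "(\<lambda>t\<in>S'. r t + ?s t) = (\<lambda>t\<in>S'. of_nat (Suc n) * r t)"
      by (auto simp: algebra_simps)
    have "frag_cmul (int (Suc n)) (frag_of (r, m)) = frag_of (r, m) + frag_cmul (int n) (frag_of (r, m))"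
      by (simp add: frag_cmul_distrib)
    thus ?case
      using tensor_relations_trans_add[OF left_add[OF r s m, unfolded eq] Suc] by (simp only:)
  qed
  have left_int: "frag_of (\<lambda>t\<in>S'. of_int n * r t, m) - frag_cmul n (frag_of (r, m)) \<in> ?T"
    if r: "r \<in> I" and m: "m \<in> carrier ?M" for n r m
  proof (cases n rule: int_cases2)
    case (nonneg k)
    thus ?thesis using left_nat[OF that, of k] by simp
  next
    case (nonpos k)
    let ?r = "\<lambda>t\<in>S'. of_int n * r t" and ?s = "\<lambda>t\<in>S'. of_nat k * r t"
    have I': "?r \<in> I" "?s \<in> I" by (rule I_mult[OF r regular_on_const])+
    have eq: "(\<lambda>t\<in>S'. ?r t + ?s t) = (\<lambda>t\<in>S'. 0)"
      by (auto simp: nonpos)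
    have "frag_of (?r, m) + frag_cmul (int k) (frag_of (r, m)) \<in> ?T"
      by (rule tensor_relations_cancel[OF left_add[OF I' m, unfolded eq] left0[OF m] left_nat[OF that]])
    moreover have "frag_cmul n (frag_of (r, m)) = - frag_cmul (int k) (frag_of (r, m))"
      by (simp add: nonpos)
    ultimately show ?thesis by (simp only: diff_minus_eq_add)
  qed
  let ?K = "Poly_Mapping.keys w"
  define n where "n k = Poly_Mapping.lookup w k" for k
  have Kc: "fst k \<in> I" "snd k \<in> regfuns (affine_variety C S)" if "k \<in> ?K" for k
    using keys that by auto
  have K: "fst k \<in> I" "snd k \<in> regular_on C S" "restrict (snd k) S = snd k" if "k \<in> ?K" for k
  proof -
    show "fst k \<in> I" by (rule Kc(1)[OF that])
    show "snd k \<in> regular_on C S" using Kc(2)[OF that] by (simp add: regfuns_affine_variety)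
    show "restrict (snd k) S = snd k" by (rule regfuns_extensional[OF Kc(2)[OF that]])
  qed
  have "\<forall>k\<in>?K. \<exists>F c. finite F \<and> (\<forall>i. c i \<in> regular_on C' S') \<and>
      (\<forall>p\<in>S. snd k p = (\<Sum>i\<in>F. c i (\<phi> p) * B i p))"
    by (intro ballI span K(2))
  from bchoice[OF this] obtain F where "\<forall>k\<in>?K. \<exists>c. finite (F k) \<and>
      (\<forall>i. c i \<in> regular_on C' S') \<and> (\<forall>p\<in>S. snd k p = (\<Sum>i\<in>F k. c i (\<phi> p) * B i p))" ..
  from bchoice[OF this] obtain c where c: "\<forall>k\<in>?K. finite (F k) \<and>
      (\<forall>i. c k i \<in> regular_on C' S') \<and> (\<forall>p\<in>S. snd k p = (\<Sum>i\<in>F k. c k i (\<phi> p) * B i p))" ..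
  have Fc: "finite (F k)" "c k i \<in> regular_on C' S'"
      "p \<in> S \<Longrightarrow> snd k p = (\<Sum>i\<in>F k. c k i (\<phi> p) * B i p)" if "k \<in> ?K" for k i p
    using bspec[OF c that] by blast+
  define J where "J = (\<Union>k\<in>?K. F k)"
  define d where "d k i = (if i \<in> F k then c k i else (\<lambda>_. 0))" for k i
  have J: "finite J" using Fc(1) by (auto simp: J_def)
  have d: "d k i \<in> regular_on C' S'" if "k \<in> ?K" for k i
    using Fc(2)[OF that] by (simp add: d_def regular_on_const)
  have expand: "snd k p = (\<Sum>i\<in>J. d k i (\<phi> p) * B i p)" if "k \<in> ?K" "p \<in> S" for k p
  proof -
    have "(\<Sum>i\<in>J. d k i (\<phi> p) * B i p) = (\<Sum>i\<in>F k. d k i (\<phi> p) * B i p)"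
      using that J by (intro sum.mono_neutral_right) (auto simp: J_def d_def)
    thus ?thesis using Fc(3)[OF that] by (simp add: d_def)
  qed
  define e where "e k i = (\<lambda>t\<in>S'. d k i t * fst k t)" for k i
  define h where "h i k = (\<lambda>t\<in>S'. of_int (n k) * e k i t)" for k i
  have e: "e k i \<in> I" if "k \<in> ?K" for k i
    unfolding e_def using K(1)[OF that] d[OF that] by (intro I_mult)
  have h: "h i k \<in> I" if "k \<in> ?K" for k i
    unfolding h_def by (rule I_mult[OF e[OF that] regular_on_const])
  let ?B = "\<lambda>i. restrict (B i) S"
  have Bc: "?B i \<in> carrier ?M" for i using B by simp
  \<comment> \<open>Move all coefficients of the second tensor factor to the first one.\<close>
  have step1: "frag_of k - (\<Sum>i\<in>J. frag_of (e k i, ?B i)) \<in> ?T" if k: "k \<in> ?K" for k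
  proof -
    define m where "m i = (\<lambda>p\<in>S. d k i (\<phi> p) * B i p)" for i
    have m: "m i = restrict (d k i) S' \<odot>\<^bsub>?M\<^esub> ?B i" for i
      by (auto simp: m_def pullback_def \<phi>S)
    have mc: "m i \<in> carrier ?M" for i
      unfolding m using module.smult_closed[OF module_pullback_module[OF \<phi>] _ Bc] d[OF k] by simp
    have sum_m: "(\<lambda>p\<in>S. \<Sum>i\<in>J. m i p) = snd k"
      by (subst K(3)[OF k, symmetric], rule restrict_ext) (simp add: m_def expand[OF k, symmetric])
    have *: "frag_of (fst k, snd k) - (\<Sum>i\<in>J. frag_of (fst k, m i)) \<in> ?T"
      using right_sum[where m = m, OF J mc K(1)[OF k]] unfolding sum_m .
    have "frag_of (e k i, ?B i) - frag_of (fst k, m i) \<in> ?T" for i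
    proof -
      have "frag_of (restrict (d k i) S' \<otimes>\<^bsub>?R\<^esub> fst k, ?B i)
          - frag_of (fst k, restrict (d k i) S' \<odot>\<^bsub>?M\<^esub> ?B i) \<in> ?T"
        by (rule tensor_relations.scalar) (use d[OF k] K(1)[OF k] Bc in auto)
      moreover have "restrict (d k i) S' \<otimes>\<^bsub>?R\<^esub> fst k = e k i" by (auto simp: e_def)
      ultimately show ?thesis by (simp only: m)
    qed
    hence "(\<Sum>i\<in>J. frag_of (e k i, ?B i) - frag_of (fst k, m i)) \<in> ?T"
      by (rule tensor_relations_sum)
    from tensor_relations.diff[OF * this] show ?thesis by (simp add: sum_subtractf)
  qed
  have step2: "frag_cmul (n k) (frag_of k) - (\<Sum>i\<in>J. frag_of (h i k, ?B i)) \<in> ?T" if k: "k \<in> ?K" for k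
  proof -
    have "(\<Sum>i\<in>J. frag_of (h i k, ?B i) - frag_cmul (n k) (frag_of (e k i, ?B i))) \<in> ?T"
      unfolding h_def by (intro tensor_relations_sum left_int e k Bc)
    with tensor_relations_cmul[OF step1[OF k], of "n k"]
    have "frag_cmul (n k) (frag_of k - (\<Sum>i\<in>J. frag_of (e k i, ?B i)))
       - (\<Sum>i\<in>J. frag_of (h i k, ?B i) - frag_cmul (n k) (frag_of (e k i, ?B i))) \<in> ?T"
      by (rule tensor_relations.diff)
    thus ?thesis by (simp add: frag_cmul_diff_right frag_cmul_sum sum_subtractf)
  qed
  have step3: "(\<Sum>k\<in>?K. frag_of (h i k, ?B i)) \<in> ?T" if i: "i \<in> J" for i
  proof -
    have "\<forall>i\<in>J. \<forall>t\<in>S'. (\<Sum>k\<in>?K. h i k t) = 0"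
    proof (rule indep[OF J])
      show "(\<lambda>t. \<Sum>k\<in>?K. h i k t) \<in> regular_on C' S'" for i
        using I_reg h by (intro regular_on_sum) auto
    next
      fix p assume p: "p \<in> S"
      have "(\<Sum>i\<in>J. (\<Sum>k\<in>?K. h i k (\<phi> p)) * B i p) =
          (\<Sum>k\<in>?K. of_int (n k) * (fst k (\<phi> p) * (\<Sum>i\<in>J. d k i (\<phi> p) * B i p)))"
        unfolding sum_distrib_right sum_distrib_left
        by (subst sum.swap) (simp add: \<phi>S[OF p] h_def e_def algebra_simps)
      also have "\<dots> = (\<Sum>k\<in>?K. of_int (n k) * (fst k (\<phi> p) * snd k p))"
        using expand[OF _ p] by simp
      also have "\<dots> = (\<Sum>k\<in>?K. add_pow ?M (n k) (fst k \<odot>\<^bsub>?M\<^esub> snd k) p)"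
      proof (rule sum.cong)
        fix k assume k: "k \<in> ?K"
        have "fst k \<odot>\<^bsub>?M\<^esub> snd k \<in> carrier ?M"
          using module.smult_closed[OF module_pullback_module[OF \<phi>]] ideal.Icarr[OF I K(1)[OF k]]
            keys k by auto
        hence "add_pow ?M (n k) (fst k \<odot>\<^bsub>?M\<^esub> snd k) p = of_int (n k) * (fst k \<odot>\<^bsub>?M\<^esub> snd k) p"
          unfolding add_pow_pullback_module using p by (intro add_pow_coord_ring) auto
        thus "of_int (n k) * (fst k (\<phi> p) * snd k p) = add_pow ?M (n k) (fst k \<odot>\<^bsub>?M\<^esub> snd k) p"
          using p by (simp add: pullback_def)
      qed simp
      also have "\<dots> = finsum ?M (\<lambda>k. add_pow ?M (n k) (fst k \<odot>\<^bsub>?M\<^esub> snd k)) ?K p"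
      proof -
        have M: "abelian_group ?M" using module_pullback_module[OF \<phi>] by (simp add: Module.module_def)
        have "add_pow ?M (n k) (fst k \<odot>\<^bsub>?M\<^esub> snd k) \<in> carrier ?M" if k: "k \<in> ?K" for k
        proof -
          interpret abelian_group ?M by (rule M)
          show ?thesis
            using module.smult_closed[OF module_pullback_module[OF \<phi>]] ideal.Icarr[OF I K(1)[OF k]]
            keys k by (intro add.int_pow_closed) auto
        qed
        thus ?thesis unfolding pullback_module_simps(5) using p
          by (intro finsum_coord_ring[symmetric]) auto
      qed
      also have "\<dots> = 0" using rel p by (simp add: n_def)
      finally show "(\<Sum>i\<in>J. (\<Sum>k\<in>?K. h i k (\<phi> p)) * B i p) = 0" .
    qed
    hence eq: "(\<lambda>t\<in>S'. \<Sum>k\<in>?K. h i k t) = (\<lambda>t\<in>S'. 0)" using i by auto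
    have "frag_of (\<lambda>t\<in>S'. \<Sum>k\<in>?K. h i k t, ?B i) - (\<Sum>k\<in>?K. frag_of (h i k, ?B i)) \<in> ?T"
      using left_sum[where r = "h i", OF finite_keys h Bc] .
    from tensor_relations.diff[OF left0[OF Bc[of i]] this[unfolded eq]] show ?thesis by simp
  qed
  have "(\<Sum>k\<in>?K. frag_cmul (n k) (frag_of k) - (\<Sum>i\<in>J. frag_of (h i k, ?B i))) \<in> ?T"
    using step2 by (rule tensor_relations_sum)
  moreover have "(\<Sum>i\<in>J. \<Sum>k\<in>?K. frag_of (h i k, ?B i)) \<in> ?T"
    using step3 by (rule tensor_relations_sum)
  hence "(\<Sum>k\<in>?K. \<Sum>i\<in>J. frag_of (h i k, ?B i)) \<in> ?T" by (subst sum.swap)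
  ultimately have "(\<Sum>k\<in>?K. frag_cmul (n k) (frag_of k)) \<in> ?T"
    unfolding sum_subtractf by (rule tensor_relations_trans0)
  moreover have "(\<Sum>k\<in>?K. frag_cmul (n k) (frag_of k)) = w"
    using frag_expansion[of w] by (simp add: frag_extend_def n_def)
  ultimately show "w \<in> ?T" by simp
qed


section \<open>Quotients in terms of generating invariants\<close>

lemma generated_group_gen: "s \<in> T \<Longrightarrow> s \<in> generated_group T"
  using generated_group.comp[OF _ generated_group.id, of s T] by simp

lemma generated_group_comp:
  "g \<in> generated_group T \<Longrightarrow> h \<in> generated_group T \<Longrightarrow> g \<circ> h \<in> generated_group T"
  by (induction rule: generated_group.induct) (auto simp: o_assoc[symmetric] intro: generated_group.intros)

lemma generated_group_funpow: "s \<in> T \<Longrightarrow> s ^^ n \<in> generated_group T"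
  by (induction n) (auto intro: generated_group.intros)

lemma generated_group_invariant:
  "g \<in> generated_group T \<Longrightarrow> (\<And>s p. s \<in> T \<Longrightarrow> f (s p) = f p) \<Longrightarrow> f (g p) = f p"
  by (induction arbitrary: p rule: generated_group.induct) auto

lemma group_orbit_refl: "p \<in> group_orbit (generated_group T) p"
  unfolding group_orbit_def by (rule image_eqI[OF _ generated_group.id]) simp

lemma group_orbit_generator:
  assumes s: "s \<in> T" and n: "s ^^ Suc n = id"
  shows "group_orbit (generated_group T) (s p) = group_orbit (generated_group T) p"
proof -
  have sub: "group_orbit (generated_group T) (h q) \<subseteq> group_orbit (generated_group T) q"
    if "h \<in> generated_group T" for h q
    unfolding group_orbit_def
  proof safe
    fix g assume "g \<in> generated_group T"
    with that have "g \<circ> h \<in> generated_group T" by (intro generated_group_comp)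
    thus "g (h q) \<in> (\<lambda>g. g q) ` generated_group T" by (rule image_eqI[rotated]) simp
  qed
  have "(s ^^ n) (s p) = p"
    using n by (metis comp_apply funpow_Suc_right id_apply)
  with sub[OF generated_group_funpow[OF s], of n "s p"] sub[OF generated_group_gen[OF s], of p]
  show ?thesis by simp
qed

lemma group_orbit_eq:
  assumes fin: "\<And>s. s \<in> T \<Longrightarrow> \<exists>n. s ^^ Suc n = id" and g: "g \<in> generated_group T"
  shows "group_orbit (generated_group T) (g p) = group_orbit (generated_group T) p"
proof (rule generated_group_invariant[OF g])
  fix s p assume s: "s \<in> T"
  then obtain n where "s ^^ Suc n = id" using fin by blast
  with s show "group_orbit (generated_group T) (s p) = group_orbit (generated_group T) p"
    by (rule group_orbit_generator)
qed

lemma induced_map_orbit: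
  assumes "\<And>s p. s \<in> T \<Longrightarrow> f (s p) = f p"
  shows "induced_map f (group_orbit (generated_group T) p) = f p"
proof -
  have "f ` group_orbit (generated_group T) p = {f p}"
  proof safe
    fix q assume "q \<in> group_orbit (generated_group T) p"
    then obtain g where g: "g \<in> generated_group T" "q = g p" by (auto simp: group_orbit_def)
    have "f (g p) = f p" using g(1) assms by (rule generated_group_invariant)
    thus "f q = f p" by (simp add: g)
  next
    show "f p \<in> f ` group_orbit (generated_group T) p"
      using group_orbit_refl by (rule imageI)
  qed
  thus ?thesis by (simp add: induced_map_def)
qed

text \<open>
  A generating set of the invariants becomes, as functions of orbits, a set of coordinates of the
  quotient. The elements of \<open>T\<close> generate a monoid only; their finite order supplies the inverses, so
  that a point and its images have the same orbit.
\<close>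

lemma quotient_variety_affine:
  assumes fin: "\<And>s. s \<in> T \<Longrightarrow> \<exists>n. s ^^ Suc n = id"
    and S: "\<And>s p. s \<in> T \<Longrightarrow> p \<in> S \<Longrightarrow> s p \<in> S"
    and inv: "\<And>f s p. f \<in> I \<Longrightarrow> s \<in> T \<Longrightarrow> f (s p) = f p"
    and reg: "\<And>f. f \<in> I \<Longrightarrow> f \<in> regular_on C S"
    and gen: "\<And>f. f \<in> regular_on C S \<Longrightarrow> (\<And>s p. s \<in> T \<Longrightarrow> p \<in> S \<Longrightarrow> f (s p) = f p) \<Longrightarrow>
      f \<in> regular_on I S"
  shows "quotient_variety (affine_variety C S) (generated_group T) =
    affine_variety (induced_map ` I) (group_orbit (generated_group T) ` S)"
proof -
  let ?o = "group_orbit (generated_group T)"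
  let ?Q = "?o ` S"
  have ind: "induced_map f (?o p) = f p" if "f \<in> I" for f p
    using inv that by (intro induced_map_orbit) auto
  have "f \<in> regular_on (induced_map ` I) ?Q \<longleftrightarrow> (\<lambda>p. f (?o p)) \<in> regular_on C S" for f
  proof
    assume "f \<in> regular_on (induced_map ` I) ?Q"
    thus "(\<lambda>p. f (?o p)) \<in> regular_on C S"
      by (rule regular_on_comp) (use ind reg in auto)
  next
    assume "(\<lambda>p. f (?o p)) \<in> regular_on C S"
    hence "(\<lambda>p. f (?o p)) \<in> regular_on I S"
    proof (rule gen)
      fix s p assume s: "s \<in> T"
      from s fin obtain n where "s ^^ Suc n = id" by blast
      with s have "?o (s p) = ?o p" by (rule group_orbit_generator)
      thus "f (?o (s p)) = f (?o p)" by simp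
    qed
    then obtain g where g: "g \<in> polyfuns I" "\<And>p. p \<in> S \<Longrightarrow> f (?o p) = g p"
      by (auto simp: regular_on_def)
    from g(1) have "\<exists>h\<in>polyfuns (induced_map ` I). \<forall>p. h (?o p) = g p"
    proof induction
      case (coord f)
      thus ?case using ind by (intro bexI[of _ "induced_map f"]) (auto intro: polyfuns.coord)
    next
      case (const c)
      show ?case by (intro bexI[of _ "\<lambda>_. c"]) (auto intro: polyfuns.const)
    next
      case (add g1 g2)
      then obtain h1 h2 where "h1 \<in> polyfuns (induced_map ` I)" "\<forall>p. h1 (?o p) = g1 p"
        "h2 \<in> polyfuns (induced_map ` I)" "\<forall>p. h2 (?o p) = g2 p" by blast
      thus ?case by (intro bexI[of _ "\<lambda>p. h1 p + h2 p"]) (auto intro: polyfuns.add)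
    next
      case (mult g1 g2)
      then obtain h1 h2 where "h1 \<in> polyfuns (induced_map ` I)" "\<forall>p. h1 (?o p) = g1 p"
        "h2 \<in> polyfuns (induced_map ` I)" "\<forall>p. h2 (?o p) = g2 p" by blast
      thus ?case by (intro bexI[of _ "\<lambda>p. h1 p * h2 p"]) (auto intro: polyfuns.mult)
    qed
    then obtain h where "h \<in> polyfuns (induced_map ` I)" "\<forall>p. h (?o p) = g p" ..
    thus "f \<in> regular_on (induced_map ` I) ?Q"
      unfolding regular_on_def using g(2) by (intro CollectI bexI[of _ h]) auto
  qed
  hence "{f \<in> extensional ?Q. pullback (affine_variety C S) ?o f \<in> regfuns (affine_variety C S)} =
      regfuns (affine_variety (induced_map ` I) ?Q)"
    unfolding regfuns_affine_variety[of "induced_map ` I"] by (auto simp: pullback_def)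
  thus ?thesis
    by (simp add: quotient_variety_def Let_def affine_variety_def)
qed


section \<open>Rings of invariants\<close>

text \<open>
  Let \<open>R\<close> be the ring generated by \<open>I\<close>. Because \<open>b\<^sup>2\<close>, \<open>b z\<close> and \<open>z\<^sup>2\<close> lie in \<open>R\<close>, the ring
  generated by \<open>I\<close>, \<open>b\<close>, \<open>z\<close> is \<open>R + b R + z R\<close>. The involution \<open>s\<close> fixes the first summand and
  negates the two others.
\<close>

lemma invariants_of_sign_change:
  assumes b2: "(\<lambda>p. b p ^ 2) \<in> regular_on I S" and bz: "(\<lambda>p. b p * z p) \<in> regular_on I S"
    and z2: "(\<lambda>p. z p ^ 2) \<in> regular_on I S"
    and s: "\<And>p. p \<in> S \<Longrightarrow> s p \<in> S" "\<And>p. p \<in> S \<Longrightarrow> b (s p) = - b p" "\<And>p. p \<in> S \<Longrightarrow> z (s p) = - z p"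
    and inv: "\<And>g p. g \<in> I \<Longrightarrow> p \<in> S \<Longrightarrow> g (s p) = g p"
    and f: "f \<in> regular_on (insert b (insert z I)) S" "\<And>p. p \<in> S \<Longrightarrow> f (s p) = f p"
  shows "f \<in> regular_on I S"
proof -
  let ?D = "\<lambda>f. \<exists>f0 f1 f2. f0 \<in> regular_on I S \<and> f1 \<in> regular_on I S \<and> f2 \<in> regular_on I S \<and>
     (\<forall>p\<in>S. f p = f0 p + b p * f1 p + z p * f2 p)"
  from f(1) obtain f' where f': "f' \<in> polyfuns (insert b (insert z I))" "\<And>p. p \<in> S \<Longrightarrow> f p = f' p"
    by (auto simp: regular_on_def)
  from f'(1) have "?D f'"
  proof induction
    case (coord g)
    then consider "g = b" | "g = z" | "g \<in> I" by auto
    thus ?case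
    proof cases
      case 1
      thus ?thesis by (intro exI[of _ "\<lambda>_. 0"] exI[of _ "\<lambda>_. 1"]) (auto intro: regular_on_const)
    next
      case 2
      show ?thesis
        by (rule exI[of _ "\<lambda>_. 0"], rule exI[of _ "\<lambda>_. 0"], rule exI[of _ "\<lambda>_. 1"])
           (use 2 in \<open>auto intro: regular_on_const\<close>)
    next
      case 3
      show ?thesis
        by (rule exI[of _ g], rule exI[of _ "\<lambda>_. 0"], rule exI[of _ "\<lambda>_. 0"])
           (use 3 in \<open>auto intro: regular_on_const regular_on_coord\<close>)
    qed
  next
    case (const c)
    show ?case
      by (rule exI[of _ "\<lambda>_. c"], rule exI[of _ "\<lambda>_. 0"], rule exI[of _ "\<lambda>_. 0"])
         (auto intro: regular_on_const)
  next
    case (add f g)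
    then obtain f0 f1 f2 g0 g1 g2 where
      "f0 \<in> regular_on I S" "f1 \<in> regular_on I S" "f2 \<in> regular_on I S"
      "\<forall>p\<in>S. f p = f0 p + b p * f1 p + z p * f2 p"
      "g0 \<in> regular_on I S" "g1 \<in> regular_on I S" "g2 \<in> regular_on I S"
      "\<forall>p\<in>S. g p = g0 p + b p * g1 p + z p * g2 p"
      by (elim exE conjE)
    thus ?case
      by (intro exI[of _ "\<lambda>p. f0 p + g0 p"] exI[of _ "\<lambda>p. f1 p + g1 p"] exI[of _ "\<lambda>p. f2 p + g2 p"])
         (auto intro: regular_on_add simp: algebra_simps)
  next
    case (mult f g)
    then obtain f0 f1 f2 g0 g1 g2 where fg:
      "f0 \<in> regular_on I S" "f1 \<in> regular_on I S" "f2 \<in> regular_on I S"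
      "\<forall>p\<in>S. f p = f0 p + b p * f1 p + z p * f2 p"
      "g0 \<in> regular_on I S" "g1 \<in> regular_on I S" "g2 \<in> regular_on I S"
      "\<forall>p\<in>S. g p = g0 p + b p * g1 p + z p * g2 p"
      by (elim exE conjE)
    have "(\<lambda>p. f0 p * g0 p + b p ^ 2 * (f1 p * g1 p) + b p * z p * (f1 p * g2 p + f2 p * g1 p)
        + z p ^ 2 * (f2 p * g2 p)) \<in> regular_on I S"
      using fg by (intro regular_on_add regular_on_mult[OF b2] regular_on_mult[OF bz]
          regular_on_mult[OF z2] regular_on_mult)
    moreover have "(\<lambda>p. f0 p * g1 p + f1 p * g0 p) \<in> regular_on I S"
      "(\<lambda>p. f0 p * g2 p + f2 p * g0 p) \<in> regular_on I S"
      using fg by (auto intro!: regular_on_add regular_on_mult)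
    moreover have "\<forall>p\<in>S. f p * g p =
        (f0 p * g0 p + b p ^ 2 * (f1 p * g1 p) + b p * z p * (f1 p * g2 p + f2 p * g1 p)
          + z p ^ 2 * (f2 p * g2 p))
        + b p * (f0 p * g1 p + f1 p * g0 p) + z p * (f0 p * g2 p + f2 p * g0 p)"
      using fg by (simp add: algebra_simps power2_eq_square)
    ultimately show ?case by (intro exI conjI)
  qed
  then obtain f0 f1 f2 where f0: "f0 \<in> regular_on I S"
    and dec': "\<forall>p\<in>S. f' p = f0 p + b p * f1 p + z p * f2 p"
    and f12: "f1 \<in> regular_on I S" "f2 \<in> regular_on I S"
    by (elim exE conjE)
  have dec: "f p = f0 p + b p * f1 p + z p * f2 p" if "p \<in> S" for p
    using bspec[OF dec' that] f'(2)[OF that] by simp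
  have inv': "g (s p) = g p" if "g \<in> regular_on I S" "p \<in> S" for g p
  proof -
    from that(1) obtain h where h: "h \<in> polyfuns I" "\<And>p. p \<in> S \<Longrightarrow> g p = h p"
      by (auto simp: regular_on_def)
    from h(1) have "h (s p) = h p" by induction (use that inv in auto)
    thus ?thesis using h(2) s(1) that(2) by simp
  qed
  have "f p = f0 p" if p: "p \<in> S" for p
  proof -
    have "f0 p + b p * f1 p + z p * f2 p = f0 p - b p * f1 p - z p * f2 p"
      using f(2)[OF p] dec[OF p] dec[OF s(1)[OF p]] s(2,3)[OF p] inv'[OF f0 p] inv'[OF f12(1) p]
        inv'[OF f12(2) p] by simp
    hence "2 * (b p * f1 p + z p * f2 p) = 0" by (simp add: algebra_simps)
    hence "b p * f1 p + z p * f2 p = 0" by (metis mult_eq_0_iff zero_neq_numeral)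
    thus ?thesis using dec[OF p] by (simp add: add.assoc)
  qed
  thus ?thesis using regular_on_cong[OF f0] by blast
qed


section \<open>Linear combinations of functions\<close>

text \<open>
  The coefficients are functions, so that one notion covers modules over the ring of the parameters
  and, with constant coefficients, vector spaces. The index set \<open>A\<close> allows bounding degrees.
\<close>

definition lincombs ::
    "('a \<Rightarrow> complex) set \<Rightarrow> ('i \<Rightarrow> 'a \<Rightarrow> complex) \<Rightarrow> 'i set \<Rightarrow> 'a set \<Rightarrow> ('a \<Rightarrow> complex) set" where
  "lincombs K B A S = {f. \<exists>F c. finite F \<and> F \<subseteq> A \<and> (\<forall>i. c i \<in> K) \<and>
     (\<forall>p\<in>S. f p = (\<Sum>i\<in>F. c i p * B i p))}"

lemma lincombsI:
  "finite F \<Longrightarrow> F \<subseteq> A \<Longrightarrow> (\<And>i. c i \<in> K) \<Longrightarrow> (\<And>p. p \<in> S \<Longrightarrow> f p = (\<Sum>i\<in>F. c i p * B i p)) \<Longrightarrow>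
     f \<in> lincombs K B A S"
  unfolding lincombs_def by (rule CollectI, rule exI[of _ F], rule exI[of _ c]) simp

lemma lincombsE:
  assumes "f \<in> lincombs K B A S"
  obtains F c where "finite F" "F \<subseteq> A" "\<And>i. c i \<in> K"
    "\<And>p. p \<in> S \<Longrightarrow> f p = (\<Sum>i\<in>F. c i p * B i p)"
proof -
  from assms obtain F c where *: "finite F" "F \<subseteq> A" "\<forall>i. c i \<in> K"
    "\<forall>p\<in>S. f p = (\<Sum>i\<in>F. c i p * B i p)"
    unfolding lincombs_def by (elim CollectE exE conjE)
  show thesis
    by (rule that[of F c]) (use * in simp_all)
qed

lemma lincombs_mono: "f \<in> lincombs K B A S \<Longrightarrow> A \<subseteq> A' \<Longrightarrow> f \<in> lincombs K B A' S"
  by (elim lincombsE, rule lincombsI) (assumption | blast)+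

lemma lincombs_cong:
  "f \<in> lincombs K B A S \<Longrightarrow> (\<And>p. p \<in> S \<Longrightarrow> g p = f p) \<Longrightarrow> g \<in> lincombs K B A S"
  by (elim lincombsE, rule lincombsI) (assumption | simp)+

context
  fixes K :: "('a \<Rightarrow> complex) set" and B :: "'i \<Rightarrow> 'a \<Rightarrow> complex" and S :: "'a set"
  assumes K_const: "\<And>c. (\<lambda>_. c) \<in> K"
    and K_add: "\<And>f g. f \<in> K \<Longrightarrow> g \<in> K \<Longrightarrow> (\<lambda>p. f p + g p) \<in> K"
    and K_mult: "\<And>f g. f \<in> K \<Longrightarrow> g \<in> K \<Longrightarrow> (\<lambda>p. f p * g p) \<in> K"
begin

lemma lincombs_zero: "(\<lambda>_. 0) \<in> lincombs K B A S"
  by (rule lincombsI[of "{}" _ "\<lambda>_ _. 0"]) (auto intro: K_const)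

lemma lincombs_basis: "i \<in> A \<Longrightarrow> B i \<in> lincombs K B A S"
  by (rule lincombsI[of "{i}" _ "\<lambda>_ _. 1"]) (auto intro: K_const)

lemma lincombs_scale:
  assumes "k \<in> K" "f \<in> lincombs K B A S"
  shows "(\<lambda>p. k p * f p) \<in> lincombs K B A S"
  using assms(2)
proof (rule lincombsE)
  fix F c assume "finite F" "F \<subseteq> A" "\<And>i. c i \<in> K" "\<And>p. p \<in> S \<Longrightarrow> f p = (\<Sum>i\<in>F. c i p * B i p)"
  thus ?thesis
    by (intro lincombsI[of F A "\<lambda>i p. k p * c i p"])
       (auto intro: K_mult assms(1) simp: sum_distrib_left mult.assoc)
qed

lemma lincombs_add:
  assumes "f \<in> lincombs K B A S" "g \<in> lincombs K B A S"
  shows "(\<lambda>p. f p + g p) \<in> lincombs K B A S"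
proof -
  obtain F c where f: "finite F" "F \<subseteq> A" "\<And>i. c i \<in> K" "\<And>p. p \<in> S \<Longrightarrow> f p = (\<Sum>i\<in>F. c i p * B i p)"
    by (rule lincombsE[OF assms(1)]) (rule that)
  obtain G d where g: "finite G" "G \<subseteq> A" "\<And>i. d i \<in> K" "\<And>p. p \<in> S \<Longrightarrow> g p = (\<Sum>i\<in>G. d i p * B i p)"
    by (rule lincombsE[OF assms(2)]) (rule that)
  define c' where "c' i = (if i \<in> F then c i else (\<lambda>_. 0))" for i
  define d' where "d' i = (if i \<in> G then d i else (\<lambda>_. 0))" for i
  show ?thesis
  proof (rule lincombsI[of "F \<union> G" A "\<lambda>i p. c' i p + d' i p"])
    show "(\<lambda>p. c' i p + d' i p) \<in> K" for i
      using f(3) g(3) by (intro K_add) (auto simp: c'_def d'_def K_const)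
  next
    fix p assume p: "p \<in> S"
    have "(\<Sum>i\<in>F. c i p * B i p) = (\<Sum>i\<in>F \<union> G. c' i p * B i p)"
      using f(1) g(1) by (intro sum.mono_neutral_cong_left) (auto simp: c'_def)
    moreover have "(\<Sum>i\<in>G. d i p * B i p) = (\<Sum>i\<in>F \<union> G. d' i p * B i p)"
      using f(1) g(1) by (intro sum.mono_neutral_cong_left) (auto simp: d'_def)
    ultimately show "f p + g p = (\<Sum>i\<in>F \<union> G. (c' i p + d' i p) * B i p)"
      using f(4)[OF p] g(4)[OF p] by (simp add: sum.distrib ring_distribs)
  qed (use f g in auto)
qed

lemma lincombs_sum:
  "(\<And>i. i \<in> I \<Longrightarrow> f i \<in> lincombs K B A S) \<Longrightarrow> (\<lambda>p. \<Sum>i\<in>I. f i p) \<in> lincombs K B A S"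
  by (induction I rule: infinite_finite_induct) (auto intro: lincombs_add lincombs_zero)

lemma lincombs_mult_right:
  assumes "f \<in> lincombs K B A S" "\<And>i. i \<in> A \<Longrightarrow> (\<lambda>p. g p * B i p) \<in> lincombs K B A' S"
  shows "(\<lambda>p. g p * f p) \<in> lincombs K B A' S"
proof -
  obtain F c where f: "finite F" "F \<subseteq> A" "\<And>i. c i \<in> K" "\<And>p. p \<in> S \<Longrightarrow> f p = (\<Sum>i\<in>F. c i p * B i p)"
    by (rule lincombsE[OF assms(1)]) (rule that)
  have "(\<lambda>p. \<Sum>i\<in>F. c i p * (g p * B i p)) \<in> lincombs K B A' S"
    using f(2) by (intro lincombs_sum lincombs_scale f(3) assms(2)) auto
  thus ?thesis
    by (rule lincombs_cong) (simp add: f(4) sum_distrib_left mult_ac)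
qed

text \<open>
  By induction, multiplication by any element of the ring preserves the module; it is then applied
  to 1.
\<close>

lemma regular_on_in_lincombs:
  assumes one: "(\<lambda>_. 1) \<in> lincombs K B A S"
    and C: "\<And>g i. g \<in> C \<Longrightarrow> i \<in> A \<Longrightarrow> (\<lambda>p. g p * B i p) \<in> lincombs K B A S"
    and f: "f \<in> regular_on C S"
  shows "f \<in> lincombs K B A S"
proof -
  obtain f' where f': "f' \<in> polyfuns C" "\<And>p. p \<in> S \<Longrightarrow> f p = f' p"
    using f by (auto simp: regular_on_def)
  have "(\<lambda>p. f' p * h p) \<in> lincombs K B A S" if "h \<in> lincombs K B A S" for h
    using f'(1) that
  proof (induction arbitrary: h)
    case (coord g)
    show ?case using coord.prems C[OF coord.hyps] by (rule lincombs_mult_right)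
  next
    case (const c)
    thus ?case by (intro lincombs_scale K_const)
  next
    case (add f g)
    thus ?case using lincombs_add[OF add.IH(1)[OF add.prems] add.IH(2)[OF add.prems]]
      by (simp add: ring_distribs)
  next
    case (mult f g)
    thus ?case using mult.IH(1)[OF mult.IH(2)[OF mult.prems]] by (simp add: mult.assoc)
  qed
  from this[OF one] show ?thesis by (rule lincombs_cong) (simp add: f'(2))
qed

end


section \<open>The invariants of the two groups\<close>

definition inv_a :: "C5 \<Rightarrow> complex" where "inv_a = (\<lambda>(x, y, z, t2, t4). x + y)"
definition inv_w :: "C5 \<Rightarrow> complex" where "inv_w = (\<lambda>(x, y, z, t2, t4). z ^ 2)"
definition inv_v :: "C5 \<Rightarrow> complex" where "inv_v = (\<lambda>(x, y, z, t2, t4). (x - y) * z)"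
definition par_t2 :: "C5 \<Rightarrow> complex" where "par_t2 = (\<lambda>(x, y, z, t2, t4). t2)"
definition par_t4 :: "C5 \<Rightarrow> complex" where "par_t4 = (\<lambda>(x, y, z, t2, t4). t4)"

definition X_set :: "C5 set" where
  "X_set = {(x, y, z, t2, t4). z ^ 4 + t2 * z ^ 2 + t4 + 1 / 8 * t2 ^ 2 = x * y}"

lemmas inv_defs = inv_a_def inv_w_def inv_v_def par_t2_def par_t4_def

lemma sigma_sigma: "sigma (sigma p) = p"
  by (auto simp: sigma_def split: prod.splits)

lemma X_set_sigma: "p \<in> X_set \<Longrightarrow> sigma p \<in> X_set"
  by (auto simp: X_set_def sigma_def mult.commute)

lemma regular_on_coords5:
  "(\<lambda>(x, y, z, t2, t4). x) \<in> regular_on coords5 S" "(\<lambda>(x, y, z, t2, t4). y) \<in> regular_on coords5 S"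
  "(\<lambda>(x, y, z, t2, t4). z) \<in> regular_on coords5 S" "(\<lambda>(x, y, z, t2, t4). t2) \<in> regular_on coords5 S"
  "(\<lambda>(x, y, z, t2, t4). t4) \<in> regular_on coords5 S"
  by (intro regular_on_coord; simp add: coords5_def)+

text \<open>
  The anti-invariants are generated by \<open>b = x - y\<close> and \<open>z\<close>, and \<open>b\<^sup>2 = (x + y)\<^sup>2 - 4 x y\<close>, where the
  equation of the family expresses \<open>x y\<close> through \<open>z\<^sup>2\<close> and the parameters.
\<close>

lemma Omega_invariants:
  assumes "f \<in> regular_on coords5 X_set" "\<And>p. p \<in> X_set \<Longrightarrow> f (sigma p) = f p"
  shows "f \<in> regular_on {inv_a, inv_w, inv_v, par_t2, par_t4} X_set" (is "f \<in> regular_on ?I _")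
proof (rule invariants_of_sign_change)
  let ?b = "\<lambda>(x, y, z, t2, t4). x - y :: complex" and ?z = "\<lambda>(x, y, z, t2, t4). z :: complex"
  have I: "inv_a \<in> regular_on ?I X_set" "inv_w \<in> regular_on ?I X_set" "inv_v \<in> regular_on ?I X_set"
    "par_t2 \<in> regular_on ?I X_set" "par_t4 \<in> regular_on ?I X_set"
    by (intro regular_on_coord; simp)+
  have "(\<lambda>p. inv_a p ^ 2 - 4 * (inv_w p ^ 2 + par_t2 p * inv_w p + par_t4 p + 1 / 8 * par_t2 p ^ 2))
      \<in> regular_on ?I X_set"
    by (intro regular_on_intros I)
  thus "(\<lambda>p. ?b p ^ 2) \<in> regular_on ?I X_set"
  proof (rule regular_on_cong)
    fix p assume "p \<in> X_set"
    moreover obtain x y z t2 t4 where [simp]: "p = (x, y, z, t2, t4)" by (cases p) auto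
    ultimately have *: "z ^ 4 + t2 * z ^ 2 + t4 + 1 / 8 * t2 ^ 2 = x * y" by (simp add: X_set_def)
    have "(x - y) ^ 2 = (x + y) ^ 2 - 4 * (x * y)" by (simp add: power2_eq_square algebra_simps)
    also have "\<dots> = (x + y) ^ 2 - 4 * ((z ^ 2) ^ 2 + t2 * z ^ 2 + t4 + 1 / 8 * t2 ^ 2)"
      unfolding *[symmetric] by simp
    finally show "?b p ^ 2 = inv_a p ^ 2 -
        4 * (inv_w p ^ 2 + par_t2 p * inv_w p + par_t4 p + 1 / 8 * par_t2 p ^ 2)"
      by (simp add: inv_defs)
  qed
  show "(\<lambda>p. ?b p * ?z p) \<in> regular_on ?I X_set"
    by (rule regular_on_cong[OF I(3)]) (auto simp: inv_defs)
  show "(\<lambda>p. ?z p ^ 2) \<in> regular_on ?I X_set"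
    by (rule regular_on_cong[OF I(2)]) (auto simp: inv_defs)
  show "sigma p \<in> X_set" if "p \<in> X_set" for p
    using that by (rule X_set_sigma)
  show "?b (sigma p) = - ?b p" "?z (sigma p) = - ?z p" for p
    by (auto simp: sigma_def split: prod.splits)
  show "g (sigma p) = g p" if "g \<in> ?I" for g p
    using that by (auto simp: sigma_def inv_defs algebra_simps split: prod.splits)
  let ?J = "insert ?b (insert ?z ?I)"
  have b: "?b \<in> regular_on ?J X_set" by (intro regular_on_coord) simp
  have a: "inv_a \<in> regular_on ?J X_set" by (intro regular_on_coord) simp
  have "(\<lambda>p. 1 / 2 * (inv_a p + ?b p)) \<in> regular_on ?J X_set"
    by (intro regular_on_mult regular_on_add regular_on_const a b)
  hence x: "(\<lambda>(x, y, z, t2, t4). x) \<in> regular_on ?J X_set"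
    by (rule regular_on_cong) (auto simp: inv_defs)
  have "(\<lambda>p. 1 / 2 * (inv_a p - ?b p)) \<in> regular_on ?J X_set"
    by (intro regular_on_mult regular_on_diff regular_on_const a b)
  hence y: "(\<lambda>(x, y, z, t2, t4). y) \<in> regular_on ?J X_set"
    by (rule regular_on_cong) (auto simp: inv_defs)
  show "f \<in> regular_on ?J X_set"
  proof (rule regular_on_change_coords[OF assms(1)])
    fix g assume "g \<in> coords5"
    then consider "g = (\<lambda>(x, y, z, t2, t4). x)" | "g = (\<lambda>(x, y, z, t2, t4). y)"
      | "g = ?z" | "g = par_t2" | "g = par_t4"
      unfolding coords5_def par_t2_def par_t4_def by blast
    thus "g \<in> regular_on ?J X_set"
      by cases (use x y in \<open>simp_all add: regular_on_coord\<close>)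
  qed
qed (use assms in auto)

definition quot_coords :: "(C5 set \<Rightarrow> complex) set" where
  "quot_coords = induced_map ` {inv_a, inv_w, inv_v, par_t2, par_t4}"

abbreviation Omega_orbit :: "C5 \<Rightarrow> C5 set" where "Omega_orbit \<equiv> group_orbit Omega"

lemma inv_sigma:
  "inv_a (sigma p) = inv_a p" "inv_w (sigma p) = inv_w p" "inv_v (sigma p) = inv_v p"
  "par_t2 (sigma p) = par_t2 p" "par_t4 (sigma p) = par_t4 p" "alpha_B2 (sigma p) = alpha_B2 p"
  by (auto simp: sigma_def inv_defs alpha_B2_def algebra_simps split: prod.splits)

lemma X_B2_mod_Omega_eq: "X_B2_mod_Omega = affine_variety quot_coords (Omega_orbit ` X_set)"
  unfolding X_B2_mod_Omega_def X_B2_def Omega_def quot_coords_def X_set_def[symmetric]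
proof (rule quotient_variety_affine)
  fix f assume "f \<in> {inv_a, inv_w, inv_v, par_t2, par_t4}"
  moreover have "inv_a \<in> regular_on coords5 X_set"
    by (rule regular_on_cong[OF regular_on_add[OF regular_on_coords5(1,2)]]) (auto simp: inv_defs)
  moreover have "inv_w \<in> regular_on coords5 X_set"
    by (rule regular_on_cong[OF regular_on_power[where n = 2, OF regular_on_coords5(3)]]) (auto simp: inv_defs)
  moreover have "inv_v \<in> regular_on coords5 X_set"
    by (rule regular_on_cong[OF regular_on_mult[OF regular_on_diff[OF regular_on_coords5(1,2)]
          regular_on_coords5(3)]]) (auto simp: inv_defs)
  moreover have "par_t2 \<in> regular_on coords5 X_set" "par_t4 \<in> regular_on coords5 X_set"
    unfolding par_t2_def par_t4_def by (rule regular_on_coords5)+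
  ultimately show "f \<in> regular_on coords5 X_set" by blast
next
  fix s :: "C5 \<Rightarrow> C5" assume "s \<in> {sigma}"
  thus "\<exists>n. s ^^ Suc n = id" by (intro exI[of _ 1]) (auto simp: sigma_sigma)
qed (auto simp: inv_sigma X_set_sigma intro: Omega_invariants)

lemma induced_map_Omega:
  "induced_map inv_a (Omega_orbit p) = inv_a p" "induced_map inv_w (Omega_orbit p) = inv_w p"
  "induced_map inv_v (Omega_orbit p) = inv_v p" "induced_map par_t2 (Omega_orbit p) = par_t2 p"
  "induced_map par_t4 (Omega_orbit p) = par_t4 p" "alpha_B2_bar (Omega_orbit p) = alpha_B2 p"
  unfolding Omega_def alpha_B2_bar_def by (rule induced_map_orbit; simp add: inv_sigma)+

lemma Omega_orbit_sigma: "Omega_orbit (sigma p) = Omega_orbit p"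
  unfolding Omega_def by (rule group_orbit_generator[where n = 1]) (auto simp: sigma_sigma)

text \<open>
  The quotient is the hypersurface \<open>v\<^sup>2 = quot_poly t a w\<close>; the right-hand side is \<open>w (x - y)\<^sup>2\<close>.
\<close>

definition quot_poly :: "C2 \<Rightarrow> complex \<Rightarrow> complex \<Rightarrow> complex" where
  "quot_poly t a w = w * (a ^ 2 - 4 * (w ^ 2 + fst t * w + snd t + 1 / 8 * fst t ^ 2))"

lemma X_set_quot_poly: "p \<in> X_set \<Longrightarrow> inv_v p ^ 2 = quot_poly (alpha_B2 p) (inv_a p) (inv_w p)"
proof -
  assume "p \<in> X_set"
  moreover obtain x y z t2 t4 where [simp]: "p = (x, y, z, t2, t4)" by (cases p) auto
  ultimately have *: "z ^ 4 + t2 * z ^ 2 + t4 + 1 / 8 * t2 ^ 2 = x * y" by (simp add: X_set_def)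
  have "((x - y) * z) ^ 2 = z ^ 2 * ((x + y) ^ 2 - 4 * (x * y))"
    by (simp add: power2_eq_square algebra_simps)
  also have "\<dots> = z ^ 2 * ((x + y) ^ 2 - 4 * ((z ^ 2) ^ 2 + t2 * z ^ 2 + t4 + 1 / 8 * t2 ^ 2))"
    unfolding *[symmetric] by simp
  finally show ?thesis by (simp add: inv_defs quot_poly_def alpha_B2_def)
qed

lemma X_set_surj:
  assumes "v ^ 2 = quot_poly t a w"
  shows "\<exists>p\<in>X_set. alpha_B2 p = t \<and> inv_a p = a \<and> inv_w p = w \<and> inv_v p = v"
proof -
  define k where "k = w ^ 2 + fst t * w + snd t + 1 / 8 * fst t ^ 2"
  obtain z where z: "z ^ 2 = w" using power2_csqrt by blast
  obtain b0 where b0: "b0 ^ 2 = a ^ 2 - 4 * k" using power2_csqrt by blast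
  have "(b0 * z) ^ 2 = v ^ 2" unfolding assms power_mult_distrib z b0 quot_poly_def k_def by simp
  hence "b0 * z = v \<or> - b0 * z = v" by (auto simp: power2_eq_iff)
  then obtain b where b: "b ^ 2 = a ^ 2 - 4 * k" "b * z = v" using b0 by (metis power2_minus)
  let ?p = "((a + b) / 2, (a - b) / 2, z, fst t, snd t)"
  have "(a + b) / 2 * ((a - b) / 2) = (a ^ 2 - b ^ 2) / 4"
    by (simp add: power2_eq_square algebra_simps)
  also have "\<dots> = k" using b(1) by simp
  finally have xy: "(a + b) / 2 * ((a - b) / 2) = k" .
  have "z ^ 4 = w ^ 2" unfolding z[symmetric] by simp
  hence "?p \<in> X_set"
    unfolding X_set_def mem_Collect_eq prod.case xy by (simp add: k_def z)
  moreover have "(a + b) / 2 + (a - b) / 2 = a" "(a + b) / 2 - (a - b) / 2 = b"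
    by (simp_all add: field_simps)
  ultimately show ?thesis using b(2) z
    by (intro bexI[of _ ?p]) (simp_all add: inv_defs alpha_B2_def)
qed

text \<open>
  The invariants determine \<open>x - y\<close> and \<open>z\<close> up to signs, and their product \<open>v\<close> couples the two signs.
\<close>

lemma X_set_inj:
  assumes "p \<in> X_set" "q \<in> X_set" "alpha_B2 p = alpha_B2 q"
    "inv_a p = inv_a q" "inv_w p = inv_w q" "inv_v p = inv_v q"
  shows "q = p \<or> q = sigma p"
proof -
  obtain x y z t2 t4 where p: "p = (x, y, z, t2, t4)" by (cases p) auto
  obtain x' y' z' where q: "q = (x', y', z', t2, t4)"
    using assms(3) by (cases q) (auto simp: p alpha_B2_def)
  have a: "x + y = x' + y'" and w: "z ^ 2 = z' ^ 2" and v: "(x - y) * z = (x' - y') * z'"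
    using assms(4-6) by (simp_all add: p q inv_defs)
  have "z ^ 4 = z' ^ 4" using arg_cong[OF w, of "\<lambda>u. u ^ 2"] by simp
  hence "x * y = x' * y'"
    using assms(1,2) w by (simp add: X_set_def p q)
  moreover have "(x - y) ^ 2 = (x + y) ^ 2 - 4 * (x * y)"
    "(x' - y') ^ 2 = (x' + y') ^ 2 - 4 * (x' * y')" by (simp_all add: power2_eq_square algebra_simps)
  ultimately have b: "(x - y) ^ 2 = (x' - y') ^ 2" using a by simp
  have halves: "x = ((x + y) + (x - y)) / 2" "y = ((x + y) - (x - y)) / 2"
    "x' = ((x' + y') + (x' - y')) / 2" "y' = ((x' + y') - (x' - y')) / 2"
    by (simp_all add: field_simps)
  have pos: "q = p" if "x - y = x' - y'" "z = z'"
    using halves that a by (simp add: p q)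
  have neg: "q = sigma p" if "x - y = - (x' - y')" "z = - z'"
    using halves that a by (simp add: p q sigma_def)
  show ?thesis
  proof (cases "z = 0")
    case True
    thus ?thesis using b w pos neg by (auto simp: power2_eq_iff)
  next
    case False
    with w consider "z = z'" "z' \<noteq> 0" | "z = - z'" "z' \<noteq> 0" by (auto simp: power2_eq_iff)
    thus ?thesis
    proof cases
      case 1
      thus ?thesis using v pos by simp
    next
      case 2
      hence "((x - y) + (x' - y')) * z' = 0" using v by (simp add: algebra_simps)
      hence "(x - y) + (x' - y') = 0" using 2 by (simp only: mult_eq_0_iff) simp
      hence "x - y = - (x' - y')" by (rule eq_neg_iff_add_eq_0[THEN iffD2])
      thus ?thesis using 2 neg by simp
    qed
  qed
qed


section \<open>The singularity of type D4\<close>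

abbreviation cyc_gen :: "C2 \<Rightarrow> C2" where "cyc_gen \<equiv> \<lambda>(u, v). (\<i> * u, - \<i> * v)"
abbreviation swap_gen :: "C2 \<Rightarrow> C2" where "swap_gen \<equiv> \<lambda>(u, v). (v, - u)"

definition cyc_x :: "C2 \<Rightarrow> complex" where "cyc_x = (\<lambda>(u, v). u ^ 4)"
definition cyc_y :: "C2 \<Rightarrow> complex" where "cyc_y = (\<lambda>(u, v). v ^ 4)"
definition cyc_z :: "C2 \<Rightarrow> complex" where "cyc_z = (\<lambda>(u, v). u * v)"
definition d4_a :: "C2 \<Rightarrow> complex" where "d4_a = (\<lambda>p. cyc_x p + cyc_y p)"
definition d4_w :: "C2 \<Rightarrow> complex" where "d4_w = (\<lambda>p. cyc_z p ^ 2)"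
definition d4_v :: "C2 \<Rightarrow> complex" where "d4_v = (\<lambda>p. (cyc_x p - cyc_y p) * cyc_z p)"

lemmas cyc_defs = cyc_x_def cyc_y_def cyc_z_def
lemmas d4_defs = d4_a_def d4_w_def d4_v_def

lemma regular_on_coords2:
  "(\<lambda>(u, v). u) \<in> regular_on coords2 S" "(\<lambda>(u, v). v) \<in> regular_on coords2 S"
  by (intro regular_on_coord; simp add: coords2_def)+

lemma regular_on_fst_snd: "fst \<in> regular_on coords2 S" "snd \<in> regular_on coords2 S"
  using regular_on_coords2[of S] by (simp_all add: case_prod_unfold)

abbreviation constants :: "('a \<Rightarrow> complex) set" where "constants \<equiv> range (\<lambda>c _. c)"

lemma constants_closed:
  "(\<lambda>_. c) \<in> constants"
  "f \<in> constants \<Longrightarrow> g \<in> constants \<Longrightarrow> (\<lambda>p. f p + g p) \<in> constants"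
  "f \<in> constants \<Longrightarrow> g \<in> constants \<Longrightarrow> (\<lambda>p. f p * g p) \<in> constants"
  by auto

lemma regular_on_coords2_monomials:
  assumes "f \<in> regular_on coords2 S"
  shows "f \<in> lincombs constants (\<lambda>(i, j) p. fst p ^ i * snd p ^ j) UNIV S" (is "f \<in> lincombs _ ?B _ _")
proof (rule regular_on_in_lincombs[OF constants_closed _ _ assms])
  show "(\<lambda>_. 1) \<in> lincombs constants ?B UNIV S"
    by (rule lincombs_cong[OF lincombs_basis[OF constants_closed, of "(0, 0)"]]) auto
next
  fix g :: "C2 \<Rightarrow> complex" and k assume "g \<in> coords2"
  then consider "g = fst" | "g = snd" by (auto simp: coords2_def case_prod_unfold)
  thus "(\<lambda>p. g p * ?B k p) \<in> lincombs constants ?B UNIV S"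
  proof cases
    case 1
    show ?thesis
      by (rule lincombs_cong[OF lincombs_basis[OF constants_closed, of "(Suc (fst k), snd k)"]])
         (auto simp: 1 case_prod_unfold)
  next
    case 2
    show ?thesis
      by (rule lincombs_cong[OF lincombs_basis[OF constants_closed, of "(fst k, Suc (snd k))"]])
         (auto simp: 2 case_prod_unfold)
  qed
qed

text \<open>
  The cyclic group multiplies a monomial by powers of \<open>\<zeta>\<close>, so that averaging kills each monomial that
  is not fixed.
\<close>

lemma cyclic_average_monomial:
  fixes i j :: nat
  defines "\<zeta> \<equiv> \<i> ^ (i + 3 * j)"
  shows "(\<lambda>p. (1 + \<zeta> + \<zeta> ^ 2 + \<zeta> ^ 3) * (fst p ^ i * snd p ^ j)) \<in> regular_on {cyc_x, cyc_y, cyc_z} S"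
    (is "_ \<in> regular_on ?J S")
proof (cases "4 dvd i + 3 * j")
  case False
  define r where "r = (i + 3 * j) mod 4"
  have "\<zeta> = \<i> ^ (4 * ((i + 3 * j) div 4) + r)" by (simp add: \<zeta>_def r_def)
  hence \<zeta>: "\<zeta> = \<i> ^ r" by (simp add: power_add power_mult)
  have "r \<noteq> 0" "r < 4" using False by (auto simp: r_def mod_eq_0_iff_dvd)
  hence "r = 1 \<or> r = 2 \<or> r = 3" by linarith
  hence "1 + \<zeta> + \<zeta> ^ 2 + \<zeta> ^ 3 = 0"
    by (auto simp: \<zeta> power3_eq_cube power2_eq_square numeral_eq_Suc)
  thus ?thesis by (simp add: regular_on_const)
next
  case True
  have J: "cyc_x \<in> regular_on ?J S" "cyc_y \<in> regular_on ?J S" "cyc_z \<in> regular_on ?J S"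
    by (intro regular_on_coord; simp)+
  have "(\<lambda>p. fst p ^ i * snd p ^ j) \<in> regular_on ?J S"
  proof (cases "j \<le> i")
    case le: True
    with True have "4 dvd i - j" by presburger
    then obtain k where "i - j = 4 * k" ..
    hence "i = 4 * k + j" using le by simp
    thus ?thesis
      by (intro regular_on_cong[OF regular_on_mult[OF regular_on_power[OF J(1), of k]
              regular_on_power[OF J(3), of j]]])
         (simp add: cyc_defs case_prod_unfold power_add power_mult power_mult_distrib)
  next
    case gt: False
    with True have "4 dvd j - i" by presburger
    then obtain k where "j - i = 4 * k" ..
    hence "j = 4 * k + i" using gt by simp
    thus ?thesis
      by (intro regular_on_cong[OF regular_on_mult[OF regular_on_power[OF J(2), of k]
              regular_on_power[OF J(3), of i]]])
         (simp add: cyc_defs case_prod_unfold power_add power_mult power_mult_distrib)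
  qed
  thus ?thesis by (rule regular_on_mult[OF regular_on_const])
qed

lemma cyclic_invariants:
  assumes f: "f \<in> regular_on coords2 UNIV" and inv: "\<And>p. f (cyc_gen p) = f p"
  shows "f \<in> regular_on {cyc_x, cyc_y, cyc_z} UNIV"
proof -
  obtain F c where F: "finite F" "\<And>i. c i \<in> constants"
    "\<And>p. f p = (\<Sum>i\<in>F. c i p * (case i of (i, j) \<Rightarrow> \<lambda>p. fst p ^ i * snd p ^ j) p)"
    by (rule lincombsE[OF regular_on_coords2_monomials[OF f]]) (rule that, auto)
  define c' where "c' i = c i (0, 0)" for i
  have c': "c i = (\<lambda>_. c' i)" for i using F(2)[of i] by (auto simp: c'_def)
  define m where "m i p = fst p ^ fst i * snd p ^ snd i" for i :: "nat \<times> nat" and p :: C2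
  have f_eq: "f p = (\<Sum>i\<in>F. c' i * m i p)" for p
    unfolding F(3) m_def by (simp add: c' case_prod_unfold)
  define \<zeta> where "\<zeta> i = \<i> ^ (fst i + 3 * snd i)" for i :: "nat \<times> nat"
  have "(- \<i>) ^ n = \<i> ^ (3 * n)" for n by (simp add: power_mult power3_eq_cube)
  hence m_cyc: "m i (cyc_gen p) = \<zeta> i * m i p" for i p
    unfolding m_def \<zeta>_def case_prod_unfold fst_conv snd_conv power_mult_distrib power_add
    by (simp only: mult_ac)
  have "f p = 1 / 4 * (\<Sum>i\<in>F. c' i * ((1 + \<zeta> i + \<zeta> i ^ 2 + \<zeta> i ^ 3) * m i p))" for p
  proof -
    have "4 * f p = f p + f (cyc_gen p) + f (cyc_gen (cyc_gen p)) + f (cyc_gen (cyc_gen (cyc_gen p)))"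
      unfolding inv by simp
    also have "\<dots> = (\<Sum>i\<in>F. c' i * ((1 + \<zeta> i + \<zeta> i ^ 2 + \<zeta> i ^ 3) * m i p))"
      unfolding f_eq m_cyc
      by (simp add: sum.distrib[symmetric] algebra_simps power2_eq_square power3_eq_cube)
    finally have eq: "4 * f p = (\<Sum>i\<in>F. c' i * ((1 + \<zeta> i + \<zeta> i ^ 2 + \<zeta> i ^ 3) * m i p))" .
    show ?thesis unfolding eq[symmetric] by simp
  qed
  moreover have "(\<lambda>p. 1 / 4 * (\<Sum>i\<in>F. c' i * ((1 + \<zeta> i + \<zeta> i ^ 2 + \<zeta> i ^ 3) * m i p))) \<in> regular_on {cyc_x, cyc_y, cyc_z} UNIV"
    unfolding \<zeta>_def m_def
    by (intro regular_on_mult[OF regular_on_const] regular_on_sum cyclic_average_monomial)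
  ultimately show ?thesis by (auto intro: regular_on_cong)
qed

text \<open>
  In the invariants of the cyclic subgroup the second generator acts as \<open>sigma\<close> does on the fibre over
  the origin, so the same splitting applies.
\<close>

lemma D4_invariants:
  assumes f: "f \<in> regular_on coords2 UNIV" and inv: "\<And>p. f (cyc_gen p) = f p" "\<And>p. f (swap_gen p) = f p"
  shows "f \<in> regular_on {d4_a, d4_w, d4_v} UNIV" (is "f \<in> regular_on ?I _")
proof (rule invariants_of_sign_change)
  let ?b = "\<lambda>p. cyc_x p - cyc_y p"
  have I: "d4_a \<in> regular_on ?I UNIV" "d4_w \<in> regular_on ?I UNIV" "d4_v \<in> regular_on ?I UNIV"
    by (intro regular_on_coord; simp)+
  have "(\<lambda>p. d4_a p ^ 2 - 4 * d4_w p ^ 2) \<in> regular_on ?I UNIV" by (intro regular_on_intros I)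
  thus "(\<lambda>p. ?b p ^ 2) \<in> regular_on ?I UNIV"
    by (rule regular_on_cong)
       (auto simp: d4_defs cyc_defs power2_eq_square power4_eq_xxxx algebra_simps)
  show "(\<lambda>p. ?b p * cyc_z p) \<in> regular_on ?I UNIV" using I(3) by (simp add: d4_v_def)
  show "(\<lambda>p. cyc_z p ^ 2) \<in> regular_on ?I UNIV" using I(2) by (simp add: d4_w_def)
  show "?b (swap_gen p) = - ?b p" "cyc_z (swap_gen p) = - cyc_z p" for p
    by (auto simp: cyc_defs split: prod.splits)
  show "g (swap_gen p) = g p" if "g \<in> ?I" for g p
    using that by (auto simp: d4_defs cyc_defs algebra_simps split: prod.splits)
  let ?J = "insert ?b (insert cyc_z ?I)"
  have b: "?b \<in> regular_on ?J UNIV" by (intro regular_on_coord) simp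
  have a: "d4_a \<in> regular_on ?J UNIV" by (intro regular_on_coord) simp
  have "(\<lambda>p. 1 / 2 * (d4_a p + ?b p)) \<in> regular_on ?J UNIV"
    by (intro regular_on_mult regular_on_add regular_on_const a b)
  hence x: "cyc_x \<in> regular_on ?J UNIV"
    by (rule regular_on_cong) (auto simp: d4_defs)
  have "(\<lambda>p. 1 / 2 * (d4_a p - ?b p)) \<in> regular_on ?J UNIV"
    by (intro regular_on_mult regular_on_diff regular_on_const a b)
  hence y: "cyc_y \<in> regular_on ?J UNIV"
    by (rule regular_on_cong) (auto simp: d4_defs)
  show "f \<in> regular_on ?J UNIV"
  proof (rule regular_on_change_coords[OF cyclic_invariants[OF f inv(1)]])
    fix g assume "g \<in> {cyc_x, cyc_y, cyc_z}"
    thus "g \<in> regular_on ?J UNIV" using x y by (auto intro: regular_on_coord)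
  qed
qed (use assms in auto)

abbreviation D4_orbit :: "C2 \<Rightarrow> C2 set" where "D4_orbit \<equiv> group_orbit binary_dihedral_8"

lemma d4_invariant:
  assumes "f \<in> {d4_a, d4_w, d4_v}" "s \<in> {cyc_gen, swap_gen}"
  shows "f (s p) = f p"
proof -
  obtain u v where p: "p = (u, v)" by fastforce
  have "(\<i> * u) ^ 4 = u ^ 4" "(\<i> * v) ^ 4 = v ^ 4" "(- v) ^ 4 = v ^ 4" "(- (\<i> * v)) ^ 4 = v ^ 4"
    by (simp_all add: power_mult_distrib)
  thus ?thesis using assms by (auto simp: d4_defs cyc_defs p algebra_simps power2_eq_square)
qed

lemma g_finite_order: "s \<in> {cyc_gen, swap_gen} \<Longrightarrow> s ^^ Suc 3 = id"
  by (auto simp: fun_eq_iff numeral_eq_Suc)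

lemma singularity_D4_eq:
  "singularity_D4 = affine_variety (induced_map ` {d4_a, d4_w, d4_v}) (range D4_orbit)"
  unfolding singularity_D4_def affine_plane_def binary_dihedral_8_def
proof (rule quotient_variety_affine)
  fix f assume "f \<in> {d4_a, d4_w, d4_v}"
  moreover have c: "cyc_x \<in> regular_on coords2 UNIV" "cyc_y \<in> regular_on coords2 UNIV"
    "cyc_z \<in> regular_on coords2 UNIV"
    unfolding cyc_defs case_prod_unfold
    by (intro regular_on_power regular_on_mult regular_on_fst_snd)+
  moreover have "d4_a \<in> regular_on coords2 UNIV" "d4_w \<in> regular_on coords2 UNIV"
    "d4_v \<in> regular_on coords2 UNIV"
    unfolding d4_defs by (intro regular_on_intros c)+
  ultimately show "f \<in> regular_on coords2 UNIV" by blast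
next
  fix s :: "C2 \<Rightarrow> C2" assume "s \<in> {cyc_gen, swap_gen}"
  thus "\<exists>n. s ^^ Suc n = id" using g_finite_order by blast
next
  fix f :: "C2 \<Rightarrow> complex"
  assume f: "f \<in> regular_on coords2 UNIV" "\<And>s p. s \<in> {cyc_gen, swap_gen} \<Longrightarrow> p \<in> UNIV \<Longrightarrow> f (s p) = f p"
  show "f \<in> regular_on {d4_a, d4_w, d4_v} UNIV"
    by (rule D4_invariants) (use f in auto)
qed (use d4_invariant in auto)

lemma induced_map_D4:
  "f \<in> {d4_a, d4_w, d4_v} \<Longrightarrow> induced_map f (D4_orbit p) = f p"
  unfolding binary_dihedral_8_def by (rule induced_map_orbit) (rule d4_invariant)

lemma complex_root4_exists: "\<exists>u :: complex. u ^ 4 = x"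
proof -
  have "(csqrt (csqrt x)) ^ 4 = (csqrt (csqrt x) ^ 2) ^ 2"
    unfolding power_mult[symmetric] by simp
  also have "\<dots> = x" by (simp only: power2_csqrt)
  finally show ?thesis ..
qed

lemma fourth_powers_eq:
  fixes u v :: complex
  assumes "u ^ 4 = v ^ 4"
  shows "\<exists>k. u = \<i> ^ k * v"
proof -
  have "(u - v) * (u + v) * ((u - \<i> * v) * (u + \<i> * v)) = u ^ 4 - v ^ 4"
    by (simp add: power4_eq_xxxx algebra_simps)
  hence "u = v \<or> u = - v \<or> u = \<i> * v \<or> u = - \<i> * v"
    using assms by (auto simp: eq_neg_iff_add_eq_0)
  moreover have "\<i> ^ 3 = - \<i>" by (simp add: power3_eq_cube)
  ultimately consider "u = \<i> ^ 0 * v" | "u = \<i> ^ 2 * v" | "u = \<i> ^ 1 * v" | "u = \<i> ^ 3 * v"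
    by auto
  thus ?thesis by cases blast+
qed

lemma cyc_gen_power: "(cyc_gen ^^ k) (u, v) = (\<i> ^ k * u, (- \<i>) ^ k * v)"
  by (induction k) (auto simp: mult.assoc)

text \<open>
  Fourth powers determine \<open>u\<close> and \<open>v\<close> up to powers of \<open>\<i>\<close>, and the product \<open>u v\<close> forces these two
  powers to be inverse to each other.
\<close>

lemma D4_orbit_rotate:
  assumes "cyc_x q = cyc_x p" "cyc_y q = cyc_y p" "cyc_z q = cyc_z p"
  shows "D4_orbit q = D4_orbit p"
proof -
  obtain u v where p: "p = (u, v)" by fastforce
  obtain u' v' where q: "q = (u', v')" by fastforce
  have eqs: "u' ^ 4 = u ^ 4" "v' ^ 4 = v ^ 4" "u' * v' = u * v"
    using assms by (simp_all add: p q cyc_defs)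
  have ii: "\<i> ^ k * (- \<i>) ^ k = 1" for k by (simp add: power_mult_distrib[symmetric])
  have "\<exists>k. u' = \<i> ^ k * u \<and> v' = (- \<i>) ^ k * v"
  proof (cases "u = 0")
    case False
    obtain k where k: "u' = \<i> ^ k * u" using fourth_powers_eq[OF eqs(1)] ..
    have "u * v = u * (\<i> ^ k * v')" unfolding eqs(3)[symmetric] k by (simp only: mult_ac)
    hence "v = \<i> ^ k * v'" by (rule mult_left_cancel[OF False, THEN iffD1])
    hence "(- \<i>) ^ k * v = (\<i> ^ k * (- \<i>) ^ k) * v'" by (simp only: mult_ac)
    hence "v' = (- \<i>) ^ k * v" unfolding ii by simp
    with k show ?thesis by blast
  next
    case True
    obtain k where k: "v' = \<i> ^ k * v" using fourth_powers_eq[OF eqs(2)] ..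
    have "(- \<i>) ^ (3 * k) = ((- \<i>) ^ 3) ^ k" by (simp add: power_mult)
    also have "(- \<i>) ^ 3 = \<i>" by (simp add: power3_eq_cube)
    finally show ?thesis using True eqs(1) k by (intro exI[of _ "3 * k"]) simp
  qed
  then obtain k where k: "u' = \<i> ^ k * u" "v' = (- \<i>) ^ k * v" by blast
  have "q = (cyc_gen ^^ k) p" unfolding p q cyc_gen_power k ..
  thus ?thesis unfolding binary_dihedral_8_def
    by (simp only:) (rule group_orbit_eq[OF _ generated_group_funpow];
       use g_finite_order in blast)
qed

lemma D4_orbit_g2: "D4_orbit (swap_gen p) = D4_orbit p"
  unfolding binary_dihedral_8_def
  by (rule group_orbit_generator[where n = 3]) (use g_finite_order[of swap_gen] in auto)

text \<open>
  The plane modulo the cyclic group is the hypersurface \<open>x y = z\<^sup>4\<close>, on which the quotient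
  group acts as \<open>sigma\<close>.
\<close>

definition cyc_point :: "C2 \<Rightarrow> C5" where
  "cyc_point p = (cyc_x p, cyc_y p, cyc_z p, 0, 0)"

lemma cyc_point:
  "cyc_point p \<in> X_set" "alpha_B2 (cyc_point p) = (0, 0)"
  "inv_a (cyc_point p) = d4_a p" "inv_w (cyc_point p) = d4_w p" "inv_v (cyc_point p) = d4_v p"
  "cyc_point (swap_gen p) = sigma (cyc_point p)"
  by (auto simp: cyc_point_def X_set_def cyc_defs d4_defs inv_defs alpha_B2_def sigma_def
      power_mult_distrib split: prod.splits)

lemma cyc_point_surj:
  assumes "q \<in> X_set" "alpha_B2 q = (0, 0)"
  shows "\<exists>p. cyc_point p = q"
proof -
  obtain x y z where q: "q = (x, y, z, 0, 0)" using assms(2) by (cases q) (auto simp: alpha_B2_def)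
  have xy: "z ^ 4 = x * y" using assms(1) by (simp add: q X_set_def)
  show ?thesis
  proof (cases "x = 0")
    case True
    obtain v where "v ^ 4 = y" using complex_root4_exists ..
    thus ?thesis using True xy
      by (intro exI[of _ "(0, v)"]) (simp add: cyc_point_def cyc_defs q)
  next
    case False
    obtain u where u: "u ^ 4 = x" using complex_root4_exists ..
    with False have "u \<noteq> 0" by auto
    moreover have "(z / u) ^ 4 = y" using xy u False by (simp add: power_divide)
    ultimately show ?thesis using u
      by (intro exI[of _ "(u, z / u)"]) (simp add: cyc_point_def cyc_defs q)
  qed
qed

lemma D4_orbit_bij:
  "bij_betw (\<lambda>O'. (induced_map d4_a O', induced_map d4_w O', induced_map d4_v O'))
     (range D4_orbit) {(a, w, v). v ^ 2 = quot_poly (0, 0) a w}" (is "bij_betw ?k _ ?Y")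
  unfolding bij_betw_def
proof
  have k: "?k (D4_orbit p) = (d4_a p, d4_w p, d4_v p)" for p by (simp add: induced_map_D4)
  show "inj_on ?k (range D4_orbit)"
  proof (rule inj_onI, elim imageE, goal_cases)
    case (1 O1 O2 p q)
    hence "(d4_a p, d4_w p, d4_v p) = (d4_a q, d4_w q, d4_v q)" by (metis k)
    hence *: "cyc_point q = cyc_point p \<or> cyc_point q = sigma (cyc_point p)"
      by (intro X_set_inj) (auto simp: cyc_point)
    have rot: "D4_orbit q' = D4_orbit p'" if "cyc_point q' = cyc_point p'" for q' p'
      by (rule D4_orbit_rotate) (use that in \<open>simp_all add: cyc_point_def\<close>)
    from * have "cyc_point q = cyc_point p \<or> cyc_point q = cyc_point (swap_gen p)" by (simp add: cyc_point)
    hence "D4_orbit q = D4_orbit p \<or> D4_orbit q = D4_orbit (swap_gen p)"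
      using rot by blast
    thus ?case using 1 by (elim disjE) (simp_all only: D4_orbit_g2)
  qed
  show "?k ` range D4_orbit = ?Y"
  proof (intro equalityI subsetI)
    fix y assume "y \<in> ?k ` range D4_orbit"
    then obtain p where "y = (d4_a p, d4_w p, d4_v p)" using k by auto
    thus "y \<in> ?Y" using X_set_quot_poly[OF cyc_point(1)[of p]] by (simp add: cyc_point)
  next
    fix y assume "y \<in> ?Y"
    then obtain a w v where y: "y = (a, w, v)" "v ^ 2 = quot_poly (0, 0) a w" by auto
    then obtain q where q: "q \<in> X_set" "alpha_B2 q = (0, 0)" "inv_a q = a" "inv_w q = w" "inv_v q = v"
      using X_set_surj by blast
    then obtain p where "cyc_point p = q" using cyc_point_surj by blast
    hence "y = ?k (D4_orbit p)" using q y unfolding k by (auto simp: cyc_point)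
    thus "y \<in> ?k ` range D4_orbit" by blast
  qed
qed

section \<open>The zero fibre\<close>

text \<open>
  Both triples of coordinates embed their varieties with the same image \<open>Y\<close>; one embedding followed
  by the inverse of the other pulls coordinates back to coordinates.
\<close>

lemma variety_iso_affine:
  assumes bij: "bij_betw (\<lambda>p. (f1 p, f2 p, f3 p)) S Y" "bij_betw (\<lambda>p. (h1 p, h2 p, h3 p)) S' Y"
  shows "variety_iso (affine_variety {f1, f2, f3} S) (affine_variety {h1, h2, h3} S')"
proof -
  let ?f = "\<lambda>p. (f1 p, f2 p, f3 p)" and ?g = "\<lambda>p. (h1 p, h2 p, h3 p)"
  define \<phi> where "\<phi> = inv_into S' ?g \<circ> ?f"
  define \<psi> where "\<psi> = inv_into S ?f \<circ> ?g"
  have Y: "?f ` S = Y" "?g ` S' = Y" using bij by (auto simp: bij_betw_def)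
  have fS: "?f p \<in> Y" if "p \<in> S" for p using Y(1) that by blast
  have gS: "?g p \<in> Y" if "p \<in> S'" for p using Y(2) that by blast
  have \<phi>: "\<phi> p \<in> S'" "?g (\<phi> p) = ?f p" if "p \<in> S" for p
    using fS[OF that] inv_into_into[of "?f p" ?g S'] f_inv_into_f[of "?f p" ?g S']
    unfolding \<phi>_def Y o_def by blast+
  have \<psi>: "\<psi> p \<in> S" "?f (\<psi> p) = ?g p" if "p \<in> S'" for p
    using gS[OF that] inv_into_into[of "?g p" ?f S] f_inv_into_f[of "?g p" ?f S]
    unfolding \<psi>_def Y o_def by blast+
  have inj: "inj_on ?f S" "inj_on ?g S'" using bij by (auto simp: bij_betw_def)
  show ?thesis unfolding variety_iso_def
  proof (intro exI conjI ballI)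
    show "variety_morphism (affine_variety {f1, f2, f3} S) (affine_variety {h1, h2, h3} S') \<phi>"
    proof (rule variety_morphism_affine)
      fix h assume "h \<in> {h1, h2, h3}"
      moreover have "(\<lambda>p. h1 (\<phi> p)) \<in> regular_on {f1, f2, f3} S"
        by (rule regular_on_cong[OF regular_on_coord[of f1]]) (use \<phi> in auto)
      moreover have "(\<lambda>p. h2 (\<phi> p)) \<in> regular_on {f1, f2, f3} S"
        by (rule regular_on_cong[OF regular_on_coord[of f2]]) (use \<phi> in auto)
      moreover have "(\<lambda>p. h3 (\<phi> p)) \<in> regular_on {f1, f2, f3} S"
        by (rule regular_on_cong[OF regular_on_coord[of f3]]) (use \<phi> in auto)
      ultimately show "(\<lambda>p. h (\<phi> p)) \<in> regular_on {f1, f2, f3} S" by blast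
    qed (use \<phi> in simp)
    show "variety_morphism (affine_variety {h1, h2, h3} S') (affine_variety {f1, f2, f3} S) \<psi>"
    proof (rule variety_morphism_affine)
      fix h assume "h \<in> {f1, f2, f3}"
      moreover have "(\<lambda>p. f1 (\<psi> p)) \<in> regular_on {h1, h2, h3} S'"
        by (rule regular_on_cong[OF regular_on_coord[of h1]]) (use \<psi> in auto)
      moreover have "(\<lambda>p. f2 (\<psi> p)) \<in> regular_on {h1, h2, h3} S'"
        by (rule regular_on_cong[OF regular_on_coord[of h2]]) (use \<psi> in auto)
      moreover have "(\<lambda>p. f3 (\<psi> p)) \<in> regular_on {h1, h2, h3} S'"
        by (rule regular_on_cong[OF regular_on_coord[of h3]]) (use \<psi> in auto)
      ultimately show "(\<lambda>p. h (\<psi> p)) \<in> regular_on {h1, h2, h3} S'" by blast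
    qed (use \<psi> in simp)
    show "\<psi> (\<phi> p) = p" if "p \<in> points (affine_variety {f1, f2, f3} S)" for p
      using that inj_onD[OF inj(1), of "\<psi> (\<phi> p)" p] \<phi> \<psi> by simp
    show "\<phi> (\<psi> p) = p" if "p \<in> points (affine_variety {h1, h2, h3} S')" for p
      using that inj_onD[OF inj(2), of "\<phi> (\<psi> p)" p] \<phi> \<psi> by simp
  qed
qed

abbreviation "quot_a \<equiv> induced_map inv_a"
abbreviation "quot_w \<equiv> induced_map inv_w"
abbreviation "quot_v \<equiv> induced_map inv_v"

definition fibre_set :: "C2 \<Rightarrow> C5 set set" where
  "fibre_set t = {O' \<in> Omega_orbit ` X_set. alpha_B2_bar O' = t}"

lemma fibre_quot: "fibre X_B2_mod_Omega alpha_B2_bar t = affine_variety {quot_a, quot_w, quot_v} (fibre_set t)"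
  unfolding X_B2_mod_Omega_eq fibre_affine_variety fibre_set_def[symmetric]
proof (rule affine_variety_eqI)
  let ?I = "{quot_a, quot_w, quot_v}"
  have par: "induced_map par_t2 p = fst t" "induced_map par_t4 p = snd t" if "p \<in> fibre_set t" for p
    using that unfolding fibre_set_def
    by (auto simp only: induced_map_Omega) (auto simp: inv_defs alpha_B2_def split: prod.splits)
  have "induced_map par_t2 \<in> regular_on ?I (fibre_set t)"
    by (rule regular_on_cong[OF regular_on_const[of "fst t"]]) (use par in auto)
  moreover have "induced_map par_t4 \<in> regular_on ?I (fibre_set t)"
    by (rule regular_on_cong[OF regular_on_const[of "snd t"]]) (use par in auto)
  moreover fix g assume "g \<in> quot_coords"
  ultimately show "g \<in> regular_on ?I (fibre_set t)"
    unfolding quot_coords_def by (auto intro: regular_on_coord)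
qed (auto simp: quot_coords_def intro: regular_on_coord)

lemma fibre_set_eq:
  "O' \<in> fibre_set t \<Longrightarrow> quot_v O' ^ 2 = quot_poly t (quot_a O') (quot_w O')"
  using X_set_quot_poly by (auto simp: fibre_set_def induced_map_Omega)

lemma fibre_set_surj:
  assumes "v ^ 2 = quot_poly t a w"
  shows "\<exists>p\<in>fibre_set t. quot_a p = a \<and> quot_w p = w \<and> quot_v p = v"
proof -
  obtain p where "p \<in> X_set" "alpha_B2 p = t" "inv_a p = a" "inv_w p = w" "inv_v p = v"
    using X_set_surj[OF assms] by blast
  thus ?thesis
    by (intro bexI[of _ "Omega_orbit p"]) (auto simp: fibre_set_def induced_map_Omega)
qed

lemma fibre_set_bij:
  "bij_betw (\<lambda>p. (quot_a p, quot_w p, quot_v p)) (fibre_set t) {(a, w, v). v ^ 2 = quot_poly t a w}"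
  (is "bij_betw ?k _ ?Y")
  unfolding bij_betw_def
proof
  show "inj_on ?k (fibre_set t)"
  proof (rule inj_onI)
    fix O1 O2 assume *: "O1 \<in> fibre_set t" "O2 \<in> fibre_set t" "?k O1 = ?k O2"
    then obtain p q where pq: "p \<in> X_set" "q \<in> X_set" "O1 = Omega_orbit p" "O2 = Omega_orbit q"
      by (auto simp: fibre_set_def)
    hence "q = p \<or> q = sigma p"
      using * by (intro X_set_inj) (auto simp: fibre_set_def induced_map_Omega)
    thus "O1 = O2" using pq(3,4) by (elim disjE) (simp_all only: Omega_orbit_sigma)
  qed
  show "?k ` fibre_set t = ?Y"
  proof (intro equalityI subsetI)
    fix y assume "y \<in> ?k ` fibre_set t"
    thus "y \<in> ?Y" using fibre_set_eq[where t = t] by auto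
  next
    fix y assume "y \<in> ?Y"
    then obtain a w v where y: "y = (a, w, v)" "v ^ 2 = quot_poly t a w" by auto
    with fibre_set_surj[OF y(2)] show "y \<in> ?k ` fibre_set t" by (auto simp: image_iff)
  qed
qed

lemma zero_fibre_iso: "variety_iso (fibre X_B2_mod_Omega alpha_B2_bar (0, 0)) singularity_D4"
proof -
  have "singularity_D4 =
      affine_variety {induced_map d4_a, induced_map d4_w, induced_map d4_v} (range D4_orbit)"
    by (simp add: singularity_D4_eq)
  thus ?thesis
    unfolding fibre_quot using variety_iso_affine[OF fibre_set_bij D4_orbit_bij] by simp
qed


section \<open>Normal forms on the quotient\<close>

lemma polyfun_snd_poly:
  assumes "q \<in> regular_on coords2 UNIV"
  shows "\<exists>P. \<forall>w. q (a, w) = poly P w"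
proof -
  have "q \<in> polyfuns coords2" using assms by (simp add: regular_on_UNIV)
  thus ?thesis
  proof induction
    case (coord f)
    hence "f = fst \<or> f = snd" by (auto simp: coords2_def case_prod_unfold)
    thus ?case
      by (elim disjE) (simp_all, auto intro: exI[of _ "[:a:]"] exI[of _ "[:0, 1:]"])
  next
    case (const c)
    show ?case by (rule exI[of _ "[:c:]"]) simp
  next
    case (add f g)
    then obtain P Q where "\<forall>w. f (a, w) = poly P w" "\<forall>w. g (a, w) = poly Q w" by blast
    thus ?case by (intro exI[of _ "P + Q"]) simp
  next
    case (mult f g)
    then obtain P Q where "\<forall>w. f (a, w) = poly P w" "\<forall>w. g (a, w) = poly Q w" by blast
    thus ?case by (intro exI[of _ "P * Q"]) simp
  qed
qed

text \<open>
  The two sheets over the \<open>(a, w)\<close>-plane are exchanged by \<open>v \<mapsto> - v\<close>, and \<open>quot_poly\<close> is a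
  nonzero polynomial in \<open>w\<close> for each \<open>a\<close>.
\<close>

lemma sheets_independent:
  assumes p: "p \<in> regular_on coords2 UNIV" and q: "q \<in> regular_on coords2 UNIV"
    and eq: "\<And>a w v. v ^ 2 = quot_poly t a w \<Longrightarrow> p (a, w) + v * q (a, w) = 0"
  shows "p (a, w) = 0" "q (a, w) = 0"
proof -
  have *: "p (a, w) = 0 \<and> (quot_poly t a w = 0 \<or> q (a, w) = 0)" for w
  proof -
    obtain v where v: "v ^ 2 = quot_poly t a w" using power2_csqrt by blast
    hence "(- v) ^ 2 = quot_poly t a w" by simp
    have e: "p (a, w) + v * q (a, w) = 0" "p (a, w) - v * q (a, w) = 0"
      using eq[OF v] eq[OF \<open>(- v) ^ 2 = quot_poly t a w\<close>] by simp_all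
    have "2 * p (a, w) = (p (a, w) + v * q (a, w)) + (p (a, w) - v * q (a, w))" by simp
    hence p0: "p (a, w) = 0" unfolding e by simp
    hence "v = 0 \<or> q (a, w) = 0" using e(1) by simp
    thus ?thesis using v p0 by auto
  qed
  show "p (a, w) = 0" using * by blast
  obtain Q where Q: "\<And>w. q (a, w) = poly Q w" using polyfun_snd_poly[OF q] by blast
  define G where "G = [:0, a ^ 2 - 4 * (snd t + 1 / 8 * fst t ^ 2), - 4 * fst t, - 4:]"
  have G: "quot_poly t a w = poly G w" for w
    by (simp add: quot_poly_def G_def algebra_simps power2_eq_square)
  have "poly (G * Q) w = 0" for w using *[of w] by (auto simp: G Q)
  hence "G * Q = 0" by (intro poly_all_0_iff_0[THEN iffD1] allI)
  moreover have "G \<noteq> 0" by (simp add: G_def)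
  ultimately show "q (a, w) = 0" by (simp add: Q)
qed

lemma bivariate_coefficients_zero:
  fixes c :: "nat \<Rightarrow> nat \<Rightarrow> complex"
  assumes "\<And>a w. (\<Sum>i\<le>n. \<Sum>j\<le>n. c i j * (a ^ i * w ^ j)) = 0" "i \<le> n" "j \<le> n"
  shows "c i j = 0"
proof -
  have "(\<Sum>j\<le>n. c i j * w ^ j) = 0" for w
  proof -
    have "\<forall>a. (\<Sum>i\<le>n. (\<Sum>j\<le>n. c i j * w ^ j) * a ^ i) = 0"
      using assms(1)[of _ w] by (simp add: sum_distrib_right sum_distrib_left mult_ac)
    thus ?thesis
      using assms(2) polyfun_eq_0[of "\<lambda>i. \<Sum>j\<le>n. c i j * w ^ j" n] by simp
  qed
  thus ?thesis using assms(3) polyfun_eq_0[of "c i" n] by simp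
qed

definition quot_basis :: "nat \<times> nat \<times> bool \<Rightarrow> C5 set \<Rightarrow> complex" where
  "quot_basis k p = (case k of (i, j, e) \<Rightarrow> quot_a p ^ i * quot_w p ^ j * (if e then quot_v p else 1))"

text \<open>
  Independence holds on each single fibre, not only on the total space. Therefore it serves both for
  the freeness of the coordinate ring over the parameters and for the reducedness of the fibres.
\<close>

lemma quot_basis_independent:
  assumes F: "finite F" and zero: "\<And>p. p \<in> fibre_set t \<Longrightarrow> (\<Sum>k\<in>F. c k * quot_basis k p) = 0"
    and k: "k \<in> F"
  shows "c k = 0"
proof -
  obtain n where n: "\<And>i j e. (i, j, e) \<in> F \<Longrightarrow> i \<le> n \<and> j \<le> n"
  proof -
    have "finite (fst ` F \<union> (fst \<circ> snd) ` F)" using F by simp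
    then obtain n where n: "\<forall>m\<in>fst ` F \<union> (fst \<circ> snd) ` F. m \<le> n"
      unfolding finite_nat_set_iff_bounded_le ..
    show thesis
    proof (rule that[of n])
      fix i j e assume "(i, j, e) \<in> F"
      hence "i \<in> fst ` F" "j \<in> (fst \<circ> snd) ` F" by force+
      thus "i \<le> n \<and> j \<le> n" using n by blast
    qed
  qed
  define d where "d e i j = (if (i, j, e) \<in> F then c (i, j, e) else 0)" for e i j
  define s where "s e = (\<lambda>p. \<Sum>i\<le>n. \<Sum>j\<le>n. d e i j * (fst p ^ i * snd p ^ j))" for e :: bool
  have s: "s e \<in> regular_on coords2 UNIV" for e
    unfolding s_def by (intro regular_on_intros regular_on_fst_snd)
  have "s False (a, w) + v * s True (a, w) = 0" if v: "v ^ 2 = quot_poly t a w" for a w v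
  proof -
    obtain p where p: "p \<in> fibre_set t" "quot_a p = a" "quot_w p = w" "quot_v p = v"
      using fibre_set_surj[OF v] by blast
    let ?c = "\<lambda>k. if k \<in> F then c k else 0"
    have "0 = (\<Sum>k\<in>F. c k * quot_basis k p)" using zero[OF p(1)] by simp
    also have "\<dots> = (\<Sum>k\<in>{..n} \<times> {..n} \<times> UNIV. ?c k * quot_basis k p)"
      by (intro sum.mono_neutral_cong_left) (auto dest: n)
    also have "\<dots> = (\<Sum>i\<le>n. \<Sum>j\<le>n. \<Sum>e\<in>UNIV. ?c (i, j, e) * quot_basis (i, j, e) p)"
      by (simp add: sum.cartesian_product)
    also have "\<dots> = s False (a, w) + v * s True (a, w)"
      unfolding s_def sum_distrib_left sum.distrib[symmetric]
      by (intro sum.cong refl) (simp add: d_def UNIV_bool quot_basis_def p)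
    finally show ?thesis by simp
  qed
  from sheets_independent[OF s s this]
  have "s e (a, w) = 0" for e a w by (cases e) auto
  hence "d e i j = 0" if "i \<le> n" "j \<le> n" for e i j
    using that by (intro bivariate_coefficients_zero[where n = n and c = "d e"]) (simp_all add: s_def)
  moreover obtain i j e where kk: "k = (i, j, e)" by (cases k) auto
  moreover have "i \<le> n \<and> j \<le> n" using n k unfolding kk by this
  ultimately have "d e i j = 0" by simp
  thus ?thesis using k by (simp add: d_def kk)
qed

definition par_funs :: "(C5 set \<Rightarrow> complex) set" where
  "par_funs = {c \<circ> alpha_B2_bar | c. c \<in> regular_on coords2 UNIV}"

lemma par_funs_closed:
  "(\<lambda>_. c) \<in> par_funs"
  "f \<in> par_funs \<Longrightarrow> g \<in> par_funs \<Longrightarrow> (\<lambda>p. f p + g p) \<in> par_funs"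
  "f \<in> par_funs \<Longrightarrow> g \<in> par_funs \<Longrightarrow> (\<lambda>p. f p * g p) \<in> par_funs"
proof -
  show "(\<lambda>_. c) \<in> par_funs" unfolding par_funs_def
    by (intro CollectI exI[of _ "\<lambda>_. c"]) (auto intro: regular_on_const)
next
  assume "f \<in> par_funs" "g \<in> par_funs"
  then obtain c d where "f = c \<circ> alpha_B2_bar" "g = d \<circ> alpha_B2_bar"
    "c \<in> regular_on coords2 UNIV" "d \<in> regular_on coords2 UNIV" unfolding par_funs_def by blast
  hence "(\<lambda>p. f p + g p) = (\<lambda>t. c t + d t) \<circ> alpha_B2_bar"
    "(\<lambda>p. f p * g p) = (\<lambda>t. c t * d t) \<circ> alpha_B2_bar"
    "(\<lambda>t. c t + d t) \<in> regular_on coords2 UNIV" "(\<lambda>t. c t * d t) \<in> regular_on coords2 UNIV"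
    by (auto intro: regular_on_add regular_on_mult)
  thus "(\<lambda>p. f p + g p) \<in> par_funs" "(\<lambda>p. f p * g p) \<in> par_funs"
    unfolding par_funs_def by blast+
qed

abbreviation quot_set :: "C5 set set" where "quot_set \<equiv> Omega_orbit ` X_set"

lemma quot_set_fibre: "p \<in> quot_set \<Longrightarrow> p \<in> fibre_set (alpha_B2_bar p)"
  by (simp add: fibre_set_def)

lemma quot_set_eq:
  "p \<in> quot_set \<Longrightarrow> quot_v p ^ 2 = quot_poly (alpha_B2_bar p) (quot_a p) (quot_w p)"
  using fibre_set_eq quot_set_fibre by blast

text \<open>
  The weight 2 of \<open>v\<close> is chosen such that the polynomial \<open>quot_poly\<close>, which has degree 3 in \<open>a\<close> and
  \<open>w\<close>, does not exceed the degree of \<open>v\<^sup>2\<close>.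
\<close>

definition quot_deg :: "nat \<times> nat \<times> bool \<Rightarrow> nat" where
  "quot_deg k = (case k of (i, j, e) \<Rightarrow> i + j + (if e then 2 else 0))"

text \<open>
  The functions \<open>c2\<close> and \<open>c4\<close> stand for the two parameters: they are the parameters themselves on the
  whole quotient, and constants on a fibre.
\<close>

lemma quot_basis_mult:
  assumes K: "\<And>c. (\<lambda>_. c) \<in> K" "\<And>f g. f \<in> K \<Longrightarrow> g \<in> K \<Longrightarrow> (\<lambda>p. f p + g p) \<in> K"
      "\<And>f g. f \<in> K \<Longrightarrow> g \<in> K \<Longrightarrow> (\<lambda>p. f p * g p) \<in> K"
    and S: "S \<subseteq> quot_set" and c: "c2 \<in> K" "c4 \<in> K" "\<And>p. p \<in> S \<Longrightarrow> alpha_B2_bar p = (c2 p, c4 p)"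
  shows "(\<lambda>p. quot_basis k p * quot_basis l p)
    \<in> lincombs K quot_basis {m. quot_deg m \<le> quot_deg k + quot_deg l} S" (is "_ \<in> ?L")
proof -
  obtain i j e where k: "k = (i, j, e)" by (cases k) auto
  obtain i' j' e' where l: "l = (i', j', e')" by (cases l) auto
  show ?thesis
  proof (cases "e \<and> e'")
    case False
    have "quot_basis (i + i', j + j', e \<or> e') \<in> ?L"
      using False by (intro lincombs_basis[OF K]) (auto simp: quot_deg_def k l)
    thus ?thesis
      by (rule lincombs_cong) (use False in \<open>auto simp: quot_basis_def k l power_add\<close>)
  next
    case True
    let ?c = "\<lambda>p. c4 p + 1 / 8 * (c2 p * c2 p)"
    let ?b = "\<lambda>x y. quot_basis (i + i' + x, j + j' + y, False)"
    have b: "?b x y \<in> ?L" if "x + y \<le> 4" for x y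
      using that True by (intro lincombs_basis[OF K]) (auto simp: quot_deg_def k l)
    have "(\<lambda>p. - 4 * c2 p) \<in> K" "(\<lambda>p. - 4 * ?c p) \<in> K"
      by (intro K(1) K(2)[OF c(2)] K(3) c(1))+
    hence "(\<lambda>p. ?b 2 1 p + ((- 4) * ?b 0 3 p + ((- 4 * c2 p) * ?b 0 2 p + (- 4 * ?c p) * ?b 0 1 p))) \<in> ?L"
      by (intro lincombs_add[OF K] lincombs_scale[OF K] K(1) b) auto
    thus ?thesis
    proof (rule lincombs_cong)
      fix p assume p: "p \<in> S"
      have "quot_basis k p * quot_basis l p = quot_a p ^ (i + i') * quot_w p ^ (j + j') * quot_v p ^ 2"
        using True by (simp add: quot_basis_def k l power_add power2_eq_square)
      also have "\<dots> = quot_a p ^ (i + i') * quot_w p ^ (j + j') * quot_poly (c2 p, c4 p) (quot_a p) (quot_w p)"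
        using quot_set_eq[of p] S p c(3)[OF p] by auto
      also have "\<dots> = ?b 2 1 p + ((- 4) * ?b 0 3 p + ((- 4 * c2 p) * ?b 0 2 p + (- 4 * ?c p) * ?b 0 1 p))"
        by (simp add: quot_basis_def quot_poly_def power_add algebra_simps power2_eq_square power3_eq_cube)
      finally show "quot_basis k p * quot_basis l p =
        ?b 2 1 p + ((- 4) * ?b 0 3 p + ((- 4 * c2 p) * ?b 0 2 p + (- 4 * ?c p) * ?b 0 1 p))" .
    qed
  qed
qed

lemma alpha_B2_bar_par:
  assumes "p \<in> quot_set"
  shows "alpha_B2_bar p = (induced_map par_t2 p, induced_map par_t4 p)"
  using assms by (auto simp only: induced_map_Omega) (auto simp: inv_defs alpha_B2_def)

lemma quot_normal_form:
  assumes "f \<in> regular_on quot_coords quot_set"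
  shows "f \<in> lincombs par_funs quot_basis UNIV quot_set"
proof (rule regular_on_in_lincombs[OF par_funs_closed _ _ assms])
  let ?L = "lincombs par_funs quot_basis UNIV quot_set"
  have basis: "quot_basis k \<in> ?L" for k by (rule lincombs_basis[OF par_funs_closed UNIV_I])
  have par: "(\<lambda>p. c (alpha_B2_bar p)) \<in> par_funs" if "c \<in> regular_on coords2 UNIV" for c
    unfolding par_funs_def by (intro CollectI exI[of _ c] conjI that) (simp add: o_def)
  note par = par[OF regular_on_fst_snd(1)] par[OF regular_on_fst_snd(2)]
  have mult: "(\<lambda>p. quot_basis k p * quot_basis l p) \<in> ?L" for k l
    by (rule lincombs_mono[OF quot_basis_mult[OF par_funs_closed subset_refl par]]) simp_all
  show "(\<lambda>_. 1) \<in> ?L"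
    by (rule lincombs_cong[OF basis[of "(0, 0, False)"]]) (simp add: quot_basis_def)
  fix g k assume "g \<in> quot_coords"
  then consider "g = quot_a" | "g = quot_w" | "g = quot_v" | "g = induced_map par_t2"
    | "g = induced_map par_t4" unfolding quot_coords_def by auto
  thus "(\<lambda>p. g p * quot_basis k p) \<in> ?L"
  proof cases
    case 1
    show ?thesis by (rule lincombs_cong[OF mult[of "(1, 0, False)" k]]) (simp add: quot_basis_def 1)
  next
    case 2
    show ?thesis by (rule lincombs_cong[OF mult[of "(0, 1, False)" k]]) (simp add: quot_basis_def 2)
  next
    case 3
    show ?thesis by (rule lincombs_cong[OF mult[of "(0, 0, True)" k]]) (simp add: quot_basis_def 3)
  next
    case 4
    have "(\<lambda>p. fst (alpha_B2_bar p) * quot_basis k p) \<in> ?L"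
      by (rule lincombs_scale[OF par_funs_closed par(1) basis])
    thus ?thesis
    proof (rule lincombs_cong)
      fix p assume "p \<in> quot_set"
      from alpha_B2_bar_par[OF this]
      show "g p * quot_basis k p = fst (alpha_B2_bar p) * quot_basis k p" by (simp add: 4)
    qed
  next
    case 5
    have "(\<lambda>p. snd (alpha_B2_bar p) * quot_basis k p) \<in> ?L"
      by (rule lincombs_scale[OF par_funs_closed par(2) basis])
    thus ?thesis
    proof (rule lincombs_cong)
      fix p assume "p \<in> quot_set"
      from alpha_B2_bar_par[OF this]
      show "g p * quot_basis k p = snd (alpha_B2_bar p) * quot_basis k p" by (simp add: 5)
    qed
  qed
qed

lemma quot_normal_form':
  assumes "f \<in> regular_on quot_coords quot_set"
  obtains F c where "finite F" "\<And>k. c k \<in> regular_on coords2 UNIV"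
    "\<And>p. p \<in> quot_set \<Longrightarrow> f p = (\<Sum>k\<in>F. c k (alpha_B2_bar p) * quot_basis k p)"
proof -
  obtain F c where F: "finite F" "\<And>k. c k \<in> par_funs"
    "\<And>p. p \<in> quot_set \<Longrightarrow> f p = (\<Sum>k\<in>F. c k p * quot_basis k p)"
    by (rule lincombsE[OF quot_normal_form[OF assms]]) (rule that)
  have "\<forall>k. \<exists>d. c k = d \<circ> alpha_B2_bar \<and> d \<in> regular_on coords2 UNIV"
    using F(2) unfolding par_funs_def by blast
  from choice[OF this] obtain d where
    d: "\<forall>k. c k = d k \<circ> alpha_B2_bar \<and> d k \<in> regular_on coords2 UNIV" ..
  show thesis
    by (rule that[of F d]) (use F d in auto)
qed

lemma quot_basis_regular: "quot_basis k \<in> regular_on quot_coords S"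
proof -
  have I: "quot_a \<in> regular_on quot_coords S" "quot_w \<in> regular_on quot_coords S"
    "quot_v \<in> regular_on quot_coords S"
    by (intro regular_on_coord; simp add: quot_coords_def)+
  have "(\<lambda>p. quot_a p ^ i * quot_w p ^ j * (if e then quot_v p else 1)) \<in> regular_on quot_coords S" for i j e
    by (cases e) (auto intro!: regular_on_mult regular_on_power I regular_on_const)
  moreover have "quot_basis k = (\<lambda>p. quot_a p ^ fst k * quot_w p ^ fst (snd k) * (if snd (snd k) then quot_v p else 1))"
    by (simp add: quot_basis_def case_prod_unfold fun_eq_iff)
  ultimately show ?thesis by simp
qed

section \<open>Flatness and the scheme-theoretic zero fibre\<close>

lemma alpha_B2_bar_morphism: "variety_morphism X_B2_mod_Omega affine_plane alpha_B2_bar"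
  unfolding X_B2_mod_Omega_eq affine_plane_def
proof (rule variety_morphism_affine)
  fix g :: "C2 \<Rightarrow> complex" assume "g \<in> coords2"
  hence g: "g = fst \<or> g = snd" by (auto simp: coords2_def case_prod_unfold)
  have "induced_map par_t2 \<in> regular_on quot_coords quot_set"
    "induced_map par_t4 \<in> regular_on quot_coords quot_set"
    by (intro regular_on_coord; simp add: quot_coords_def)+
  moreover have "fst (alpha_B2_bar p) = induced_map par_t2 p" "snd (alpha_B2_bar p) = induced_map par_t4 p"
    if "p \<in> quot_set" for p
    using alpha_B2_bar_par[OF that] by simp_all
  ultimately show "(\<lambda>p. g (alpha_B2_bar p)) \<in> regular_on quot_coords quot_set"
    using g by (auto elim: regular_on_cong)
qed simp

lemma alpha_B2_bar_flat: "flat_morphism X_B2_mod_Omega affine_plane alpha_B2_bar"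
  unfolding flat_morphism_def
proof
  show "flat_module (coord_ring affine_plane) (pullback_module X_B2_mod_Omega alpha_B2_bar)"
    unfolding X_B2_mod_Omega_eq affine_plane_def
  proof (rule flat_module_of_basis)
    show "variety_morphism (affine_variety quot_coords quot_set) (affine_variety coords2 UNIV) alpha_B2_bar"
      using alpha_B2_bar_morphism unfolding X_B2_mod_Omega_eq affine_plane_def .
    show "quot_basis k \<in> regular_on quot_coords quot_set" for k by (rule quot_basis_regular)
    show "\<exists>F c. finite F \<and> (\<forall>k. c k \<in> regular_on coords2 UNIV) \<and>
        (\<forall>p\<in>quot_set. f p = (\<Sum>k\<in>F. c k (alpha_B2_bar p) * quot_basis k p))"
      if f: "f \<in> regular_on quot_coords quot_set" for f
    proof -
      obtain F c where "finite F" "\<And>k. c k \<in> regular_on coords2 UNIV"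
        "\<And>p. p \<in> quot_set \<Longrightarrow> f p = (\<Sum>k\<in>F. c k (alpha_B2_bar p) * quot_basis k p)"
        by (rule quot_normal_form'[OF f]) (rule that)
      thus ?thesis by (intro exI[of _ F] exI[of _ c]) simp
    qed
    show "\<forall>k\<in>F. \<forall>t\<in>UNIV. c k t = 0"
      if F: "finite F" and zero: "\<And>p. p \<in> quot_set \<Longrightarrow> (\<Sum>k\<in>F. c k (alpha_B2_bar p) * quot_basis k p) = 0"
      for F and c :: "nat \<times> nat \<times> bool \<Rightarrow> C2 \<Rightarrow> complex"
    proof (intro ballI)
      fix k t assume k: "k \<in> F"
      show "c k t = 0"
      proof (rule quot_basis_independent[OF F _ k])
        fix p assume "p \<in> fibre_set t"
        hence "p \<in> quot_set" "alpha_B2_bar p = t" by (auto simp only: fibre_set_def)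
        thus "(\<Sum>k\<in>F. c k t * quot_basis k p) = 0" using zero[of p] by simp
      qed
    qed
  qed
qed (rule alpha_B2_bar_morphism)

text \<open>
  If a function vanishes on the fibre over \<open>t\<close>, the coefficients of its normal form vanish at \<open>t\<close>,
  hence they lie in the pulled-back maximal ideal.
\<close>

lemma fibre_reduced: "reduced_fibre X_B2_mod_Omega affine_plane alpha_B2_bar t"
proof -
  let ?V = "affine_variety quot_coords quot_set" and ?W = "affine_variety coords2 UNIV"
  let ?I = "{f \<in> regfuns ?V. \<forall>p\<in>points ?V. alpha_B2_bar p = t \<longrightarrow> f p = 0}"
  let ?G = "pullback ?V alpha_B2_bar ` {g \<in> regfuns ?W. g t = 0}"
  have "?I = genideal (coord_ring ?V) ?G"
  proof
    have "?I = {f \<in> regfuns ?V. \<forall>p\<in>fibre_set t. f p = 0}" by (auto simp: fibre_set_def)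
    hence "ideal ?I (coord_ring ?V)"
      using ideal_vanishing[of "fibre_set t" quot_set quot_coords] by (auto simp: fibre_set_def)
    moreover have "?G \<subseteq> ?I"
      using alpha_B2_bar_morphism
      unfolding variety_morphism_def X_B2_mod_Omega_eq affine_plane_def
      by (auto simp: pullback_def)
    ultimately show "genideal (coord_ring ?V) ?G \<subseteq> ?I" by (auto simp: genideal_def)
  next
    show "?I \<subseteq> genideal (coord_ring ?V) ?G"
      unfolding genideal_def
    proof (intro subsetI InterI, elim CollectE conjE)
      fix f J assume f: "f \<in> regfuns ?V" and zero: "\<forall>p\<in>points ?V. alpha_B2_bar p = t \<longrightarrow> f p = 0"
        and J: "ideal J (coord_ring ?V)" "?G \<subseteq> J"
      have "f \<in> regular_on quot_coords quot_set" using f by (simp add: regfuns_affine_variety)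
      then obtain F c where F: "finite F" "\<And>k. c k \<in> regular_on coords2 UNIV"
        "\<And>p. p \<in> quot_set \<Longrightarrow> f p = (\<Sum>k\<in>F. c k (alpha_B2_bar p) * quot_basis k p)"
        by (rule quot_normal_form') (rule that)
      have c0: "c k t = 0" if k: "k \<in> F" for k
      proof (rule quot_basis_independent[OF F(1) _ k])
        fix p assume "p \<in> fibre_set t"
        hence "p \<in> quot_set" "alpha_B2_bar p = t" by (auto simp only: fibre_set_def)
        thus "(\<Sum>k\<in>F. c k t * quot_basis k p) = 0" using F(3)[of p] zero by simp
      qed
      have "(\<lambda>p\<in>quot_set. c k (alpha_B2_bar p) * quot_basis k p) \<in> J" if k: "k \<in> F" for k
      proof (rule ideal_coord_ring_mult[OF J(1)])
        have "pullback ?V alpha_B2_bar (c k) \<in> ?G"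
          using F(2)[of k] c0[OF k] by (auto simp: regfuns_affine_variety)
        thus "(\<lambda>p\<in>quot_set. c k (alpha_B2_bar p)) \<in> J"
          using J(2) by (auto simp: pullback_def)
      qed (rule quot_basis_regular)
      hence "(\<lambda>p\<in>quot_set. \<Sum>k\<in>F. c k (alpha_B2_bar p) * quot_basis k p) \<in> J"
        by (rule ideal_coord_ring_sum[OF J(1)])
      moreover have "(\<lambda>p\<in>quot_set. \<Sum>k\<in>F. c k (alpha_B2_bar p) * quot_basis k p) = restrict f quot_set"
        by (rule restrict_ext) (simp add: F(3))
      ultimately show "f \<in> J" using regfuns_extensional[OF f] by simp
    qed
  qed
  thus ?thesis
    unfolding reduced_fibre_def X_B2_mod_Omega_eq affine_plane_def .
qed

lemma quotient_deformation:
  "deformation X_B2_mod_Omega affine_plane alpha_B2_bar (0, 0) singularity_D4"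
  unfolding deformation_def
  using alpha_B2_bar_flat fibre_reduced zero_fibre_iso by (simp add: affine_plane_def)


section \<open>The Krull dimension of an algebra with algebraic dependences\<close>

interpretation fs: vector_space "\<lambda>(c::complex) (D :: 'b \<Rightarrow> complex) f. c * D f"
  by (rule vector_space_functionals)

lemma homogeneous_system_solvable:
  fixes M :: "'k \<Rightarrow> 'i \<Rightarrow> complex"
  assumes A: "finite A" "finite I" "card A < card I" "\<And>l i. i \<notin> A \<Longrightarrow> M l i = 0"
  shows "\<exists>c. (\<exists>l\<in>I. c l \<noteq> 0) \<and> (\<forall>i. (\<Sum>l\<in>I. c l * M l i) = 0)"
proof (cases "inj_on M I")
  case False
  then obtain k l where kl: "k \<in> I" "l \<in> I" "k \<noteq> l" "M k = M l" by (auto simp: inj_on_def)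
  define c :: "'k \<Rightarrow> complex" where "c m = (if m = k then 1 else 0) - (if m = l then 1 else 0)" for m
  have "(\<Sum>m\<in>I. c m * M m i) = 0" for i
    using kl A(2) by (simp add: c_def left_diff_distrib sum_subtractf if_distrib[of "\<lambda>x. x * _"] cong: if_cong)
  moreover have "c k \<noteq> 0" using kl by (simp add: c_def)
  ultimately show ?thesis using kl(1) by blast
next
  case True
  define \<delta> :: "'i \<Rightarrow> 'i \<Rightarrow> complex" where "\<delta> k i = (if i = k then 1 else 0)" for k i
  have "M l \<in> fs.span (\<delta> ` A)" for l
  proof -
    have "(\<Sum>k\<in>A. (\<lambda>i. M l k * \<delta> k i)) \<in> fs.span (\<delta> ` A)"
      by (intro fs.span_sum fs.span_scale fs.span_base imageI)
    also have "(\<Sum>k\<in>A. (\<lambda>i. M l k * \<delta> k i)) = M l"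
    proof
      fix i
      have "(\<Sum>k\<in>A. (\<lambda>i. M l k * \<delta> k i)) i = (\<Sum>k\<in>A. M l k * \<delta> k i)"
        using A(1) by (induction A) auto
      also have "\<dots> = M l i"
        using A(1,4) by (cases "i \<in> A") (auto simp: \<delta>_def mult_delta_right)
      finally show "(\<Sum>k\<in>A. (\<lambda>i. M l k * \<delta> k i)) i = M l i" .
    qed
    finally show ?thesis .
  qed
  hence "M ` I \<subseteq> fs.span (\<delta> ` A)" by blast
  hence "fs.dependent (M ` I)"
    using fs.independent_span_bound[of "\<delta> ` A" "M ` I"] A card_image[OF True] card_image_le[OF A(1), of \<delta>]
    by fastforce
  then obtain u where u: "\<exists>v\<in>M ` I. u v \<noteq> 0" "(\<Sum>v\<in>M ` I. (\<lambda>i. u v * v i)) = 0"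
    using fs.dependent_finite[of "M ` I"] A(2) by blast
  have "(\<Sum>l\<in>I. u (M l) * M l i) = 0" for i
  proof -
    have "(\<Sum>l\<in>J. (\<lambda>i. u (M l) * M l i)) i = (\<Sum>l\<in>J. u (M l) * M l i)" if "finite J" for J
      using that by (induction J) auto
    moreover have "(\<Sum>l\<in>I. (\<lambda>i. u (M l) * M l i)) = 0"
      using u(2) by (simp add: sum.reindex[OF True] o_def)
    ultimately show ?thesis using A(2) by (metis zero_fun_apply)
  qed
  thus ?thesis using u(1) by (intro exI[of _ "\<lambda>l. u (M l)"]) auto
qed

lemma lincombs_dependent:
  assumes A: "finite A" "finite I" "card A < card I"
    and f: "\<And>l. l \<in> I \<Longrightarrow> f l \<in> lincombs constants B A S"
  shows "\<exists>c. (\<exists>l\<in>I. c l \<noteq> 0) \<and> (\<forall>p\<in>S. (\<Sum>l\<in>I. c l * f l p) = 0)"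
proof -
  have "\<exists>m. (\<forall>i. i \<notin> A \<longrightarrow> m i = 0) \<and> (\<forall>p\<in>S. f l p = (\<Sum>i\<in>A. m i * B i p))" if l: "l \<in> I" for l
  proof -
    obtain F c where F: "finite F" "F \<subseteq> A" "\<And>i. c i \<in> constants"
      "\<And>p. p \<in> S \<Longrightarrow> f l p = (\<Sum>i\<in>F. c i p * B i p)"
      by (rule lincombsE[OF f[OF l]]) (rule that)
    define m where "m i = (if i \<in> F then c i undefined else 0)" for i
    have "f l p = (\<Sum>i\<in>A. m i * B i p)" if p: "p \<in> S" for p
    proof -
      have "c i p = m i" if "i \<in> F" for i using F(3)[of i] that by (auto simp: m_def)
      hence "(\<Sum>i\<in>F. c i p * B i p) = (\<Sum>i\<in>A. m i * B i p)"
        using A(1) F(2) by (intro sum.mono_neutral_cong_left) (auto simp: m_def)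
      thus ?thesis using F(4)[OF p] by simp
    qed
    moreover have "m i = 0" if "i \<notin> A" for i using that F(2) by (auto simp: m_def)
    ultimately show ?thesis by blast
  qed
  hence "\<forall>l\<in>I. \<exists>m. (\<forall>i. i \<notin> A \<longrightarrow> m i = 0) \<and> (\<forall>p\<in>S. f l p = (\<Sum>i\<in>A. m i * B i p))"
    by (rule ballI)
  from bchoice[OF this] obtain M' where M': "\<forall>l\<in>I. (\<forall>i. i \<notin> A \<longrightarrow> M' l i = 0) \<and>
      (\<forall>p\<in>S. f l p = (\<Sum>i\<in>A. M' l i * B i p))" ..
  define M where "M l i = (if i \<in> A then M' l i else 0)" for l i
  have M: "f l p = (\<Sum>i\<in>A. M l i * B i p)" if "l \<in> I" "p \<in> S" for l p
    using bspec[OF M' that(1)] that(2) by (simp add: M_def)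
  have M0: "M l i = 0" if "i \<notin> A" for l i using that by (simp add: M_def)
  have "\<exists>c. (\<exists>l\<in>I. c l \<noteq> 0) \<and> (\<forall>i. (\<Sum>l\<in>I. c l * M l i) = 0)"
    by (rule homogeneous_system_solvable[OF A]) (rule M0)
  then obtain c where c: "\<exists>l\<in>I. c l \<noteq> 0" "\<forall>i. (\<Sum>l\<in>I. c l * M l i) = 0" by (elim exE conjE)
  have "(\<Sum>l\<in>I. c l * f l p) = 0" if p: "p \<in> S" for p
  proof -
    have "(\<Sum>l\<in>I. c l * f l p) = (\<Sum>l\<in>I. \<Sum>i\<in>A. c l * M l i * B i p)"
      using M p by (simp add: sum_distrib_left mult.assoc)
    also have "\<dots> = (\<Sum>i\<in>A. (\<Sum>l\<in>I. c l * M l i) * B i p)"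
      by (subst sum.swap) (simp add: sum_distrib_right)
    finally show ?thesis by (simp add: c(2))
  qed
  thus ?thesis using c(1) by blast
qed

text \<open>
  As \<open>x\<close> does not lie in the prime \<open>I\<close>, the relation can be divided by the largest power of \<open>x\<close> that
  it contains. Modulo \<open>x\<close>, hence modulo \<open>J\<close>, only the lowest coefficient remains. The predicate \<open>Z\<close>
  marks coefficients that are known to vanish formally.
\<close>

lemma lowest_coefficient_in_ideal:
  fixes y :: "nat \<Rightarrow> 'a \<Rightarrow> complex"
  assumes I: "primeideal I (coord_ring (affine_variety C S))"
    and J: "ideal J (coord_ring (affine_variety C S))" "I \<subseteq> J"
    and x: "x \<in> regular_on C S" "restrict x S \<in> J" "restrict x S \<notin> I"
    and y: "\<And>i. y i \<in> regular_on C S"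
    and rel: "(\<lambda>p\<in>S. \<Sum>i<N. x p ^ i * y i p) \<in> I"
    and Z: "\<And>i. Z i \<Longrightarrow> (\<forall>p\<in>S. y i p = 0)" "\<exists>i<N. \<not> Z i"
  shows "\<exists>i<N. \<not> Z i \<and> restrict (y i) S \<in> J"
  using y rel Z
proof (induction N arbitrary: y Z)
  case 0
  thus ?case by simp
next
  case (Suc N)
  let ?s = "\<lambda>p. \<Sum>i<N. x p ^ i * y (Suc i) p"
  have s: "?s \<in> regular_on C S"
    by (intro regular_on_sum regular_on_mult regular_on_power x(1) Suc.prems(1))
  have split: "(\<Sum>i<Suc N. x p ^ i * y i p) = y 0 p + x p * ?s p" for p
    unfolding sum.lessThan_Suc_shift sum_distrib_left by (simp add: mult.assoc)
  have rel: "(\<lambda>p\<in>S. y 0 p + x p * ?s p) \<in> I"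
    using Suc.prems(2) unfolding split .
  show ?case
  proof (cases "Z 0")
    case False
    have "(\<lambda>p\<in>S. x p * (- ?s p)) \<in> J"
      by (rule ideal_coord_ring_mult[OF J(1) x(2) regular_on_uminus[OF s]])
    with subsetD[OF J(2) rel] have "(\<lambda>p\<in>S. (y 0 p + x p * ?s p) + x p * (- ?s p)) \<in> J"
      by (rule ideal_coord_ring_add[OF J(1), where f = "\<lambda>p. y 0 p + x p * ?s p"])
    hence "restrict (y 0) S \<in> J" by simp
    thus ?thesis using False by blast
  next
    case True
    have "(\<lambda>p\<in>S. y 0 p + x p * ?s p) = restrict x S \<otimes>\<^bsub>coord_ring (affine_variety C S)\<^esub> restrict ?s S"
      using Suc.prems(3)[OF True] by (auto simp: fun_eq_iff)
    with rel have "restrict x S \<otimes>\<^bsub>coord_ring (affine_variety C S)\<^esub> restrict ?s S \<in> I" by simp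
    hence "restrict x S \<in> I \<or> restrict ?s S \<in> I"
      using x(1) s by (intro primeideal.I_prime[OF I]) auto
    hence "restrict ?s S \<in> I" using x(3) by blast
    moreover have "\<exists>i<N. \<not> Z (Suc i)"
      using Suc.prems(4) True by (metis less_Suc_eq_0_disj)
    ultimately have "\<exists>i<N. \<not> Z (Suc i) \<and> restrict (y (Suc i)) S \<in> J"
      by (intro Suc.IH[of "\<lambda>i. y (Suc i)" "\<lambda>i. Z (Suc i)"] Suc.prems(1,3))
    thus ?thesis by blast
  qed
qed

text \<open>
  A chain of four primes gives three functions, each entering at one step of the chain. Applied to a
  nontrivial polynomial relation between them, \<open>lowest_coefficient_in_ideal\<close> removes one variable at
  each step and leaves a nonzero constant in the last prime.
\<close>

lemma local_dim_le_2:
  assumes p: "p \<in> S"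
    and dep: "\<And>x y z. x \<in> regular_on C S \<Longrightarrow> y \<in> regular_on C S \<Longrightarrow> z \<in> regular_on C S \<Longrightarrow>
      \<exists>N c. (\<exists>i<N. \<exists>j<N. \<exists>k<N. c i j k \<noteq> 0) \<and>
        (\<forall>q\<in>S. (\<Sum>i<N. \<Sum>j<N. \<Sum>k<N. c i j k * (x q ^ i * y q ^ j * z q ^ k)) = (0 :: complex))"
  shows "local_dim (affine_variety C S) p \<le> enat 2"
  unfolding local_dim_def
proof (rule Sup_least, elim CollectE exE conjE)
  fix d n and P :: "nat \<Rightarrow> ('a \<Rightarrow> complex) set"
  let ?R = "coord_ring (affine_variety C S)"
  assume d: "d = enat n"
    and prime: "\<forall>i\<le>n. primeideal (P i) ?R \<and> P i \<subseteq> maximal_ideal_at (affine_variety C S) p"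
    and chain: "\<forall>i<n. P i \<subset> P (Suc i)"
  have "n \<le> 2"
  proof (rule ccontr)
    assume "\<not> n \<le> 2"
    hence n: "3 \<le> n" by simp
    have id: "ideal (P i) ?R" if "i \<le> 3" for i
      using prime that n primeideal.axioms(1) by (meson order_trans)
    have pr: "primeideal (P i) ?R" if "i \<le> 3" for i
      using prime that n by (meson order_trans)
    have pr3: "primeideal (P 0) ?R" "primeideal (P 1) ?R" "primeideal (P 2) ?R"
      by (rule pr, simp)+
    have id3: "ideal (P 1) ?R" "ideal (P 2) ?R" "ideal (P 3) ?R"
      by (rule id, simp)+
    have "\<exists>x. x \<in> regular_on C S \<and> restrict x S \<in> P (Suc i) \<and> restrict x S \<notin> P i" if i: "i < 3" for i
    proof -
      have "P i \<subset> P (Suc i)" using chain i n by simp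
      then obtain x where x: "x \<in> P (Suc i)" "x \<notin> P i" by blast
      have "x \<in> regfuns (affine_variety C S)" using ideal.Icarr[OF id x(1)] i by simp
      from regfuns_extensional[OF this] this show ?thesis
        using x by (intro exI[of _ x]) (simp add: regfuns_affine_variety)
    qed
    from this[of 0] this[of 1] this[of 2] obtain x y z where
      x: "x \<in> regular_on C S" "restrict x S \<in> P 1" "restrict x S \<notin> P 0" and
      y: "y \<in> regular_on C S" "restrict y S \<in> P 2" "restrict y S \<notin> P 1" and
      z: "z \<in> regular_on C S" "restrict z S \<in> P 3" "restrict z S \<notin> P 2"
      by (auto simp: numeral_eq_Suc)
    have sub: "P 0 \<subseteq> P 1" "P 1 \<subseteq> P 2" "P 2 \<subseteq> P 3"
      using chain[rule_format, of 0] chain[rule_format, of 1] chain[rule_format, of 2] n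
      by (auto simp: numeral_eq_Suc)
    obtain N c where c: "\<exists>i<N. \<exists>j<N. \<exists>k<N. c i j k \<noteq> 0" and
      rel: "\<And>q. q \<in> S \<Longrightarrow> (\<Sum>i<N. \<Sum>j<N. \<Sum>k<N. c i j k * (x q ^ i * y q ^ j * z q ^ k)) = 0"
      using dep[OF x(1) y(1) z(1)] by blast
    define f where "f i j = (\<lambda>q. \<Sum>k<N. z q ^ k * c i j k)" for i j
    define g where "g i = (\<lambda>q. \<Sum>j<N. y q ^ j * f i j q)" for i
    have f_reg: "f i j \<in> regular_on C S" for i j
      unfolding f_def by (intro regular_on_intros z(1))
    have g_reg: "g i \<in> regular_on C S" for i
      unfolding g_def by (intro regular_on_sum regular_on_mult regular_on_power f_reg y(1))
    have "(\<Sum>i<N. x q ^ i * g i q) = 0" if "q \<in> S" for q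
      using rel[OF that] by (simp add: f_def g_def sum_distrib_left mult_ac)
    hence "(\<lambda>q\<in>S. \<Sum>i<N. x q ^ i * g i q) = (\<lambda>q\<in>S. 0)" by auto
    hence "(\<lambda>q\<in>S. \<Sum>i<N. x q ^ i * g i q) \<in> P 0"
      using ideal_coord_ring_zero[OF id[of 0]] by simp
    hence "\<exists>i<N. \<not> (\<forall>j<N. \<forall>k<N. c i j k = 0) \<and> restrict (g i) S \<in> P 1"
      by (rule lowest_coefficient_in_ideal[OF pr3(1) id3(1) sub(1) x g_reg]) (use c in \<open>auto simp: f_def g_def\<close>)
    then obtain i where i: "\<exists>j<N. \<exists>k<N. c i j k \<noteq> 0" "restrict (g i) S \<in> P 1" by blast
    have "(\<lambda>q\<in>S. \<Sum>j<N. y q ^ j * f i j q) \<in> P 1" using i(2) by (simp add: g_def)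
    hence "\<exists>j<N. \<not> (\<forall>k<N. c i j k = 0) \<and> restrict (f i j) S \<in> P 2"
      by (rule lowest_coefficient_in_ideal[OF pr3(2) id3(2) sub(2) y f_reg]) (use i in \<open>auto simp: f_def\<close>)
    then obtain j where j: "\<exists>k<N. c i j k \<noteq> 0" "restrict (f i j) S \<in> P 2" by blast
    have "(\<lambda>q\<in>S. \<Sum>k<N. z q ^ k * c i j k) \<in> P 2" using j(2) by (simp add: f_def)
    hence "\<exists>k<N. \<not> c i j k = 0 \<and> restrict (\<lambda>q. c i j k) S \<in> P 3"
      by (rule lowest_coefficient_in_ideal[OF pr3(3) id3(3) sub(3) z regular_on_const]) (use j in auto)
    then obtain k where k: "c i j k \<noteq> 0" "(\<lambda>q\<in>S. c i j k) \<in> P 3" by blast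
    have "P 3 \<subseteq> maximal_ideal_at (affine_variety C S) p" using prime n by blast
    with k(2) have "(\<lambda>q\<in>S. c i j k) p = 0" by (auto simp: maximal_ideal_at_def)
    thus False using k(1) p by simp
  qed
  thus "d \<le> enat 2" using d by simp
qed


section \<open>The fibres are two-dimensional\<close>

abbreviation fibre_coords :: "(C5 set \<Rightarrow> complex) set" where
  "fibre_coords \<equiv> {quot_a, quot_w, quot_v}"

lemma constants_lincombs_basis: "i \<in> A \<Longrightarrow> B i \<in> lincombs constants B A S"
  by (rule lincombs_basis[OF constants_closed])

lemma constants_lincombs_scale:
  assumes "f \<in> lincombs constants B A S"
  shows "(\<lambda>p. c * f p) \<in> lincombs constants B A S"
  by (rule lincombs_scale[OF constants_closed constants_closed(1) assms])

lemma constants_lincombs_add: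
  assumes "f \<in> lincombs constants B A S" "g \<in> lincombs constants B A S"
  shows "(\<lambda>p. f p + g p) \<in> lincombs constants B A S"
  by (rule lincombs_add[OF constants_closed assms])

definition bounded_deg :: "nat \<Rightarrow> C2 \<Rightarrow> (C5 set \<Rightarrow> complex) set" where
  "bounded_deg n t = lincombs constants quot_basis {k. quot_deg k \<le> n} (fibre_set t)"

lemma bounded_deg_mono: "f \<in> bounded_deg m t \<Longrightarrow> m \<le> n \<Longrightarrow> f \<in> bounded_deg n t"
  unfolding bounded_deg_def by (erule lincombs_mono) auto

lemma bounded_deg_mult:
  assumes "f \<in> bounded_deg m t" "g \<in> bounded_deg n t"
  shows "(\<lambda>p. f p * g p) \<in> bounded_deg (m + n) t"
proof -
  have 1: "(\<lambda>p. quot_basis k p * quot_basis l p) \<in> bounded_deg (m + n) t"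
    if "quot_deg k \<le> m" "quot_deg l \<le> n" for k l
  proof -
    have "(\<lambda>p. quot_basis k p * quot_basis l p)
        \<in> lincombs constants quot_basis {i. quot_deg i \<le> quot_deg k + quot_deg l} (fibre_set t)"
      by (rule quot_basis_mult[OF constants_closed, where ?c2.0 = "\<lambda>_. fst t" and ?c4.0 = "\<lambda>_. snd t"])
         (auto simp: fibre_set_def)
    thus ?thesis unfolding bounded_deg_def by (rule lincombs_mono) (use that in auto)
  qed
  have 2: "(\<lambda>p. quot_basis k p * g p) \<in> bounded_deg (m + n) t" if k: "quot_deg k \<le> m" for k
    unfolding bounded_deg_def
  proof (rule lincombs_mult_right[OF constants_closed assms(2)[unfolded bounded_deg_def]])
    fix l assume "l \<in> {k. quot_deg k \<le> n}"
    with 1[OF k] show "(\<lambda>p. quot_basis k p * quot_basis l p)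
        \<in> lincombs constants quot_basis {k. quot_deg k \<le> m + n} (fibre_set t)"
      by (simp add: bounded_deg_def)
  qed
  have "(\<lambda>p. g p * f p) \<in> bounded_deg (m + n) t"
    unfolding bounded_deg_def
  proof (rule lincombs_mult_right[OF constants_closed assms(1)[unfolded bounded_deg_def]])
    fix k assume "k \<in> {k. quot_deg k \<le> m}"
    with 2[of k] show "(\<lambda>p. g p * quot_basis k p)
        \<in> lincombs constants quot_basis {k. quot_deg k \<le> m + n} (fibre_set t)"
      by (simp add: bounded_deg_def mult.commute)
  qed
  thus ?thesis by (simp add: mult.commute)
qed

lemma bounded_deg_basis: "quot_basis k \<in> bounded_deg (quot_deg k) t"
  unfolding bounded_deg_def by (rule constants_lincombs_basis) simp

lemma bounded_deg_const: "(\<lambda>_. c) \<in> bounded_deg 0 t"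
proof -
  have "quot_basis (0, 0, False) \<in> bounded_deg 0 t"
    using bounded_deg_basis[of "(0, 0, False)" t] by (simp add: quot_deg_def)
  hence "(\<lambda>p. c * quot_basis (0, 0, False) p) \<in> bounded_deg 0 t"
    unfolding bounded_deg_def by (rule constants_lincombs_scale)
  thus ?thesis by (simp add: quot_basis_def)
qed

lemma bounded_deg_power:
  assumes "f \<in> bounded_deg d t"
  shows "(\<lambda>p. f p ^ n) \<in> bounded_deg (d * n) t"
proof (induction n)
  case 0
  show ?case by (simp add: bounded_deg_const)
next
  case (Suc n)
  show ?case using bounded_deg_mult[OF assms Suc] by simp
qed

lemma bounded_deg_exists:
  assumes "f \<in> regular_on fibre_coords (fibre_set t)"
  shows "\<exists>d. f \<in> bounded_deg d t"
proof -
  obtain g where g: "g \<in> polyfuns fibre_coords" "\<And>p. p \<in> fibre_set t \<Longrightarrow> f p = g p"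
    using assms by (auto simp: regular_on_def)
  from g(1) have "\<exists>d. g \<in> bounded_deg d t"
  proof induction
    case (coord h)
    have "quot_basis (1, 0, False) = quot_a" "quot_basis (0, 1, False) = quot_w"
      "quot_basis (0, 0, True) = quot_v" by (auto simp: quot_basis_def fun_eq_iff)
    moreover have "h = quot_a \<or> h = quot_w \<or> h = quot_v" using coord by simp
    ultimately have "h = quot_basis (1, 0, False) \<or> h = quot_basis (0, 1, False) \<or>
        h = quot_basis (0, 0, True)" by simp
    thus ?case by (elim disjE; simp only:) (rule exI, rule bounded_deg_basis)+
  next
    case (const c)
    show ?case by (rule exI, rule bounded_deg_const)
  next
    case (add f g)
    then obtain m n where fg: "f \<in> bounded_deg m t" "g \<in> bounded_deg n t" by (elim exE)
    have "f \<in> bounded_deg (max m n) t" "g \<in> bounded_deg (max m n) t"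
      by (rule bounded_deg_mono[OF fg(1)], simp) (rule bounded_deg_mono[OF fg(2)], simp)
    hence "(\<lambda>p. f p + g p) \<in> bounded_deg (max m n) t"
      unfolding bounded_deg_def by (rule constants_lincombs_add)
    thus ?case by blast
  next
    case (mult f g)
    then obtain m n where "f \<in> bounded_deg m t" "g \<in> bounded_deg n t" by (elim exE)
    from bounded_deg_mult[OF this] show ?case ..
  qed
  then obtain d where "g \<in> bounded_deg d t" ..
  hence "f \<in> bounded_deg d t" unfolding bounded_deg_def by (rule lincombs_cong) (rule g(2))
  thus ?thesis ..
qed

lemma quot_deg_count: "finite {k. quot_deg k \<le> n}" "card {k. quot_deg k \<le> n} \<le> 2 * (n + 1) ^ 2"
proof -
  have sub: "{k. quot_deg k \<le> n} \<subseteq> {..n} \<times> {..n} \<times> UNIV"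
    by (auto simp: quot_deg_def)
  thus "finite {k. quot_deg k \<le> n}" by (rule finite_subset) simp
  have "card {k. quot_deg k \<le> n} \<le> card ({..n} \<times> {..n} \<times> (UNIV :: bool set))"
    by (rule card_mono[OF _ sub]) simp
  thus "card {k. quot_deg k \<le> n} \<le> 2 * (n + 1) ^ 2"
    by (simp add: card_cartesian_product power2_eq_square algebra_simps)
qed

text \<open>
  The functions of degree at most \<open>n\<close> form a space of dimension quadratic in \<open>n\<close>, while three
  functions have cubically many monomials.
\<close>

lemma fibre_functions_dependent:
  assumes "x \<in> regular_on fibre_coords (fibre_set t)" "y \<in> regular_on fibre_coords (fibre_set t)"
    "z \<in> regular_on fibre_coords (fibre_set t)"
  shows "\<exists>N c. (\<exists>i<N. \<exists>j<N. \<exists>k<N. c i j k \<noteq> 0) \<and>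
    (\<forall>q\<in>fibre_set t. (\<Sum>i<N. \<Sum>j<N. \<Sum>k<N. c i j k * (x q ^ i * y q ^ j * z q ^ k)) = (0 :: complex))"
proof -
  obtain dx where dx: "x \<in> bounded_deg dx t" using bounded_deg_exists[OF assms(1)] ..
  obtain dy where dy: "y \<in> bounded_deg dy t" using bounded_deg_exists[OF assms(2)] ..
  obtain dz where dz: "z \<in> bounded_deg dz t" using bounded_deg_exists[OF assms(3)] ..
  define d where "d = dx + dy + dz + 1"
  have xyz: "x \<in> bounded_deg d t" "y \<in> bounded_deg d t" "z \<in> bounded_deg d t"
    by (rule bounded_deg_mono[OF dx] bounded_deg_mono[OF dy] bounded_deg_mono[OF dz],
        simp add: d_def)+
  define N where "N = 32 * d ^ 2 + 1"
  define I where "I = {..<N} \<times> {..<N} \<times> {..<N}"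
  define m where "m = (\<lambda>(i, j, k) q. x q ^ i * y q ^ j * z q ^ k)"
  have "m l \<in> bounded_deg (3 * d * N) t" if "l \<in> I" for l
  proof -
    obtain i j k where l: "l = (i, j, k)" by (cases l) auto
    have "m l \<in> bounded_deg (d * i + d * j + d * k) t"
      unfolding m_def l prod.case by (intro bounded_deg_mult bounded_deg_power xyz)
    moreover have "d * i \<le> d * N" "d * j \<le> d * N" "d * k \<le> d * N"
      using that by (auto simp: I_def l)
    hence "d * i + d * j + d * k \<le> 3 * d * N" by linarith
    ultimately show ?thesis by (rule bounded_deg_mono)
  qed
  moreover have "card {k. quot_deg k \<le> 3 * d * N} < card I"
  proof -
    have "1 \<le> d * N" by (simp add: d_def N_def)
    hence "(3 * d * N + 1) ^ 2 \<le> (4 * d * N) ^ 2" by (intro power_mono) auto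
    hence "card {k. quot_deg k \<le> 3 * d * N} \<le> 2 * (4 * d * N) ^ 2"
      using quot_deg_count(2)[of "3 * d * N"] by linarith
    also have "\<dots> = (32 * d ^ 2) * N ^ 2" by (simp add: power_mult_distrib)
    also have "\<dots> < N * N ^ 2" by (rule mult_strict_right_mono) (auto simp: N_def)
    also have "\<dots> = card I" by (simp add: I_def card_cartesian_product power2_eq_square)
    finally show ?thesis .
  qed
  ultimately have "\<exists>c. (\<exists>l\<in>I. c l \<noteq> 0) \<and> (\<forall>q\<in>fibre_set t. (\<Sum>l\<in>I. c l * m l q) = 0)"
    unfolding bounded_deg_def
    by (intro lincombs_dependent[of "{k. quot_deg k \<le> 3 * d * N}"] quot_deg_count(1))
       (simp_all add: I_def)
  then obtain c where c: "\<exists>l\<in>I. c l \<noteq> 0" "\<forall>q\<in>fibre_set t. (\<Sum>l\<in>I. c l * m l q) = 0"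
    by (elim exE conjE)
  have "(\<Sum>l\<in>I. c l * m l q) =
      (\<Sum>i<N. \<Sum>j<N. \<Sum>k<N. c (i, j, k) * (x q ^ i * y q ^ j * z q ^ k))" for q
    by (simp add: I_def m_def sum.cartesian_product case_prod_unfold)
  with c show ?thesis
    by (intro exI[of _ N] exI[of _ "\<lambda>i j k. c (i, j, k)"]) (auto simp: I_def)
qed

lemma fibre_local_dim:
  assumes "p \<in> fibre_set t"
  shows "local_dim (affine_variety fibre_coords (fibre_set t)) p \<le> enat 2"
  using assms fibre_functions_dependent by (rule local_dim_le_2)


section \<open>Tangent spaces\<close>

lemma tangent_spaceI:
  assumes "\<And>f. f \<notin> regfuns (affine_variety C S) \<Longrightarrow> D f = 0"
    and "\<And>f g. f \<in> regular_on C S \<Longrightarrow> g \<in> regular_on C S \<Longrightarrow>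
      D (\<lambda>q\<in>S. f q + g q) = D (restrict f S) + D (restrict g S)"
    and "\<And>c f. f \<in> regular_on C S \<Longrightarrow> D (\<lambda>q\<in>S. c * f q) = c * D (restrict f S)"
    and "\<And>f g. f \<in> regular_on C S \<Longrightarrow> g \<in> regular_on C S \<Longrightarrow>
      D (\<lambda>q\<in>S. f q * g q) = f p * D (restrict g S) + g p * D (restrict f S)"
  shows "D \<in> tangent_space (affine_variety C S) p"
proof -
  have r: "f \<in> regular_on C S" "restrict f S = f" if "f \<in> regfuns (affine_variety C S)" for f
    using that regfuns_extensional[OF that] by (simp_all add: regfuns_affine_variety)
  show ?thesis
    unfolding tangent_space_def
  proof (intro CollectI conjI allI impI ballI)
    fix f g assume f: "f \<in> regfuns (affine_variety C S)" and g: "g \<in> regfuns (affine_variety C S)"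
    show "D (f \<oplus>\<^bsub>coord_ring (affine_variety C S)\<^esub> g) = D f + D g"
      using assms(2)[OF r(1)[OF f] r(1)[OF g]] r(2)[OF f] r(2)[OF g] by simp
    show "D (f \<otimes>\<^bsub>coord_ring (affine_variety C S)\<^esub> g) = f p * D g + g p * D f"
      using assms(4)[OF r(1)[OF f] r(1)[OF g]] r(2)[OF f] r(2)[OF g] by simp
  next
    fix c f assume f: "f \<in> regfuns (affine_variety C S)"
    show "D (\<lambda>q\<in>points (affine_variety C S). c * f q) = c * D f"
      using assms(3)[OF r(1)[OF f]] r(2)[OF f] by simp
  qed (rule assms(1))
qed

context
  fixes C :: "('a \<Rightarrow> complex) set" and S p D
  assumes D: "D \<in> tangent_space (affine_variety C S) p"
begin

lemma tangent_outside: "f \<notin> regfuns (affine_variety C S) \<Longrightarrow> D f = 0"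
  using D by (auto simp: tangent_space_def)

lemma tangent_add:
  assumes "f \<in> regular_on C S" "g \<in> regular_on C S"
  shows "D (\<lambda>q\<in>S. f q + g q) = D (restrict f S) + D (restrict g S)"
proof -
  have "D (restrict f S \<oplus>\<^bsub>coord_ring (affine_variety C S)\<^esub> restrict g S) = D (restrict f S) + D (restrict g S)"
    using D assms unfolding tangent_space_def by (simp del: coord_ring_simps)
  moreover have "restrict f S \<oplus>\<^bsub>coord_ring (affine_variety C S)\<^esub> restrict g S = (\<lambda>q\<in>S. f q + g q)"
    by auto
  ultimately show ?thesis by simp
qed

lemma tangent_scale:
  assumes "f \<in> regular_on C S"
  shows "D (\<lambda>q\<in>S. c * f q) = c * D (restrict f S)"
proof -
  have "D (\<lambda>q\<in>points (affine_variety C S). c * restrict f S q) = c * D (restrict f S)"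
    using D assms unfolding tangent_space_def mem_Collect_eq by (metis restrict_in_regfuns)
  moreover have "(\<lambda>q\<in>points (affine_variety C S). c * restrict f S q) = (\<lambda>q\<in>S. c * f q)"
    by auto
  ultimately show ?thesis by simp
qed

lemma tangent_mult:
  assumes "p \<in> S" "f \<in> regular_on C S" "g \<in> regular_on C S"
  shows "D (\<lambda>q\<in>S. f q * g q) = f p * D (restrict g S) + g p * D (restrict f S)"
proof -
  have "D (restrict f S \<otimes>\<^bsub>coord_ring (affine_variety C S)\<^esub> restrict g S) =
      restrict f S p * D (restrict g S) + restrict g S p * D (restrict f S)"
    using D assms unfolding tangent_space_def by (simp del: coord_ring_simps)
  moreover have "restrict f S \<otimes>\<^bsub>coord_ring (affine_variety C S)\<^esub> restrict g S = (\<lambda>q\<in>S. f q * g q)"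
    by auto
  ultimately show ?thesis using assms(1) by simp
qed

lemma tangent_const:
  assumes "p \<in> S"
  shows "D (\<lambda>q\<in>S. c) = 0"
proof -
  have "D (\<lambda>q\<in>S. 1 * 1) = 1 * D (\<lambda>q\<in>S. 1) + 1 * D (\<lambda>q\<in>S. 1)"
    by (rule tangent_mult[OF assms regular_on_const regular_on_const])
  hence "D (\<lambda>q\<in>S. 1) = 0" by simp
  thus ?thesis using tangent_scale[OF regular_on_const, of c 1] by simp
qed

end

lemma tangent_space_determined:
  assumes D: "D \<in> tangent_space (affine_variety C S) p" "E \<in> tangent_space (affine_variety C S) p"
    and p: "p \<in> S" and C: "\<And>g. g \<in> C \<Longrightarrow> D (restrict g S) = E (restrict g S)"
  shows "D = E"
proof
  fix f
  show "D f = E f"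
  proof (cases "f \<in> regfuns (affine_variety C S)")
    case True
    then obtain g where g: "g \<in> polyfuns C" "f = restrict g S" by (auto simp: affine_variety_def)
    from g(1) have "D (restrict g S) = E (restrict g S)"
    proof induction
      case (add g h)
      note r = regular_on_polyfun[OF add.hyps(1), of S] regular_on_polyfun[OF add.hyps(2), of S]
      show ?case unfolding tangent_add[OF D(1) r] tangent_add[OF D(2) r] add.IH ..
    next
      case (mult g h)
      note r = regular_on_polyfun[OF mult.hyps(1), of S] regular_on_polyfun[OF mult.hyps(2), of S]
      show ?case unfolding tangent_mult[OF D(1) p r] tangent_mult[OF D(2) p r] mult.IH ..
    next
      case (const c)
      show ?case unfolding tangent_const[OF D(1) p] tangent_const[OF D(2) p] ..
    qed (rule C)
    thus ?thesis using g by simp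
  qed (simp add: tangent_outside[OF D(1)] tangent_outside[OF D(2)])
qed

lemma subspace_tangent_space:
  assumes p: "p \<in> S"
  shows "fs.subspace (tangent_space (affine_variety C S) p)"
proof (rule fs.subspaceI)
  show "0 \<in> tangent_space (affine_variety C S) p"
    by (rule tangent_spaceI) simp_all
next
  fix D E assume D: "D \<in> tangent_space (affine_variety C S) p" "E \<in> tangent_space (affine_variety C S) p"
  show "D + E \<in> tangent_space (affine_variety C S) p"
    by (rule tangent_spaceI)
       (simp_all add: tangent_outside[OF D(1)] tangent_outside[OF D(2)] tangent_add[OF D(1)]
         tangent_add[OF D(2)] tangent_scale[OF D(1)] tangent_scale[OF D(2)]
         tangent_mult[OF D(1) p] tangent_mult[OF D(2) p] algebra_simps)
next
  fix c D assume D: "D \<in> tangent_space (affine_variety C S) p"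
  show "(\<lambda>f. c * D f) \<in> tangent_space (affine_variety C S) p"
    by (rule tangent_spaceI)
       (simp_all add: tangent_outside[OF D] tangent_add[OF D] tangent_scale[OF D]
         tangent_mult[OF D p] algebra_simps)
qed

lemma dual_functionals_independent:
  fixes D1 D2 D3 :: "'b \<Rightarrow> complex"
  assumes dual: "D1 r1 = 1" "D1 r2 = 0" "D1 r3 = 0" "D2 r1 = 0" "D2 r2 = 1" "D2 r3 = 0"
    "D3 r1 = 0" "D3 r2 = 0" "D3 r3 = 1"
  shows "fs.independent {D1, D2, D3}" "card {D1, D2, D3} = 3"
proof -
  have ne: "D1 \<noteq> D2" "D1 \<noteq> D3" "D2 \<noteq> D3" using dual by (metis zero_neq_one)+
  show "card {D1, D2, D3} = 3" using ne by simp
  show "fs.independent {D1, D2, D3}"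
  proof (rule fs.independent_if_scalars_zero)
    fix u x assume sum: "(\<Sum>x\<in>{D1, D2, D3}. (\<lambda>f. u x * x f)) = 0" and x: "x \<in> {D1, D2, D3}"
    have eq: "u D1 * D1 f + u D2 * D2 f + u D3 * D3 f = 0" for f
      using fun_cong[OF sum, of f] ne by (simp add: add.assoc)
    have "u D1 = 0" "u D2 = 0" "u D3 = 0"
      using eq[of r1] eq[of r2] eq[of r3] by (simp_all add: dual)
    hence "\<forall>x\<in>{D1, D2, D3}. u x = 0" by blast
    thus "u x = 0" using x by (rule bspec)
  qed (intro finite.insertI finite.emptyI)
qed

text \<open>A derivation is determined by its values on the generators, so the dual derivations span.\<close>

lemma tangent_dim_3:
  assumes p: "p \<in> S"
    and D: "D1 \<in> tangent_space (affine_variety {f1, f2, f3} S) p"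
      "D2 \<in> tangent_space (affine_variety {f1, f2, f3} S) p"
      "D3 \<in> tangent_space (affine_variety {f1, f2, f3} S) p"
    and dual: "D1 (restrict f1 S) = 1" "D1 (restrict f2 S) = 0" "D1 (restrict f3 S) = 0"
      "D2 (restrict f1 S) = 0" "D2 (restrict f2 S) = 1" "D2 (restrict f3 S) = 0"
      "D3 (restrict f1 S) = 0" "D3 (restrict f2 S) = 0" "D3 (restrict f3 S) = 1"
  shows "tangent_dim (affine_variety {f1, f2, f3} S) p = 3"
  unfolding tangent_dim_def
proof (rule fs.dim_unique)
  let ?T = "tangent_space (affine_variety {f1, f2, f3} S) p"
  show "{D1, D2, D3} \<subseteq> ?T" by (intro insert_subsetI empty_subsetI D)
  show "fs.independent {D1, D2, D3}" "card {D1, D2, D3} = 3"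
    by (rule dual_functionals_independent[of D1, OF dual])+
  show "?T \<subseteq> fs.span {D1, D2, D3}"
  proof
    fix E assume E: "E \<in> ?T"
    define F where "F = (\<lambda>f. E (restrict f1 S) * D1 f) +
      ((\<lambda>f. E (restrict f2 S) * D2 f) + (\<lambda>f. E (restrict f3 S) * D3 f))"
    note T = subspace_tangent_space[OF p, of "{f1, f2, f3}"]
    have FT: "F \<in> ?T"
      unfolding F_def
      by (rule fs.subspace_add[OF T fs.subspace_scale[OF T D(1)]
            fs.subspace_add[OF T fs.subspace_scale[OF T D(2)] fs.subspace_scale[OF T D(3)]]])
    have F: "F f = E (restrict f1 S) * D1 f + (E (restrict f2 S) * D2 f + E (restrict f3 S) * D3 f)" for f
      by (simp add: F_def)
    have "E (restrict f1 S) = F (restrict f1 S)" "E (restrict f2 S) = F (restrict f2 S)"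
      "E (restrict f3 S) = F (restrict f3 S)"
      unfolding F dual by simp_all
    hence "E (restrict g S) = F (restrict g S)" if "g \<in> {f1, f2, f3}" for g
      using that by blast
    from tangent_space_determined[OF E FT p this] have "E = F" .
    moreover have "F \<in> fs.span {D1, D2, D3}"
      unfolding F_def
      by (rule fs.span_add[OF fs.span_scale fs.span_add[OF fs.span_scale fs.span_scale]])
         (rule fs.span_base, simp)+
    ultimately show "E \<in> fs.span {D1, D2, D3}" by simp
  qed
qed


section \<open>A singular point on each fibre\<close>

lemma fibre_normal_form:
  assumes "f \<in> regular_on fibre_coords (fibre_set t)"
  shows "\<exists>P Q. P \<in> regular_on coords2 UNIV \<and> Q \<in> regular_on coords2 UNIV \<and>
    (\<forall>p\<in>fibre_set t. f p = P (quot_a p, quot_w p) + quot_v p * Q (quot_a p, quot_w p))"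
proof -
  let ?N = "\<lambda>f. \<exists>P Q. P \<in> regular_on coords2 UNIV \<and> Q \<in> regular_on coords2 UNIV \<and>
    (\<forall>p\<in>fibre_set t. f p = P (quot_a p, quot_w p) + quot_v p * Q (quot_a p, quot_w p))"
  obtain g where g: "g \<in> polyfuns fibre_coords" "\<And>p. p \<in> fibre_set t \<Longrightarrow> f p = g p"
    using assms by (auto simp: regular_on_def)
  from g(1) have "?N g"
  proof induction
    case (coord h)
    then consider "h = quot_a" | "h = quot_w" | "h = quot_v" by blast
    thus ?case
    proof cases
      case 1
      show ?thesis
        by (rule exI[of _ fst], rule exI[of _ "\<lambda>_. 0"])
           (simp add: 1 regular_on_fst_snd regular_on_const)
    next
      case 2
      show ?thesis
        by (rule exI[of _ snd], rule exI[of _ "\<lambda>_. 0"])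
           (simp add: 2 regular_on_fst_snd regular_on_const)
    next
      case 3
      show ?thesis
        by (rule exI[of _ "\<lambda>_. 0"], rule exI[of _ "\<lambda>_. 1"]) (simp add: 3 regular_on_const)
    qed
  next
    case (const c)
    show ?case
      by (rule exI[of _ "\<lambda>_. c"], rule exI[of _ "\<lambda>_. 0"]) (simp add: regular_on_const)
  next
    case (add f g)
    then obtain P Q P' Q' where
      "P \<in> regular_on coords2 UNIV" "Q \<in> regular_on coords2 UNIV"
      "\<forall>p\<in>fibre_set t. f p = P (quot_a p, quot_w p) + quot_v p * Q (quot_a p, quot_w p)"
      "P' \<in> regular_on coords2 UNIV" "Q' \<in> regular_on coords2 UNIV"
      "\<forall>p\<in>fibre_set t. g p = P' (quot_a p, quot_w p) + quot_v p * Q' (quot_a p, quot_w p)"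
      by (elim exE conjE)
    thus ?case
      by (intro exI[of _ "\<lambda>x. P x + P' x"] exI[of _ "\<lambda>x. Q x + Q' x"])
         (simp add: regular_on_add algebra_simps)
  next
    case (mult f g)
    then obtain P Q P' Q' where PQ:
      "P \<in> regular_on coords2 UNIV" "Q \<in> regular_on coords2 UNIV"
      "\<forall>p\<in>fibre_set t. f p = P (quot_a p, quot_w p) + quot_v p * Q (quot_a p, quot_w p)"
      "P' \<in> regular_on coords2 UNIV" "Q' \<in> regular_on coords2 UNIV"
      "\<forall>p\<in>fibre_set t. g p = P' (quot_a p, quot_w p) + quot_v p * Q' (quot_a p, quot_w p)"
      by (elim exE conjE)
    let ?G = "\<lambda>x. quot_poly t (fst x) (snd x)"
    have "?G \<in> regular_on coords2 UNIV"
      unfolding quot_poly_def by (intro regular_on_intros regular_on_fst_snd)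
    hence "(\<lambda>x. P x * P' x + ?G x * (Q x * Q' x)) \<in> regular_on coords2 UNIV"
      "(\<lambda>x. P x * Q' x + P' x * Q x) \<in> regular_on coords2 UNIV"
      by (intro regular_on_add regular_on_mult PQ; assumption)+
    moreover have "f p * g p = (P x * P' x + ?G x * (Q x * Q' x)) + quot_v p * (P x * Q' x + P' x * Q x)"
      if "p \<in> fibre_set t" "x = (quot_a p, quot_w p)" for p x
    proof -
      have "f p * g p = (P x + quot_v p * Q x) * (P' x + quot_v p * Q' x)"
        using PQ that by simp
      also have "\<dots> = P x * P' x + quot_v p ^ 2 * (Q x * Q' x) + quot_v p * (P x * Q' x + P' x * Q x)"
        by (simp add: algebra_simps power2_eq_square)
      finally show ?thesis using fibre_set_eq[OF that(1)] that(2) by simp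
    qed
    ultimately show ?case
      by (intro exI[of _ "\<lambda>x. P x * P' x + ?G x * (Q x * Q' x)"] exI[of _ "\<lambda>x. P x * Q' x + P' x * Q x"])
         simp
  qed
  then obtain P Q where "P \<in> regular_on coords2 UNIV" "Q \<in> regular_on coords2 UNIV"
    "\<forall>p\<in>fibre_set t. g p = P (quot_a p, quot_w p) + quot_v p * Q (quot_a p, quot_w p)"
    by (elim exE conjE)
  thus ?thesis by (intro exI[of _ P] exI[of _ Q]) (simp add: g(2))
qed

definition sheets :: "C2 \<Rightarrow> (C5 set \<Rightarrow> complex) \<Rightarrow> (C2 \<Rightarrow> complex) \<times> (C2 \<Rightarrow> complex)" where
  "sheets t f = (SOME (P, Q). P \<in> regular_on coords2 UNIV \<and> Q \<in> regular_on coords2 UNIV \<and>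
    (\<forall>p\<in>fibre_set t. f p = P (quot_a p, quot_w p) + quot_v p * Q (quot_a p, quot_w p)))"

lemma sheets_eqI:
  assumes PQ: "P \<in> regular_on coords2 UNIV" "Q \<in> regular_on coords2 UNIV"
    "\<And>p. p \<in> fibre_set t \<Longrightarrow> f p = P (quot_a p, quot_w p) + quot_v p * Q (quot_a p, quot_w p)"
  shows "sheets t f = (P, Q)"
  unfolding sheets_def
proof (rule some_equality)
  fix R assume "case R of (P', Q') \<Rightarrow> P' \<in> regular_on coords2 UNIV \<and> Q' \<in> regular_on coords2 UNIV \<and>
    (\<forall>p\<in>fibre_set t. f p = P' (quot_a p, quot_w p) + quot_v p * Q' (quot_a p, quot_w p))"
  then obtain P' Q' where R: "R = (P', Q')" "P' \<in> regular_on coords2 UNIV" "Q' \<in> regular_on coords2 UNIV"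
    "\<forall>p\<in>fibre_set t. f p = P' (quot_a p, quot_w p) + quot_v p * Q' (quot_a p, quot_w p)"
    by (cases R) simp
  have d: "(\<lambda>x. P' x - P x) \<in> regular_on coords2 UNIV" "(\<lambda>x. Q' x - Q x) \<in> regular_on coords2 UNIV"
    using R PQ by (auto intro: regular_on_diff)
  have "(P' (a, w) - P (a, w)) + v * (Q' (a, w) - Q (a, w)) = 0" if v: "v ^ 2 = quot_poly t a w" for a w v
  proof -
    obtain p where "p \<in> fibre_set t" "quot_a p = a" "quot_w p = w" "quot_v p = v"
      using fibre_set_surj[OF v] by blast
    thus ?thesis using R(4) PQ(3)[of p] by (auto simp: algebra_simps)
  qed
  from sheets_independent[OF d this]
  have "P' = P" "Q' = Q" by (simp_all add: fun_eq_iff)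
  thus "R = (P, Q)" using R(1) by simp
qed (use PQ in simp)

text \<open>
  Functions on the fibre are pairs \<open>(P, Q)\<close>, meaning \<open>P + v Q\<close>, and multiply by the rule
  \<open>v\<^sup>2 = quot_poly\<close>. At a point with \<open>v = 0\<close> a tangent vector is therefore a linear functional \<open>\<delta>\<close> on
  pairs that satisfies the product rule for this multiplication.
\<close>

lemma tangent_from_sheets:
  assumes p: "p \<in> fibre_set t" "quot_a p = a" "quot_w p = 0" "quot_v p = 0"
    and add: "\<And>P Q P' Q'. P \<in> regular_on coords2 UNIV \<Longrightarrow> Q \<in> regular_on coords2 UNIV \<Longrightarrow>
      P' \<in> regular_on coords2 UNIV \<Longrightarrow> Q' \<in> regular_on coords2 UNIV \<Longrightarrow>
      \<delta> (\<lambda>x. P x + P' x, \<lambda>x. Q x + Q' x) = \<delta> (P, Q) + \<delta> (P', Q')"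
    and scale: "\<And>P Q c. P \<in> regular_on coords2 UNIV \<Longrightarrow> Q \<in> regular_on coords2 UNIV \<Longrightarrow>
      \<delta> (\<lambda>x. c * P x, \<lambda>x. c * Q x) = c * \<delta> (P, Q)"
    and mult: "\<And>P Q P' Q'. P \<in> regular_on coords2 UNIV \<Longrightarrow> Q \<in> regular_on coords2 UNIV \<Longrightarrow>
      P' \<in> regular_on coords2 UNIV \<Longrightarrow> Q' \<in> regular_on coords2 UNIV \<Longrightarrow>
      \<delta> (\<lambda>x. P x * P' x + quot_poly t (fst x) (snd x) * (Q x * Q' x), \<lambda>x. P x * Q' x + P' x * Q x)
        = P (a, 0) * \<delta> (P', Q') + P' (a, 0) * \<delta> (P, Q)"
  shows "\<exists>D\<in>tangent_space (affine_variety fibre_coords (fibre_set t)) p.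
    D (restrict quot_a (fibre_set t)) = \<delta> (fst, \<lambda>_. 0) \<and>
    D (restrict quot_w (fibre_set t)) = \<delta> (snd, \<lambda>_. 0) \<and>
    D (restrict quot_v (fibre_set t)) = \<delta> (\<lambda>_. 0, \<lambda>_. 1)"
proof (rule bexI, intro conjI)
  define D where "D = (\<lambda>f. if f \<in> regfuns (affine_variety fibre_coords (fibre_set t))
      then \<delta> (sheets t f) else 0)"
  have D: "D (restrict f (fibre_set t)) = \<delta> (P, Q)"
    if f: "f \<in> regular_on fibre_coords (fibre_set t)"
      "P \<in> regular_on coords2 UNIV" "Q \<in> regular_on coords2 UNIV"
      "\<And>p. p \<in> fibre_set t \<Longrightarrow> f p = P (quot_a p, quot_w p) + quot_v p * Q (quot_a p, quot_w p)"
    for f P Q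
    using sheets_eqI[OF f(2,3), of t "restrict f (fibre_set t)"] f(1,4) by (simp add: D_def)
  show "D (restrict quot_a (fibre_set t)) = \<delta> (fst, \<lambda>_. 0)"
    by (rule D) (simp_all add: regular_on_coord regular_on_fst_snd regular_on_const)
  show "D (restrict quot_w (fibre_set t)) = \<delta> (snd, \<lambda>_. 0)"
    by (rule D) (simp_all add: regular_on_coord regular_on_fst_snd regular_on_const)
  show "D (restrict quot_v (fibre_set t)) = \<delta> (\<lambda>_. 0, \<lambda>_. 1)"
    by (rule D) (simp_all add: regular_on_coord regular_on_fst_snd regular_on_const)
  show "D \<in> tangent_space (affine_variety fibre_coords (fibre_set t)) p"
  proof (rule tangent_spaceI)
    fix f assume "f \<notin> regfuns (affine_variety fibre_coords (fibre_set t))"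
    thus "D f = 0" by (simp add: D_def)
  next
    fix c f assume f: "f \<in> regular_on fibre_coords (fibre_set t)"
    from fibre_normal_form[OF f] obtain P Q where
      PQ: "P \<in> regular_on coords2 UNIV" "Q \<in> regular_on coords2 UNIV"
      "\<forall>p\<in>fibre_set t. f p = P (quot_a p, quot_w p) + quot_v p * Q (quot_a p, quot_w p)"
      by (elim exE conjE)
    have "D (\<lambda>q\<in>fibre_set t. c * f q) = \<delta> (\<lambda>x. c * P x, \<lambda>x. c * Q x)"
      by (rule D) (use f PQ in \<open>auto intro!: regular_on_mult regular_on_const simp: algebra_simps\<close>)
    moreover have "D (restrict f (fibre_set t)) = \<delta> (P, Q)"
      by (rule D) (use f PQ in auto)
    ultimately show "D (\<lambda>q\<in>fibre_set t. c * f q) = c * D (restrict f (fibre_set t))"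
      by (simp add: scale[OF PQ(1,2)])
  next
    fix f g assume f: "f \<in> regular_on fibre_coords (fibre_set t)"
      and g: "g \<in> regular_on fibre_coords (fibre_set t)"
    from fibre_normal_form[OF f] obtain P Q where
      PQ: "P \<in> regular_on coords2 UNIV" "Q \<in> regular_on coords2 UNIV"
      "\<forall>p\<in>fibre_set t. f p = P (quot_a p, quot_w p) + quot_v p * Q (quot_a p, quot_w p)"
      by (elim exE conjE)
    from fibre_normal_form[OF g] obtain P' Q' where
      PQ': "P' \<in> regular_on coords2 UNIV" "Q' \<in> regular_on coords2 UNIV"
      "\<forall>p\<in>fibre_set t. g p = P' (quot_a p, quot_w p) + quot_v p * Q' (quot_a p, quot_w p)"
      by (elim exE conjE)
    have Df: "D (restrict f (fibre_set t)) = \<delta> (P, Q)" by (rule D) (use f PQ in auto)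
    have Dg: "D (restrict g (fibre_set t)) = \<delta> (P', Q')" by (rule D) (use g PQ' in auto)
    have "D (\<lambda>q\<in>fibre_set t. f q + g q) = \<delta> (\<lambda>x. P x + P' x, \<lambda>x. Q x + Q' x)"
      by (rule D) (use f g PQ PQ' in \<open>auto intro!: regular_on_add simp: algebra_simps\<close>)
    thus "D (\<lambda>q\<in>fibre_set t. f q + g q) = D (restrict f (fibre_set t)) + D (restrict g (fibre_set t))"
      by (simp add: add[OF PQ(1,2) PQ'(1,2)] Df Dg)
    let ?G = "\<lambda>x. quot_poly t (fst x) (snd x)"
    have G: "?G \<in> regular_on coords2 UNIV"
      unfolding quot_poly_def by (intro regular_on_intros regular_on_fst_snd)
    have "D (\<lambda>q\<in>fibre_set t. f q * g q) = \<delta> (\<lambda>x. P x * P' x + ?G x * (Q x * Q' x), \<lambda>x. P x * Q' x + P' x * Q x)"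
    proof (rule D)
      fix q assume q: "q \<in> fibre_set t"
      define x where "x = (quot_a q, quot_w q)"
      have "f q * g q = (P x + quot_v q * Q x) * (P' x + quot_v q * Q' x)"
        using PQ PQ' q by (simp add: x_def)
      also have "\<dots> = P x * P' x + quot_v q ^ 2 * (Q x * Q' x) + quot_v q * (P x * Q' x + P' x * Q x)"
        by (simp add: algebra_simps power2_eq_square)
      finally show "f q * g q = (P (quot_a q, quot_w q) * P' (quot_a q, quot_w q) +
          ?G (quot_a q, quot_w q) * (Q (quot_a q, quot_w q) * Q' (quot_a q, quot_w q))) +
          quot_v q * (P (quot_a q, quot_w q) * Q' (quot_a q, quot_w q) +
            P' (quot_a q, quot_w q) * Q (quot_a q, quot_w q))"
        using fibre_set_eq[OF q] by (simp add: x_def)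
    qed (intro regular_on_add regular_on_mult f g G PQ(1,2) PQ'(1,2))+
    moreover have "f p = P (a, 0)" "g p = P' (a, 0)" using PQ(3) PQ'(3) p by simp_all
    ultimately show "D (\<lambda>q\<in>fibre_set t. f q * g q) =
        f p * D (restrict g (fibre_set t)) + g p * D (restrict f (fibre_set t))"
      by (simp add: mult[OF PQ(1,2) PQ'(1,2)] Df Dg)
  qed
qed

lemma regular_on_coords2_differentiable:
  assumes "f \<in> regular_on coords2 UNIV"
    and \<gamma>: "(\<lambda>s. fst (\<gamma> s)) field_differentiable at s" "(\<lambda>s. snd (\<gamma> s)) field_differentiable at s"
  shows "(\<lambda>s. f (\<gamma> s)) field_differentiable at s"
proof -
  have "f \<in> polyfuns coords2" using assms(1) by (simp add: regular_on_UNIV)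
  thus ?thesis
  proof induction
    case (coord f)
    hence "f = fst \<or> f = snd" by (auto simp: coords2_def case_prod_unfold)
    thus ?case using \<gamma> by auto
  qed (auto intro: derivative_intros)
qed

text \<open>
  The point \<open>w = v = 0\<close>, \<open>a\<^sup>2 = 4 (t\<^sub>4 + t\<^sub>2\<^sup>2 / 8)\<close> is the image of a fixed point of \<open>sigma\<close>. There
  \<open>quot_poly\<close> vanishes together with its differential, so that the partial derivatives in \<open>a\<close>, \<open>w\<close>
  and the coefficient of \<open>v\<close> are three independent tangent vectors.
\<close>

lemma fibre_singular: "singular (fibre X_B2_mod_Omega alpha_B2_bar t)"
proof -
  obtain a where a: "a ^ 2 = 4 * (snd t + 1 / 8 * fst t ^ 2)" using power2_csqrt by blast
  have "0 ^ 2 = quot_poly t a 0" by (simp add: quot_poly_def)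
  then obtain p where p: "p \<in> fibre_set t" "quot_a p = a" "quot_w p = 0" "quot_v p = 0"
    using fibre_set_surj by blast
  let ?V = "affine_variety fibre_coords (fibre_set t)"
  let ?G = "\<lambda>x. quot_poly t (fst x) (snd x)"
  have G_reg: "?G \<in> regular_on coords2 UNIV"
    unfolding quot_poly_def by (intro regular_on_intros regular_on_fst_snd)
  define da where "da P = deriv (\<lambda>s. P (s, 0 :: complex)) a" for P :: "C2 \<Rightarrow> complex"
  define dw where "dw P = deriv (\<lambda>s. P (a, s)) 0" for P :: "C2 \<Rightarrow> complex"
  have diff: "(\<lambda>s. P (s, 0)) field_differentiable at a" "(\<lambda>s. P (a, s)) field_differentiable at 0"
    if "P \<in> regular_on coords2 UNIV" for P
    using regular_on_coords2_differentiable[OF that] by auto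
  have G0: "?G (a, 0) = 0" by (simp add: quot_poly_def)
  have daG: "da ?G = 0" by (simp add: da_def quot_poly_def)
  have dwG: "dw ?G = 0"
  proof -
    have "((\<lambda>s. quot_poly t a s) has_field_derivative
        (a ^ 2 - 4 * (0 ^ 2 + fst t * 0 + snd t + 1 / 8 * fst t ^ 2))) (at 0)"
      unfolding quot_poly_def by (auto intro!: derivative_eq_intros)
    moreover have "a ^ 2 - 4 * (0 ^ 2 + fst t * 0 + snd t + 1 / 8 * fst t ^ 2) = 0" using a by simp
    ultimately show ?thesis by (simp add: dw_def DERIV_imp_deriv)
  qed
  have d_add: "da (\<lambda>x. P x + P' x) = da P + da P'" "dw (\<lambda>x. P x + P' x) = dw P + dw P'"
    if "P \<in> regular_on coords2 UNIV" "P' \<in> regular_on coords2 UNIV" for P P'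
    unfolding da_def dw_def by (intro deriv_add diff that)+
  have d_mult: "da (\<lambda>x. P x * P' x) = P (a, 0) * da P' + P' (a, 0) * da P"
    "dw (\<lambda>x. P x * P' x) = P (a, 0) * dw P' + P' (a, 0) * dw P"
    if "P \<in> regular_on coords2 UNIV" "P' \<in> regular_on coords2 UNIV" for P P'
    unfolding da_def dw_def by (simp_all add: deriv_mult diff that mult.commute)
  have d_scale: "da (\<lambda>x. c * P x) = c * da P" "dw (\<lambda>x. c * P x) = c * dw P"
    if "P \<in> regular_on coords2 UNIV" for P c
    unfolding da_def dw_def by (intro deriv_cmult diff that)+
  have d_const: "da (\<lambda>_. c) = 0" "dw (\<lambda>_. c) = 0" for c by (simp_all add: da_def dw_def)
  have d_fst_snd: "da fst = 1" "da snd = 0" "dw fst = 0" "dw snd = 1"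
    by (simp_all add: da_def dw_def)
  have dG: "da (\<lambda>x. ?G x * (Q x * Q' x)) = 0" "dw (\<lambda>x. ?G x * (Q x * Q' x)) = 0"
    if Q: "Q \<in> regular_on coords2 UNIV" "Q' \<in> regular_on coords2 UNIV" for Q Q'
    unfolding d_mult[OF G_reg regular_on_mult[OF Q]] daG dwG G0 by simp_all
  have d_prod: "da (\<lambda>x. P x * P' x + ?G x * (Q x * Q' x)) = P (a, 0) * da P' + P' (a, 0) * da P"
    "dw (\<lambda>x. P x * P' x + ?G x * (Q x * Q' x)) = P (a, 0) * dw P' + P' (a, 0) * dw P"
    if P: "P \<in> regular_on coords2 UNIV" "P' \<in> regular_on coords2 UNIV"
      and Q: "Q \<in> regular_on coords2 UNIV" "Q' \<in> regular_on coords2 UNIV" for P P' Q Q'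
    unfolding d_add[OF regular_on_mult[OF P] regular_on_mult[OF G_reg regular_on_mult[OF Q]]]
      dG[OF Q] d_mult[OF P] by simp_all
  have "\<exists>D\<in>tangent_space ?V p. D (restrict quot_a (fibre_set t)) = da fst \<and>
      D (restrict quot_w (fibre_set t)) = da snd \<and> D (restrict quot_v (fibre_set t)) = da (\<lambda>_. 0)"
    by (rule tangent_from_sheets[OF p, where \<delta> = "\<lambda>(P, Q). da P", unfolded prod.case])
       (rule d_add(1) d_scale(1) d_prod(1); assumption)+
  then obtain D1 where D1: "D1 \<in> tangent_space ?V p" "D1 (restrict quot_a (fibre_set t)) = 1"
    "D1 (restrict quot_w (fibre_set t)) = 0" "D1 (restrict quot_v (fibre_set t)) = 0"
    unfolding d_fst_snd d_const by (elim bexE conjE)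
  have "\<exists>D\<in>tangent_space ?V p. D (restrict quot_a (fibre_set t)) = dw fst \<and>
      D (restrict quot_w (fibre_set t)) = dw snd \<and> D (restrict quot_v (fibre_set t)) = dw (\<lambda>_. 0)"
    by (rule tangent_from_sheets[OF p, where \<delta> = "\<lambda>(P, Q). dw P", unfolded prod.case])
       (rule d_add(2) d_scale(2) d_prod(2); assumption)+
  then obtain D2 where D2: "D2 \<in> tangent_space ?V p" "D2 (restrict quot_a (fibre_set t)) = 0"
    "D2 (restrict quot_w (fibre_set t)) = 1" "D2 (restrict quot_v (fibre_set t)) = 0"
    unfolding d_fst_snd d_const by (elim bexE conjE)
  have "\<exists>D\<in>tangent_space ?V p. D (restrict quot_a (fibre_set t)) = 0 \<and>
      D (restrict quot_w (fibre_set t)) = 0 \<and> D (restrict quot_v (fibre_set t)) = 1"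
    by (rule tangent_from_sheets[OF p, where \<delta> = "\<lambda>(P, Q). Q (a, 0)", unfolded prod.case]) simp_all
  then obtain D3 where D3: "D3 \<in> tangent_space ?V p" "D3 (restrict quot_a (fibre_set t)) = 0"
    "D3 (restrict quot_w (fibre_set t)) = 0" "D3 (restrict quot_v (fibre_set t)) = 1"
    by (elim bexE conjE)
  have "tangent_dim ?V p = 3"
    by (rule tangent_dim_3[OF p(1) D1(1) D2(1) D3(1) D1(2-4) D2(2-4) D3(2-4)])
  moreover have "local_dim ?V p \<le> enat 2" by (rule fibre_local_dim[OF p(1)])
  moreover have "\<not> enat 3 \<le> enat 2" by simp
  ultimately have "enat (tangent_dim ?V p) \<noteq> local_dim ?V p" by metis
  hence "singular_point ?V p" using p(1) by (simp add: singular_point_def)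
  thus ?thesis unfolding fibre_quot singular_def ..
qed

theorem mainTheorem5:
  shows "deformation X_B2_mod_Omega affine_plane alpha_B2_bar (0, 0) singularity_D4 \<and>
    (\<forall>t2 t4 :: complex. singular (fibre X_B2_mod_Omega alpha_B2_bar (t2, t4)))"
  using quotient_deformation fibre_singular by blast

end
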